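(* Let $(G,S)$ be the Cayley graph of a group of polynomial growth with homogeneous dimension $N$. (1) For $N\ge3$, $\alpha\in(0,N-2)$ and $1\le p<\frac{N-\alpha}{2}$, there exists a positive ground state solution for $p>1$, and a non-negative solution for $p=1$, of the equation $$\Delta_pu+(R_\alpha\ast u^p)u^{p-1}=0\quad\text{on }G.$$ (2) For $N\ge5$, $\alpha\in(0,N)$ and $p>\frac{N+\alpha}{N-4}$, there exists a positive ground state solution of the equation $$\Delta^2u-(R_\alpha\ast u^p)u^{p-1}=0\quad\text{on }G.$$ (3) For $N\ge5$, $\alpha\in(0,N-4)$ and $1<p<\frac{N-\alpha}{4}$, there exists a positive ground state solution of the equation $$\Delta\left(|\Delta u|^{p-2}\Delta u\right)-(R_\alpha\ast u^p)u^{p-1}=0\quad\text{on }G.$$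
   Context: $G$ is a group with a finite symmetric generating set $S=S^{-1}$. The Cayley graph $(G,S)$ has vertex set $G$, and $x\sim y$ iff $x=ys$ for some $s\in S$. $d^S$ is the word (graph) metric, $e$ is the unit element, and $\beta_S(n)=\#\{x\in G: d^S(e,x)\le n\}$. $G$ has polynomial growth with homogeneous dimension $N\in\mathbb N$ if there are constants $C_1,C_2>0$ with $C_1n^N\le\beta_S(n)\le C_2n^N$ for all $n\ge1$. For $u:G\to\mathbb R$ put $\nabla_{xy}u=u(y)-u(x)$ for $x\sim y$ and $\Delta u(x)=\sum_{y\sim x}\nabla_{xy}u$. For $p>1$, $\Delta_pu(x)=\sum_{y\sim x}|\nabla_{xy}u|^{p-2}\nabla_{xy}u$. For $p=1$, $\Delta_1u$ is set-valued: $\Delta_1u(x)=\{\sum_{y\sim x}f_{xy}: f_{xy}=-f_{yx},\ f_{xy}\in\mathrm{Sgn}(\nabla_{xy}u)\}$, with $\mathrm{Sgn}(t)=\{1\}$ for $t>0$, $[-1,1]$ for $t=0$, $\{-1\}$ for $t<0$; the equation in (1) with $p=1$ is understood accordingly, as $0$ belonging to the left-hand side. Norms: $\lVert u\rVert_{D^{1,q}}=\big(\sum_{x\in G}\sum_{y\sim x}|\nabla_{xy}u|^q\big)^{1/q}$ and $\lVert u\rVert_{D^{2,q}}=\lVert\Delta u\rVert_{\ell^q(G)}$. For $k=1,2$, $D^{k,q}(G)=\{u\in\ell^{Nq/(N-kq)}(G):\lVert u\rVert_{D^{k,q}}<\infty\}$. Let $k_t(x,y)$ be the heat kernel of $\Delta$,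 i.e. the kernel of the semigroup $e^{t\Delta}$. The Green's function of the fractional Laplacian $(-\Delta)^{\alpha/2}$ is $$R_\alpha(x,y)=\frac1{\Gamma(\alpha/2)}\int_0^\infty k_t(x,y)\,t^{-1+\alpha/2}\,dt,\qquad x,y\in G.$$ The nonlocal term is taken off the diagonal: $(R_\alpha\ast f)(x)=\sum_{y\in G,\,y\ne x}R_\alpha(x,y)f(y)$. Positive means $u(x)>0$ for all $x\in G$. The ground state solutions are those furnished by the associated variational problems: up to a positive multiplicative constant they are maximizers of $\sum_{x\in G}(R_\alpha\ast|u|^p)(x)|u(x)|^p$ over the functions $u$ of unit norm in $D^{1,p}(G)$ in case (1), $D^{2,2}(G)$ in case (2), and $D^{2,p}(G)$ in case (3). *)

theory Defs
  imports "HOL-Analysis.Analysis" "HOL-Algebra.Generated_Groups"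
begin

text \<open>Functions on the group are total functions on the underlying type; only their values on
  \<^term>\<open>carrier G\<close> matter, and every notion below looks only at those.\<close>

definition cayley_adj :: "('a, 'b) monoid_scheme \<Rightarrow> 'a set \<Rightarrow> 'a \<Rightarrow> 'a \<Rightarrow> bool" where
  "cayley_adj G S x y \<longleftrightarrow>
     x \<in> carrier G \<and> y \<in> carrier G \<and> (\<exists>s\<in>S. x = y \<otimes>\<^bsub>G\<^esub> s)"

definition nbrs :: "('a, 'b) monoid_scheme \<Rightarrow> 'a set \<Rightarrow> 'a \<Rightarrow> 'a set" where
  "nbrs G S x = {y. cayley_adj G S y x}"

definition word_dist :: "('a, 'b) monoid_scheme \<Rightarrow> 'a set \<Rightarrow> 'a \<Rightarrow> 'a \<Rightarrow> nat" where
  "word_dist G S x y = (LEAST n. (x, y) \<in> {(v, w). cayley_adj G S v w} ^^ n)"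

definition growth :: "('a, 'b) monoid_scheme \<Rightarrow> 'a set \<Rightarrow> nat \<Rightarrow> nat" where
  "growth G S n = card {x \<in> carrier G. word_dist G S \<one>\<^bsub>G\<^esub> x \<le> n}"

definition polynomial_growth :: "('a, 'b) monoid_scheme \<Rightarrow> 'a set \<Rightarrow> nat \<Rightarrow> bool" where
  "polynomial_growth G S N \<longleftrightarrow>
     (\<exists>C\<^sub>1 > 0. \<exists>C\<^sub>2 > 0. \<forall>n\<ge>1.
        C\<^sub>1 * real n ^ N \<le> real (growth G S n) \<and> real (growth G S n) \<le> C\<^sub>2 * real n ^ N)"

definition laplacian ::
  "('a, 'b) monoid_scheme \<Rightarrow> 'a set \<Rightarrow> ('a \<Rightarrow> real) \<Rightarrow> 'a \<Rightarrow> real" where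
  "laplacian G S u x = (\<Sum>y\<in>nbrs G S x. u y - u x)"

definition p_laplacian ::
  "('a, 'b) monoid_scheme \<Rightarrow> 'a set \<Rightarrow> real \<Rightarrow> ('a \<Rightarrow> real) \<Rightarrow> 'a \<Rightarrow> real" where
  "p_laplacian G S p u x = (\<Sum>y\<in>nbrs G S x. \<bar>u y - u x\<bar> powr (p - 2) * (u y - u x))"

definition Sgn :: "real \<Rightarrow> real set" where
  "Sgn t = (if t > 0 then {1} else if t = 0 then {-1..1} else {-1})"

text \<open>The set-valued 1-Laplacian, as a set of functions of \<^term>\<open>x\<close>: one antisymmetric edge
  function \<^term>\<open>f\<close> serves all vertices simultaneously. (If \<^term>\<open>f\<close> could be chosen afresh at every
  vertex, the antisymmetry condition would be void.)\<close>

definition laplacian_1 ::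
  "('a, 'b) monoid_scheme \<Rightarrow> 'a set \<Rightarrow> ('a \<Rightarrow> real) \<Rightarrow> ('a \<Rightarrow> real) set" where
  "laplacian_1 G S u =
     {(\<lambda>x. \<Sum>y\<in>nbrs G S x. f x y) | f.
        \<forall>x y. cayley_adj G S y x \<longrightarrow> f x y = - f y x \<and> f x y \<in> Sgn (u y - u x)}"

definition lp_space :: "('a, 'b) monoid_scheme \<Rightarrow> real \<Rightarrow> ('a \<Rightarrow> real) set" where
  "lp_space G q = {u. (\<lambda>x. \<bar>u x\<bar> powr q) summable_on carrier G}"

definition lp_norm :: "('a, 'b) monoid_scheme \<Rightarrow> real \<Rightarrow> ('a \<Rightarrow> real) \<Rightarrow> real" where
  "lp_norm G q u = (\<Sum>\<^sub>\<infinity>x\<in>carrier G. \<bar>u x\<bar> powr q) powr (1 / q)"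

definition D1_norm ::
  "('a, 'b) monoid_scheme \<Rightarrow> 'a set \<Rightarrow> real \<Rightarrow> ('a \<Rightarrow> real) \<Rightarrow> real" where
  "D1_norm G S q u =
     (\<Sum>\<^sub>\<infinity>x\<in>carrier G. \<Sum>y\<in>nbrs G S x. \<bar>u y - u x\<bar> powr q) powr (1 / q)"

definition D2_norm ::
  "('a, 'b) monoid_scheme \<Rightarrow> 'a set \<Rightarrow> real \<Rightarrow> ('a \<Rightarrow> real) \<Rightarrow> real" where
  "D2_norm G S q u = lp_norm G q (laplacian G S u)"

text \<open>Since \<^const>\<open>infsum\<close> is 0 on non-summable families, finiteness of the norms is expressed by
  summability.\<close>

definition D1_space ::
  "('a, 'b) monoid_scheme \<Rightarrow> 'a set \<Rightarrow> nat \<Rightarrow> real \<Rightarrow> ('a \<Rightarrow> real) set" where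
  "D1_space G S N q =
     {u \<in> lp_space G (N * q / (N - q)).
        (\<lambda>x. \<Sum>y\<in>nbrs G S x. \<bar>u y - u x\<bar> powr q) summable_on carrier G}"

definition D2_space ::
  "('a, 'b) monoid_scheme \<Rightarrow> 'a set \<Rightarrow> nat \<Rightarrow> real \<Rightarrow> ('a \<Rightarrow> real) set" where
  "D2_space G S N q =
     {u \<in> lp_space G (N * q / (N - 2 * q)). laplacian G S u \<in> lp_space G q}"

text \<open>The Laplacian is bounded, so the semigroup is given by the exponential series.\<close>

definition heat_semigroup ::
  "('a, 'b) monoid_scheme \<Rightarrow> 'a set \<Rightarrow> real \<Rightarrow> ('a \<Rightarrow> real) \<Rightarrow> 'a \<Rightarrow> real" where
  "heat_semigroup G S t u x = (\<Sum>n. t ^ n / fact n * (laplacian G S ^^ n) u x)"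

definition heat_kernel ::
  "('a, 'b) monoid_scheme \<Rightarrow> 'a set \<Rightarrow> real \<Rightarrow> 'a \<Rightarrow> 'a \<Rightarrow> real" where
  "heat_kernel G S t x y = heat_semigroup G S t (indicator {y}) x"

definition green :: "('a, 'b) monoid_scheme \<Rightarrow> 'a set \<Rightarrow> real \<Rightarrow> 'a \<Rightarrow> 'a \<Rightarrow> real" where
  "green G S \<alpha> x y =
     1 / Gamma (\<alpha> / 2) * (LINT t:{0<..}|lborel. heat_kernel G S t x y * t powr (-1 + \<alpha> / 2))"

definition green_conv ::
  "('a, 'b) monoid_scheme \<Rightarrow> 'a set \<Rightarrow> real \<Rightarrow> ('a \<Rightarrow> real) \<Rightarrow> 'a \<Rightarrow> real" where
  "green_conv G S \<alpha> f x = (\<Sum>\<^sub>\<infinity>y\<in>carrier G - {x}. green G S \<alpha> x y * f y)"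

definition green_conv_defined ::
  "('a, 'b) monoid_scheme \<Rightarrow> 'a set \<Rightarrow> real \<Rightarrow> ('a \<Rightarrow> real) \<Rightarrow> bool" where
  "green_conv_defined G S \<alpha> f \<longleftrightarrow>
     (\<forall>x\<in>carrier G. (\<lambda>y. green G S \<alpha> x y * f y) summable_on (carrier G - {x}))"

definition choquard ::
  "('a, 'b) monoid_scheme \<Rightarrow> 'a set \<Rightarrow> real \<Rightarrow> real \<Rightarrow> ('a \<Rightarrow> real) \<Rightarrow> real" where
  "choquard G S \<alpha> p u =
     (\<Sum>\<^sub>\<infinity>x\<in>carrier G. green_conv G S \<alpha> (\<lambda>y. \<bar>u y\<bar> powr p) x * \<bar>u x\<bar> powr p)"

definition choquard_finite ::
  "('a, 'b) monoid_scheme \<Rightarrow> 'a set \<Rightarrow> real \<Rightarrow> real \<Rightarrow> ('a \<Rightarrow> real) \<Rightarrow> bool" where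
  "choquard_finite G S \<alpha> p u \<longleftrightarrow>
     green_conv_defined G S \<alpha> (\<lambda>y. \<bar>u y\<bar> powr p) \<and>
     (\<lambda>x. green_conv G S \<alpha> (\<lambda>y. \<bar>u y\<bar> powr p) x * \<bar>u x\<bar> powr p) summable_on carrier G"

text \<open>\<^term>\<open>E\<close> and \<^term>\<open>nrm\<close> are the function space and norm of the variational problem. The
  finiteness requirement on all competitors excludes that a divergent sum, which
  \<^const>\<open>infsum\<close> evaluates to 0, is compared with the maximum.\<close>

definition choquard_maximizer ::
  "('a, 'b) monoid_scheme \<Rightarrow> 'a set \<Rightarrow> real \<Rightarrow> real \<Rightarrow> ('a \<Rightarrow> real) set \<Rightarrow>
     (('a \<Rightarrow> real) \<Rightarrow> real) \<Rightarrow> ('a \<Rightarrow> real) \<Rightarrow> bool" where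
  "choquard_maximizer G S \<alpha> p E nrm v \<longleftrightarrow>
     v \<in> E \<and> nrm v = 1 \<and>
     (\<forall>w\<in>E. nrm w = 1 \<longrightarrow> choquard_finite G S \<alpha> p w \<and> choquard G S \<alpha> p w \<le> choquard G S \<alpha> p v)"

definition ground_state ::
  "('a, 'b) monoid_scheme \<Rightarrow> 'a set \<Rightarrow> real \<Rightarrow> real \<Rightarrow> ('a \<Rightarrow> real) set \<Rightarrow>
     (('a \<Rightarrow> real) \<Rightarrow> real) \<Rightarrow> ('a \<Rightarrow> real) \<Rightarrow> bool" where
  "ground_state G S \<alpha> p E nrm u \<longleftrightarrow>
     (\<exists>c>0. \<exists>v. choquard_maximizer G S \<alpha> p E nrm v \<and> (\<forall>x\<in>carrier G. u x = c * v x))"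

text \<open>A solution is required to have a convergent nonlocal term at every vertex.\<close>

definition solves_p_laplace ::
  "('a, 'b) monoid_scheme \<Rightarrow> 'a set \<Rightarrow> real \<Rightarrow> real \<Rightarrow> ('a \<Rightarrow> real) \<Rightarrow> bool" where
  "solves_p_laplace G S \<alpha> p u \<longleftrightarrow>
     green_conv_defined G S \<alpha> (\<lambda>y. u y powr p) \<and>
     (\<forall>x\<in>carrier G.
        p_laplacian G S p u x + green_conv G S \<alpha> (\<lambda>y. u y powr p) x * u x powr (p - 1) = 0)"

text \<open>For \<^term>\<open>p = 1\<close>; the factor \<^term>\<open>u ^ (p - 1)\<close> is the constant 1, also where \<^term>\<open>u\<close> vanishes
  (note that \<^term>\<open>0 powr 0 = (0::real)\<close>, so \<^const>\<open>powr\<close> would not give this).\<close>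

definition solves_1_laplace ::
  "('a, 'b) monoid_scheme \<Rightarrow> 'a set \<Rightarrow> real \<Rightarrow> ('a \<Rightarrow> real) \<Rightarrow> bool" where
  "solves_1_laplace G S \<alpha> u \<longleftrightarrow>
     green_conv_defined G S \<alpha> u \<and>
     (\<exists>g\<in>laplacian_1 G S u. \<forall>x\<in>carrier G. g x + green_conv G S \<alpha> u x * u x ^ 0 = 0)"

definition solves_biharmonic ::
  "('a, 'b) monoid_scheme \<Rightarrow> 'a set \<Rightarrow> real \<Rightarrow> real \<Rightarrow> ('a \<Rightarrow> real) \<Rightarrow> bool" where
  "solves_biharmonic G S \<alpha> p u \<longleftrightarrow>
     green_conv_defined G S \<alpha> (\<lambda>y. u y powr p) \<and>
     (\<forall>x\<in>carrier G.
        laplacian G S (laplacian G S u) x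
          - green_conv G S \<alpha> (\<lambda>y. u y powr p) x * u x powr (p - 1) = 0)"

definition solves_p_biharmonic ::
  "('a, 'b) monoid_scheme \<Rightarrow> 'a set \<Rightarrow> real \<Rightarrow> real \<Rightarrow> ('a \<Rightarrow> real) \<Rightarrow> bool" where
  "solves_p_biharmonic G S \<alpha> p u \<longleftrightarrow>
     green_conv_defined G S \<alpha> (\<lambda>y. u y powr p) \<and>
     (\<forall>x\<in>carrier G.
        laplacian G S (\<lambda>z. \<bar>laplacian G S u z\<bar> powr (p - 2) * laplacian G S u z) x
          - green_conv G S \<alpha> (\<lambda>y. u y powr p) x * u x powr (p - 1) = 0)"

end

theory Submission
  imports Defs "HOL-Complex_Analysis.Great_Picard"
begin

text \<open>All three ground states are found by maximizing the energy
  \<open>Q u = \<Sum> k(x,y) \<bar>u(x)\<bar>^p \<bar>u(y)\<bar>^p\<close> subject to \<open>\<parallel>T u\<parallel>\<^sub>q = 1\<close>. Since the exponents are strictly supercritical,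
  Young's inequality bounds \<open>Q\<close> by an \<open>\<ell>\<^sup>r\<close> norm with \<open>r\<close> larger than the Sobolev exponent, so a
  maximizing sequence cannot vanish in \<open>\<ell>\<^sup>\<infinity>\<close>; translated so as to stay away from 0 at the unit it has a
  nonzero pointwise limit. By the Brezis--Lieb lemma, for \<open>Q\<close> and for the norm, the fraction \<open>a\<close> of the norm that is
  captured by the limit satisfies \<open>1 \<le> a^s + (1 - a)^s\<close> with \<open>s = 2p/q > 1\<close>, whence \<open>a = 1\<close>.

  The ingredients come from the growth of balls. Counting the pairs \<open>x \<in> A\<close>, \<open>x g \<notin> A\<close> for \<open>g\<close> in a ball of
  twice the size of \<open>A\<close> gives the isoperimetric inequality, and the co-area argument the Sobolev inequality for
  the gradient; testing \<open>- \<Delta> u = f\<close> with a power of \<open>u\<close> turns the latter into the one for the Laplacian. Nash's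
  argument yields the on-diagonal decay of the heat kernel and hence the summability of the Green function.

  Positivity follows by passing to \<open>\<bar>u\<bar>\<close>, or, for the Laplacian, to the solution of \<open>- \<Delta> v = \<bar>\<Delta> u\<bar>\<close>, and the
  minimum principle. For \<open>p = 1\<close> only a one-sided variational inequality is available; an antisymmetric selection
  of signs solving the equation is found by least squares over the compact convex set of all selections.\<close>

subsection \<open>Sums of powers\<close>

text \<open>The three parameter ranges are one condition: the Sobolev exponent \<open>m\<close>,
  equal to \<open>N p / (N - p)\<close>, \<open>2 N / (N - 4)\<close> or
  \<open>N p / (N - 2 p)\<close>, lies below the Hardy-Littlewood-Sobolev exponent
  \<open>2 N p / (N + \<alpha>)\<close>. An exponent \<open>r > p\<close> is fixed strictly between
  the two. The gap below \<open>r\<close> makes a small sup norm force a small energy. The gap above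
  \<open>r\<close> puts the kernel into an honest space of summable powers, so that Young's
  inequality suffices and only on-diagonal decay of the heat kernel is needed.

  The obstacle is translation invariance: a maximizing sequence may drift to infinity or split into
  distant pieces. Drift is undone by left translation, under which kernel and norms are invariant;
  splitting is excluded because the energy has degree \<open>2 p\<close>, larger than the degree
  \<open>q\<close> of the power sum that is normalised.

  Since the nonlocal term omits the diagonal, the energy is affine in each
  \<open>\<bar>u x\<bar> powr p\<close> separately. Varying one value at a time therefore gives the
  Euler-Lagrange equation without differentiating an infinite double sum. The constant in that
  equation is removed by rescaling, as the two sides have different degrees.\<close>

lemma summable_on_abs_le:
  fixes f g :: "'i \<Rightarrow> real"
  assumes "g summable_on A" "\<And>x. x \<in> A \<Longrightarrow> \<bar>f x\<bar> \<le> g x"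
  shows "f summable_on A"
  using Infinite_Sum.abs_summable_on_comparison_test'[of g A f] assms summable_on_iff_abs_summable_on_real[of f A]
  by simp

lemma nonneg_summable_on_bounded:
  fixes f :: "'i \<Rightarrow> real"
  assumes "\<And>x. x \<in> A \<Longrightarrow> 0 \<le> f x" "\<And>F. finite F \<Longrightarrow> F \<subseteq> A \<Longrightarrow> sum f F \<le> M"
  shows "f summable_on A" and "infsum f A \<le> M"
proof -
  show "f summable_on A"
    by (rule nonneg_bdd_above_summable_on) (use assms in \<open>auto intro!: bdd_aboveI2[where M=M]\<close>)
  then show "infsum f A \<le> M"
    by (rule infsum_le_finite_sums) (use assms in auto)
qed

lemma infsum_abs_le:
  fixes f g :: "'i \<Rightarrow> real"
  assumes "g summable_on A" "\<And>x. x \<in> A \<Longrightarrow> \<bar>f x\<bar> \<le> g x"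
  shows "\<bar>infsum f A\<bar> \<le> infsum g A"
proof -
  have f: "f summable_on A" using summable_on_abs_le[OF assms] .
  have "infsum f A \<le> infsum g A"
    by (rule infsum_mono[OF f assms(1)]) (use assms(2) in \<open>force simp: abs_le_iff\<close>)
  moreover have "infsum (\<lambda>x. - f x) A \<le> infsum g A"
    by (rule infsum_mono) (use f assms in \<open>auto simp: summable_on_uminus abs_le_iff\<close>)
  ultimately show ?thesis by (simp add: infsum_uminus)
qed

lemma infsum_tail_small:
  fixes h :: "'i \<Rightarrow> real"
  assumes "h summable_on A" "\<And>x. x \<in> A \<Longrightarrow> 0 \<le> h x" "e > 0"
  obtains F where "finite F" "F \<subseteq> A" "infsum h (A - F) < e"
proof -
  obtain F where F: "finite F" "F \<subseteq> A" "dist (sum h F) (infsum h A) \<le> e/2"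
    using infsum_finite_approximation[OF assms(1), of "e/2"] assms(3) by auto
  have "infsum h A = infsum h F + infsum h (A - F)"
    using infsum_Un_disjoint[of h F "A - F"] F assms(1)
    by (simp add: Un_absorb1 summable_on_subset_banach)
  then have "infsum h (A - F) \<le> e/2" using F by (simp add: dist_real_def)
  then show thesis using that[of F] F assms(3) by simp
qed

text \<open>A finite set carries all but \<open>e/4\<close> of the majorant; off it both tails are
  below \<open>e/4\<close>, and on it the convergence is that of a finite sum.\<close>

lemma infsum_dominated_convergence:
  fixes f :: "nat \<Rightarrow> 'i \<Rightarrow> real"
  assumes h: "h summable_on A" and b: "\<And>n x. x \<in> A \<Longrightarrow> \<bar>f n x\<bar> \<le> h x"
    and lim: "\<And>x. x \<in> A \<Longrightarrow> (\<lambda>n. f n x) \<longlonglongrightarrow> g x"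
  shows "g summable_on A" and "(\<lambda>n. infsum (f n) A) \<longlonglongrightarrow> infsum g A"
proof -
  have bg: "\<bar>g x\<bar> \<le> h x" if "x \<in> A" for x
    using LIMSEQ_le_const2[OF tendsto_rabs[OF lim[OF that]]] b[OF that] by blast
  show g: "g summable_on A" by (rule summable_on_abs_le[OF h bg])
  have f: "f n summable_on A" for n by (rule summable_on_abs_le[OF h b])
  have h0: "0 \<le> h x" if "x \<in> A" for x using bg[OF that] by linarith
  show "(\<lambda>n. infsum (f n) A) \<longlonglongrightarrow> infsum g A"
  proof (rule LIMSEQ_I)
    fix e :: real assume e: "e > 0"
    obtain F where F: "finite F" "F \<subseteq> A" "infsum h (A - F) < e/4"
      using infsum_tail_small[OF h h0, of "e/4"] e by auto
    have "(\<lambda>n. sum (f n) F) \<longlonglongrightarrow> sum g F" by (intro tendsto_sum lim) (use F in auto)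
    then obtain n0 where n0: "\<And>n. n \<ge> n0 \<Longrightarrow> norm (sum (f n) F - sum g F) < e/4"
      using LIMSEQ_D[of _ _ "e/4"] e by (metis divide_pos_pos zero_less_numeral)
    have hF: "h summable_on (A - F)" using h summable_on_subset_banach by blast
    have split: "infsum k A = sum k F + infsum k (A - F)" if "k summable_on A" for k :: "'i \<Rightarrow> real"
      using infsum_Un_disjoint[of k F "A - F"] F that
      by (simp add: Un_absorb1 summable_on_subset_banach)
    have "norm (infsum (f n) A - infsum g A) < e" if "n \<ge> n0" for n
    proof -
      have "\<bar>infsum (f n) (A - F)\<bar> \<le> infsum h (A - F)" by (rule infsum_abs_le[OF hF]) (use b in auto)
      moreover have "\<bar>infsum g (A - F)\<bar> \<le> infsum h (A - F)" by (rule infsum_abs_le[OF hF]) (use bg in auto)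
      ultimately show ?thesis using n0[OF that] F(3) split[OF f[of n]] split[OF g]
        unfolding real_norm_def by linarith
    qed
    then show "\<exists>no. \<forall>n\<ge>no. norm (infsum (f n) A - infsum g A) < e" by blast
  qed
qed

text \<open>The limiting step of both Brezis--Lieb lemmas. There is no single majorant for
  \<open>f n\<close>, only one up to \<open>e\<close> times a family \<open>g n\<close> with bounded
  sums; the excess over that family is dominated and tends to 0.\<close>

lemma infsum_tendsto_zero:
  fixes f g :: "nat \<Rightarrow> 'i \<Rightarrow> real"
  assumes f0: "\<And>n x. x \<in> A \<Longrightarrow> 0 \<le> f n x"
    and fs: "\<And>n. f n summable_on A"
    and lim: "\<And>x. x \<in> A \<Longrightarrow> (\<lambda>n. f n x) \<longlonglongrightarrow> 0"
    and gs: "\<And>n. g n summable_on A" and gM: "\<And>n. infsum (g n) A \<le> M"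
    and g0: "\<And>n x. x \<in> A \<Longrightarrow> 0 \<le> g n x"
    and dom: "\<And>e. e > 0 \<Longrightarrow> \<exists>h. h summable_on A \<and> (\<forall>n. \<forall>x\<in>A. f n x \<le> e * g n x + h x)"
  shows "(\<lambda>n. infsum (f n) A) \<longlonglongrightarrow> 0"
proof (rule LIMSEQ_I)
  fix e :: real assume e: "e > 0"
  \<comment> \<open>The maximum with 1 keeps \<open>d\<close> positive also when
    \<open>M = 0\<close>.\<close>
  define M' where "M' = max M 1"
  have M': "M' > 0" "M \<le> M'" by (auto simp: M'_def)
  define d where "d = e / (2 * M')"
  have d: "d > 0" using e M' by (simp add: d_def)
  obtain h where h: "h summable_on A" "\<And>n x. x \<in> A \<Longrightarrow> f n x \<le> d * g n x + h x" using dom[OF d] by blast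
  define k where "k n x = max 0 (f n x - d * g n x)" for n x
  have ks: "(\<lambda>n. infsum (k n) A) \<longlonglongrightarrow> infsum (\<lambda>_. 0) A"
  proof (rule infsum_dominated_convergence(2))
    show "(\<lambda>x. \<bar>h x\<bar>) summable_on A" using h(1) summable_on_iff_abs_summable_on_real[of h A] by simp
    show "\<bar>k n x\<bar> \<le> \<bar>h x\<bar>" if "x \<in> A" for n x using h(2)[OF that, of n] by (auto simp: k_def)
    show "(\<lambda>n. k n x) \<longlonglongrightarrow> 0" if "x \<in> A" for x
    proof (rule tendsto_sandwich[OF _ _ tendsto_const lim[OF that]])
      show "\<forall>\<^sub>F n in sequentially. 0 \<le> k n x" by (simp add: k_def)
      show "\<forall>\<^sub>F n in sequentially. k n x \<le> f n x"
        using f0[OF that] g0[OF that] d by (auto simp: k_def)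
    qed
  qed
  then have "(\<lambda>n. infsum (k n) A) \<longlonglongrightarrow> 0" by simp
  from LIMSEQ_D[OF this, of "e/2"] obtain n0 where n0: "\<And>n. n \<ge> n0 \<Longrightarrow> norm (infsum (k n) A) < e/2"
    using e by auto
  have "norm (infsum (f n) A - 0) < e" if "n \<ge> n0" for n
  proof -
    have ksum: "k n summable_on A"
      by (rule summable_on_abs_le[OF fs[of n]]) (use f0 g0 d in \<open>auto simp: k_def\<close>)
    have "infsum (f n) A \<le> infsum (\<lambda>x. d * g n x + k n x) A"
    proof (rule infsum_mono)
      show "(\<lambda>x. d * g n x + k n x) summable_on A"
        by (intro summable_on_add summable_on_cmult_right gs ksum)
    qed (use fs in \<open>simp_all add: k_def\<close>)
    also have "\<dots> = d * infsum (g n) A + infsum (k n) A"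
      by (subst infsum_add) (use ksum gs in \<open>auto simp: infsum_cmult_right intro!: summable_on_cmult_right\<close>)
    also have "\<dots> < d * M' + e/2"
      using n0[OF that] mult_left_mono[OF order_trans[OF gM[of n] M'(2)], of d] d
      unfolding real_norm_def by linarith
    also have "\<dots> = e" using M' by (simp add: d_def field_simps)
    finally show ?thesis using infsum_nonneg[of A "f n"] f0 by simp
  qed
  then show "\<exists>no. \<forall>n\<ge>no. norm (infsum (f n) A - 0) < e" by blast
qed

section \<open>Spaces of functions with summable powers\<close>

definition lp :: "real \<Rightarrow> 'i set \<Rightarrow> ('i \<Rightarrow> real) set" where
  "lp q A = {f. (\<lambda>x. \<bar>f x\<bar> powr q) summable_on A}"

text \<open>The power of the norm rather than the norm: it is additive over disjoint index sets, and
  it is the quantity that the Brezis--Lieb lemma splits.\<close>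

definition psum :: "real \<Rightarrow> 'i set \<Rightarrow> ('i \<Rightarrow> real) \<Rightarrow> real" where
  "psum q A f = (\<Sum>\<^sub>\<infinity>x\<in>A. \<bar>f x\<bar> powr q)"

lemma psum_nonneg [simp]: "0 \<le> psum q A f"
  unfolding psum_def by (rule infsum_nonneg) simp

lemma lp_sum_le: "f \<in> lp q A \<Longrightarrow> finite F \<Longrightarrow> F \<subseteq> A \<Longrightarrow> (\<Sum>x\<in>F. \<bar>f x\<bar> powr q) \<le> psum q A f"
  unfolding psum_def lp_def by (rule finite_sum_le_infsum) auto

lemma lp_boundedI:
  assumes "\<And>F. finite F \<Longrightarrow> F \<subseteq> A \<Longrightarrow> (\<Sum>x\<in>F. \<bar>f x\<bar> powr q) \<le> M"
  shows "f \<in> lp q A" and "psum q A f \<le> M"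
  using nonneg_summable_on_bounded[of A "\<lambda>x. \<bar>f x\<bar> powr q" M] assms by (auto simp: lp_def psum_def)

lemma lp_finite_support:
  assumes "finite F" "\<And>x. x \<in> A - F \<Longrightarrow> f x = 0"
  shows "f \<in> lp q A" and "psum q A f = (\<Sum>x\<in>A \<inter> F. \<bar>f x\<bar> powr q)"
proof -
  show "f \<in> lp q A" unfolding lp_def mem_Collect_eq
    by (rule finite_nonzero_values_imp_summable_on) (rule finite_subset[OF _ assms(1)], use assms(2) in force)
  have "psum q A f = infsum (\<lambda>x. \<bar>f x\<bar> powr q) (A \<inter> F)"
    unfolding psum_def by (rule infsum_cong_neutral) (use assms in auto)
  then show "psum q A f = (\<Sum>x\<in>A \<inter> F. \<bar>f x\<bar> powr q)" using assms(1) by simp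
qed

lemma lp_mono:
  assumes "g \<in> lp q A" "\<And>x. x \<in> A \<Longrightarrow> \<bar>f x\<bar> \<le> \<bar>g x\<bar>" "0 \<le> q"
  shows "f \<in> lp q A" and "psum q A f \<le> psum q A g"
proof -
  show *: "f \<in> lp q A" unfolding lp_def mem_Collect_eq
    by (rule summable_on_abs_le[of "\<lambda>x. \<bar>g x\<bar> powr q"]) (use assms in \<open>auto simp: lp_def intro!: powr_mono2\<close>)
  show "psum q A f \<le> psum q A g" unfolding psum_def
    by (rule infsum_mono) (use assms * in \<open>auto simp: lp_def intro!: powr_mono2\<close>)
qed

lemma lp_cong:
  assumes "\<And>x. x \<in> A \<Longrightarrow> f x = g x"
  shows "f \<in> lp q A \<longleftrightarrow> g \<in> lp q A" and "psum q A f = psum q A g"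
  using assms unfolding lp_def psum_def
  by (auto intro!: infsum_cong cong: summable_on_cong)

lemma lp_cmult: 
  shows "f \<in> lp q A \<Longrightarrow> (\<lambda>x. c * f x) \<in> lp q A" and "psum q A (\<lambda>x. c * f x) = \<bar>c\<bar> powr q * psum q A f"
  unfolding lp_def psum_def
  by (auto simp: abs_mult powr_mult infsum_cmult_right' intro!: summable_on_cmult_right)

lemma lp_point_le: "f \<in> lp q A \<Longrightarrow> x \<in> A \<Longrightarrow> \<bar>f x\<bar> powr q \<le> psum q A f"
  using lp_sum_le[of f q A "{x}"] by simp

lemma lp_abs_le:
  assumes "f \<in> lp q A" "x \<in> A" "q > 0"
  shows "\<bar>f x\<bar> \<le> psum q A f powr (1/q)"
  using powr_mono2[OF _ _ lp_point_le[OF assms(1,2)], of "1/q"] assms(3) by (simp add: powr_powr)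

text \<open>Every finite partial sum passes to the limit, so a uniform bound survives without any
  domination.\<close>

lemma lp_fatou:
  assumes "\<And>n. f n \<in> lp q A" "\<And>n. psum q A (f n) \<le> M" "\<And>x. x \<in> A \<Longrightarrow> (\<lambda>n. f n x) \<longlonglongrightarrow> g x" "q > 0"
  shows "g \<in> lp q A" and "psum q A g \<le> M"
proof -
  have "(\<Sum>x\<in>F. \<bar>g x\<bar> powr q) \<le> M" if "finite F" "F \<subseteq> A" for F
  proof (rule LIMSEQ_le_const2)
    show "(\<lambda>n. \<Sum>x\<in>F. \<bar>f n x\<bar> powr q) \<longlonglongrightarrow> (\<Sum>x\<in>F. \<bar>g x\<bar> powr q)"
      by (intro tendsto_sum tendsto_powr' tendsto_rabs assms(3)) (use that assms(4) in auto)
    show "\<exists>N. \<forall>n\<ge>N. (\<Sum>x\<in>F. \<bar>f n x\<bar> powr q) \<le> M"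
      using lp_sum_le[OF assms(1) that] assms(2) order_trans by blast
  qed
  then show "g \<in> lp q A" and "psum q A g \<le> M" using lp_boundedI[of A g q M] by blast+
qed

text \<open>The factor \<open>\<bar>f x\<bar> powr (r - q)\<close> is estimated by its supremum.
  Through this interpolation a maximizing sequence with small sup norm would have small
  energy.\<close>

lemma lp_embed_bound:
  assumes "f \<in> lp q A" "q \<le> r" "\<And>x. x \<in> A \<Longrightarrow> \<bar>f x\<bar> \<le> B"
  shows "f \<in> lp r A" and "psum r A f \<le> B powr (r - q) * psum q A f"
proof -
  have *: "\<bar>f x\<bar> powr r \<le> B powr (r - q) * \<bar>f x\<bar> powr q" if "x \<in> A" for x
  proof -
    have "\<bar>f x\<bar> powr r = \<bar>f x\<bar> powr (r - q) * \<bar>f x\<bar> powr q" by (simp flip: powr_add)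
    also have "\<dots> \<le> B powr (r - q) * \<bar>f x\<bar> powr q"
      by (intro mult_right_mono powr_mono2) (use assms that in auto)
    finally show ?thesis .
  qed
  have s: "(\<lambda>x. B powr (r - q) * \<bar>f x\<bar> powr q) summable_on A"
    using assms(1) by (intro summable_on_cmult_right) (simp add: lp_def)
  show 1: "f \<in> lp r A" unfolding lp_def mem_Collect_eq
    by (rule summable_on_abs_le[OF s]) (use * in auto)
  have "psum r A f \<le> (\<Sum>\<^sub>\<infinity>x\<in>A. B powr (r - q) * \<bar>f x\<bar> powr q)" unfolding psum_def
    by (rule infsum_mono[OF _ s]) (use 1 * in \<open>auto simp: lp_def\<close>)
  then show "psum r A f \<le> B powr (r - q) * psum q A f" by (simp add: psum_def infsum_cmult_right')
qed

text \<open>On a discrete set each value is bounded by the norm, so the spaces grow with the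
  exponent.\<close>

lemma lp_embed:
  assumes "f \<in> lp q A" "0 < q" "q \<le> r"
  shows "f \<in> lp r A" and "psum r A f \<le> psum q A f powr (r/q)"
proof -
  note * = lp_embed_bound[OF assms(1,3) lp_abs_le[OF assms(1) _ assms(2)]]
  show "f \<in> lp r A" using * by simp
  have "psum r A f \<le> psum q A f powr ((r - q)/q) * psum q A f powr 1"
    using *(2) by (simp add: powr_powr)
  also have "\<dots> = psum q A f powr ((r - q)/q + 1)" by (simp only: powr_add)
  also have "(r - q)/q + 1 = r/q" using assms by (simp add: field_simps)
  finally show "psum r A f \<le> psum q A f powr (r/q)" .
qed

text \<open>Chebyshev's inequality. In this form decay at infinity enters the truncations and the
  minimum principle.\<close>

lemma lp_finite_superlevel:
  assumes "f \<in> lp q A" "e > 0" "q > 0"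
  shows "finite {x \<in> A. e < \<bar>f x\<bar>}"
proof (rule ccontr)
  assume inf: "infinite {x \<in> A. e < \<bar>f x\<bar>}"
  obtain n :: nat where n: "psum q A f / e powr q < real n" using reals_Archimedean2 by blast
  obtain F where F: "finite F" "card F = n" "F \<subseteq> {x \<in> A. e < \<bar>f x\<bar>}"
    using infinite_arbitrarily_large[OF inf] by metis
  have "real n * e powr q = (\<Sum>x\<in>F. e powr q)" using F by simp
  also have "\<dots> \<le> (\<Sum>x\<in>F. \<bar>f x\<bar> powr q)" by (intro sum_mono powr_mono2) (use F assms in auto)
  also have "\<dots> \<le> psum q A f" by (rule lp_sum_le) (use F assms in auto)
  finally show False using n assms by (simp add: field_simps)
qed

lemma psum_eq_0D: "f \<in> lp q A \<Longrightarrow> psum q A f = 0 \<Longrightarrow> x \<in> A \<Longrightarrow> f x = 0"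
  using lp_point_le[of f q A x] by (simp add: not_less[symmetric])

section \<open>Convexity inequalities, Minkowski and Hoelder\<close>

lemma powr_abs_add_le:
  fixes a b q l :: real
  assumes "q \<ge> 1" "0 < l" "l < 1"
  shows "\<bar>a + b\<bar> powr q \<le> (1 - l) powr (1 - q) * \<bar>a\<bar> powr q + l powr (1 - q) * \<bar>b\<bar> powr q"
proof -
  have conv: "((1 - l) * u + l * v) powr q \<le> (1 - l) * u powr q + l * v powr q" if "u > 0" "v > 0" for u v
    using convex_onD[OF powr_convex[OF assms(1)], of l u v] that assms by (simp add: algebra_simps)
  have conv: "((1 - l) * u + l * v) powr q \<le> (1 - l) * u powr q + l * v powr q" if "u \<ge> 0" "v \<ge> 0" for u v
  proof -
    \<comment> \<open>If \<open>u\<close> or \<open>v\<close> is 0, convexity reduces to this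
      estimate.\<close>
    have l1: "t powr q \<le> t" if "0 < t" "t < 1" for t :: real
      using powr_mono'[of 1 q t] that assms by simp
    consider "u = 0" | "v = 0" | "u > 0" "v > 0" using \<open>u \<ge> 0\<close> \<open>v \<ge> 0\<close> by fastforce
    then show ?thesis
    proof cases
      case 1 then show ?thesis using l1[of l] assms that by (auto simp: powr_mult intro!: mult_right_mono)
    next
      case 2 then show ?thesis using l1[of "1 - l"] assms that by (auto simp: powr_mult intro!: mult_right_mono)
    qed (rule conv)
  qed
  have "\<bar>a + b\<bar> powr q \<le> (\<bar>a\<bar> + \<bar>b\<bar>) powr q" using assms by (intro powr_mono2) auto
  \<comment> \<open>Writing the sum as a convex combination with a free weight serves two ends:
    \<open>l\<close> near 0 gives a coefficient of \<open>\<bar>a\<bar> powr q\<close> near 1, and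
    \<open>l\<close> adapted to the norms gives Minkowski's inequality.\<close>
  also have "\<dots> = ((1 - l) * (\<bar>a\<bar> / (1 - l)) + l * (\<bar>b\<bar> / l)) powr q" using assms by simp
  also have "\<dots> \<le> (1 - l) * (\<bar>a\<bar> / (1 - l)) powr q + l * (\<bar>b\<bar> / l) powr q"
    by (rule conv) (use assms in auto)
  also have "\<dots> = (1 - l) powr (1 - q) * \<bar>a\<bar> powr q + l powr (1 - q) * \<bar>b\<bar> powr q"
    using assms by (simp add: powr_divide powr_diff)
  finally show ?thesis .
qed

lemma powr_abs_add_le2:
  fixes a b q :: real
  assumes "q \<ge> 1"
  shows "\<bar>a + b\<bar> powr q \<le> 2 powr q * (\<bar>a\<bar> powr q + \<bar>b\<bar> powr q)"
proof -
  have "\<bar>a + b\<bar> powr q \<le> (1 / 2) powr (1 - q) * (\<bar>a\<bar> powr q + \<bar>b\<bar> powr q)"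
    using powr_abs_add_le[of q "1/2" a b] assms by (simp add: algebra_simps)
  also have "(1 / 2) powr (1 - q) \<le> (2::real) powr q"
    by (simp add: powr_divide powr_diff)
  finally show ?thesis by (simp add: mult_right_mono)
qed

lemma lp_add:
  assumes "f \<in> lp q A" "g \<in> lp q A" "q \<ge> 1"
  shows "(\<lambda>x. f x + g x) \<in> lp q A" and "psum q A (\<lambda>x. f x + g x) \<le> 2 powr q * (psum q A f + psum q A g)"
    and "0 < l \<Longrightarrow> l < 1 \<Longrightarrow>
      psum q A (\<lambda>x. f x + g x) \<le> (1 - l) powr (1 - q) * psum q A f + l powr (1 - q) * psum q A g"
proof -
  have s: "(\<lambda>x. 2 powr q * (\<bar>f x\<bar> powr q + \<bar>g x\<bar> powr q)) summable_on A"
    using assms by (intro summable_on_cmult_right summable_on_add) (auto simp: lp_def)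
  show 1: "(\<lambda>x. f x + g x) \<in> lp q A" unfolding lp_def mem_Collect_eq
    by (rule summable_on_abs_le[OF s]) (use powr_abs_add_le2[OF assms(3)] in auto)
  have "psum q A (\<lambda>x. f x + g x) \<le> (\<Sum>\<^sub>\<infinity>x\<in>A. 2 powr q * (\<bar>f x\<bar> powr q + \<bar>g x\<bar> powr q))"
    unfolding psum_def by (rule infsum_mono[OF _ s]) (use 1 powr_abs_add_le2[OF assms(3)] in \<open>auto simp: lp_def\<close>)
  also have "\<dots> = 2 powr q * (psum q A f + psum q A g)"
    using assms by (simp add: psum_def infsum_cmult_right' infsum_add lp_def)
  finally show "psum q A (\<lambda>x. f x + g x) \<le> 2 powr q * (psum q A f + psum q A g)" .
  assume l: "0 < l" "l < 1"
  have "psum q A (\<lambda>x. f x + g x) \<le>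
      (\<Sum>\<^sub>\<infinity>x\<in>A. (1 - l) powr (1 - q) * \<bar>f x\<bar> powr q + l powr (1 - q) * \<bar>g x\<bar> powr q)"
    unfolding psum_def
    by (rule infsum_mono) (use 1 powr_abs_add_le[OF assms(3) l] assms in
        \<open>auto simp: lp_def intro!: summable_on_cmult_right summable_on_add\<close>)
  also have "\<dots> = (1 - l) powr (1 - q) * psum q A f + l powr (1 - q) * psum q A g"
    using assms by (subst infsum_add) (auto simp: psum_def infsum_cmult_right' lp_def intro!: summable_on_cmult_right)
  finally show "psum q A (\<lambda>x. f x + g x) \<le> (1 - l) powr (1 - q) * psum q A f + l powr (1 - q) * psum q A g" .
qed

lemma lp_minkowski:
  assumes "f \<in> lp q A" "g \<in> lp q A" "q \<ge> 1"
  shows "psum q A (\<lambda>x. f x + g x) powr (1/q) \<le> psum q A f powr (1/q) + psum q A g powr (1/q)"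
proof -
  define a where "a = psum q A f powr (1/q)"
  define b where "b = psum q A g powr (1/q)"
  have ab: "a \<ge> 0" "b \<ge> 0" "psum q A f = a powr q" "psum q A g = b powr q"
    using assms(3) by (auto simp: a_def b_def powr_powr)
  consider "a = 0" | "b = 0" | "a > 0" "b > 0" using ab by fastforce
  then show ?thesis
  proof cases
    case 1
    then have "f x = 0" if "x \<in> A" for x using psum_eq_0D[OF assms(1) _ that] ab by simp
    then have "psum q A (\<lambda>x. f x + g x) = psum q A g" by (intro lp_cong) auto
    then show ?thesis by simp
  next
    case 2
    then have "g x = 0" if "x \<in> A" for x using psum_eq_0D[OF assms(2) _ that] ab by simp
    then have "psum q A (\<lambda>x. f x + g x) = psum q A f" by (intro lp_cong) auto
    then show ?thesis by simp
  next
    case 3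
    \<comment> \<open>The optimal weight: the right-hand side becomes exactly
      \<open>(a + b) powr q\<close>.\<close>
    define l where "l = b / (a + b)"
    have l: "0 < l" "l < 1" "1 - l = a / (a + b)" using 3 by (auto simp: l_def field_simps)
    have "psum q A (\<lambda>x. f x + g x) \<le> (1 - l) powr (1 - q) * a powr q + l powr (1 - q) * b powr q"
      using lp_add(3)[OF assms l(1,2)] ab by simp
    also have "(1 - l) powr (1 - q) * a powr q = a * (a + b) powr (q - 1)"
      using 3 unfolding l(3) by (simp add: powr_divide powr_diff)
    also have "l powr (1 - q) * b powr q = b * (a + b) powr (q - 1)"
      using 3 unfolding l_def by (simp add: powr_divide powr_diff)
    also have "a * (a + b) powr (q - 1) + b * (a + b) powr (q - 1) = (a + b) powr q"
      using 3 powr_mult_base[of "a + b" "q - 1"] by (simp add: distrib_right[symmetric])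
    finally have "psum q A (\<lambda>x. f x + g x) powr (1/q) \<le> ((a + b) powr q) powr (1/q)"
      using assms by (intro powr_mono2) auto
    then show ?thesis using 3 assms(3) by (simp add: powr_powr a_def b_def)
  qed
qed

lemma weighted_am_gm2:
  fixes a b t :: real
  assumes "0 \<le> a" "0 \<le> b" "0 \<le> t" "t \<le> 1"
  shows "a powr (1 - t) * b powr t \<le> (1 - t) * a + t * b"
proof (cases "a = 0 \<or> b = 0")
  \<comment> \<open>With base 0 the function \<open>powr\<close> is 0 even for exponent 0, so the
    left side vanishes also for \<open>t = 0\<close> and \<open>t = 1\<close>.\<close>
  case True then show ?thesis using assms by auto
next
  case False
  then have ab: "a > 0" "b > 0" using assms by auto
  have "a powr (1 - t) * b powr t = exp ((1 - t) *\<^sub>R ln a + t *\<^sub>R ln b)"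
    using ab by (simp add: powr_def exp_add)
  also have "\<dots> \<le> (1 - t) * exp (ln a) + t * exp (ln b)"
    by (rule convex_onD[OF exp_convex]) (use assms in auto)
  finally show ?thesis using ab by simp
qed

text \<open>Young's inequality termwise already gives summability; summed for the two functions
  scaled to unit norm it gives the product bound.\<close>

lemma lp_hoelder:
  fixes f g :: "'i \<Rightarrow> real"
  assumes f: "f \<in> lp a A" and g: "g \<in> lp b A" and ab: "a > 1" "b > 1" "1 / a + 1 / b = 1"
  shows "(\<lambda>x. \<bar>f x * g x\<bar>) summable_on A"
    and "(\<Sum>\<^sub>\<infinity>x\<in>A. \<bar>f x * g x\<bar>) \<le> psum a A f powr (1/a) * psum b A g powr (1/b)"
proof -
  have ptw: "\<bar>u * v\<bar> \<le> (1/a) * \<bar>u\<bar> powr a + (1/b) * \<bar>v\<bar> powr b" for u v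
    using Youngs_inequality[OF ab, of "\<bar>u\<bar>" "\<bar>v\<bar>"] by (simp add: abs_mult)
  have s: "(\<lambda>x. (1/a) * \<bar>f x\<bar> powr a + (1/b) * \<bar>g x\<bar> powr b) summable_on A"
    if "f \<in> lp a A" "g \<in> lp b A" for f g :: "'i \<Rightarrow> real"
    using that by (intro summable_on_add summable_on_cmult_right) (auto simp: lp_def)
  show fg: "(\<lambda>x. \<bar>f x * g x\<bar>) summable_on A" by (rule summable_on_abs_le[OF s[OF f g]]) (use ptw in auto)
  show "(\<Sum>\<^sub>\<infinity>x\<in>A. \<bar>f x * g x\<bar>) \<le> psum a A f powr (1/a) * psum b A g powr (1/b)"
  proof (cases "psum a A f = 0 \<or> psum b A g = 0")
    case True
    then have "(\<Sum>\<^sub>\<infinity>x\<in>A. \<bar>f x * g x\<bar>) = 0"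
      using psum_eq_0D[OF f] psum_eq_0D[OF g] by (intro infsum_0) auto
    then show ?thesis by simp
  next
    case False
    define F where "F = psum a A f powr (1/a)"
    define K where "K = psum b A g powr (1/b)"
    have FK: "F > 0" "K > 0" "F powr a = psum a A f" "K powr b = psum b A g"
      using False ab by (auto simp: F_def K_def powr_powr)
    have fF: "(\<lambda>x. (1/F) * f x) \<in> lp a A" "psum a A (\<lambda>x. (1/F) * f x) = 1"
      using lp_cmult[where f=f and q=a and A=A and c="1/F"] f FK False by (auto simp: powr_divide)
    have gK: "(\<lambda>x. (1/K) * g x) \<in> lp b A" "psum b A (\<lambda>x. (1/K) * g x) = 1"
      using lp_cmult[where f=g and q=b and A=A and c="1/K"] g FK False by (auto simp: powr_divide)
    have "(1 / (F * K)) * (\<Sum>\<^sub>\<infinity>x\<in>A. \<bar>f x * g x\<bar>) = (\<Sum>\<^sub>\<infinity>x\<in>A. \<bar>(1/F) * f x * ((1/K) * g x)\<bar>)"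
      using FK by (subst infsum_cmult_right'[symmetric]) (simp add: abs_mult field_simps)
    also have "\<dots> \<le> (\<Sum>\<^sub>\<infinity>x\<in>A. (1/a) * \<bar>(1/F) * f x\<bar> powr a + (1/b) * \<bar>(1/K) * g x\<bar> powr b)"
    proof (rule infsum_mono)
      show "(\<lambda>x. \<bar>(1/F) * f x * ((1/K) * g x)\<bar>) summable_on A"
        by (rule summable_on_abs_le[OF s[OF fF(1) gK(1)]]) (use ptw in \<open>simp only: abs_idempotent\<close>)
    qed (use ptw s[OF fF(1) gK(1)] in \<open>simp_all only:\<close>)
    also have "\<dots> = (1/a) * psum a A (\<lambda>x. (1/F) * f x) + (1/b) * psum b A (\<lambda>x. (1/K) * g x)"
      unfolding psum_def infsum_cmult_right'[symmetric]
      by (intro infsum_add summable_on_cmult_right) (use fF(1) gK(1) in \<open>simp_all only: lp_def mem_Collect_eq\<close>)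
    also have "\<dots> = 1" using fF gK ab by simp
    finally show ?thesis using FK by (simp add: field_simps F_def K_def)
  qed
qed

text \<open>The two-sided splitting inequality behind the Brezis--Lieb lemma.\<close>

lemma powr_abs_diff_le:
  fixes q e :: real
  assumes "q \<ge> 1" "e > 0"
  obtains C where "C \<ge> 0" "\<And>a b. \<bar>\<bar>a + b\<bar> powr q - \<bar>a\<bar> powr q\<bar> \<le> e * \<bar>a\<bar> powr q + C * \<bar>b\<bar> powr q"
proof -
  \<comment> \<open>As \<open>l\<close> tends to 0 the coefficient of
    \<open>\<bar>a\<bar> powr q\<close> tends to 1 while that of \<open>\<bar>b\<bar> powr q\<close>
    may blow up: these become \<open>1 + e\<close> and \<open>C\<close>.\<close>
  have "((\<lambda>l. (1 - l) powr (1 - q)) \<longlongrightarrow> (1 - 0) powr (1 - q)) (at_right 0)"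
    by (intro tendsto_intros) auto
  then have "\<forall>\<^sub>F l in at_right (0::real). (1 - l) powr (1 - q) < 1 + min e 1 / 2"
    using assms by (intro order_tendstoD) auto
  moreover have "\<forall>\<^sub>F l in at_right (0::real). l \<in> {0<..<1}" using eventually_at_right_real[of 0 1] by simp
  ultimately have "\<forall>\<^sub>F l in at_right (0::real). (1 - l) powr (1 - q) < 1 + min e 1 / 2 \<and> l \<in> {0<..<1}"
    by eventually_elim auto
  then obtain l where l: "(1 - l) powr (1 - q) < 1 + min e 1 / 2" "0 < l" "l < 1"
    using eventually_happens[of _ "at_right (0::real)"] by auto
  define A where "A = (1 - l) powr (1 - q)"
  define B where "B = l powr (1 - q)"
  have A1: "A \<ge> 1" unfolding A_def using l assms powr_mono'[of "1 - q" 0 "1 - l"] by simp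
  have Ae: "A \<le> 1 + e" using l(1) assms(2) by (auto simp: A_def min_def split: if_splits)
  have B: "B \<ge> 0" by (simp add: B_def)
  show thesis
  proof (rule that[of B])
    fix a b :: real
    have 1: "\<bar>a + b\<bar> powr q \<le> A * \<bar>a\<bar> powr q + B * \<bar>b\<bar> powr q"
      using powr_abs_add_le[OF assms(1) l(2,3)] by (simp add: A_def B_def)
    \<comment> \<open>The lower bound comes from the same inequality, read for
      \<open>a = (a + b) + (- b)\<close>.\<close>
    have 2: "\<bar>a\<bar> powr q \<le> A * \<bar>a + b\<bar> powr q + B * \<bar>b\<bar> powr q"
      using powr_abs_add_le[OF assms(1) l(2,3), of "a + b" "- b"] by (simp add: A_def B_def)
    have 3: "A * \<bar>a\<bar> powr q \<le> (1 + e) * \<bar>a\<bar> powr q" by (intro mult_right_mono Ae) auto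
    have "\<bar>a\<bar> powr q - \<bar>a + b\<bar> powr q \<le> e * \<bar>a\<bar> powr q + B * \<bar>b\<bar> powr q"
    proof (cases "\<bar>a + b\<bar> \<le> \<bar>a\<bar>")
      case True
      have "(A - 1) * \<bar>a + b\<bar> powr q \<le> e * \<bar>a\<bar> powr q"
        by (intro mult_mono powr_mono2) (use True assms Ae A1 in auto)
      then show ?thesis using 2 by (simp add: algebra_simps)
    next
      case False
      then have "\<bar>a\<bar> powr q \<le> \<bar>a + b\<bar> powr q" using assms by (intro powr_mono2) auto
      moreover have "0 \<le> e * \<bar>a\<bar> powr q" "0 \<le> B * \<bar>b\<bar> powr q" using assms B by auto
      ultimately show ?thesis by linarith
    qed
    with 1 3 show "\<bar>\<bar>a + b\<bar> powr q - \<bar>a\<bar> powr q\<bar> \<le> e * \<bar>a\<bar> powr q + B * \<bar>b\<bar> powr q"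
      by (simp add: algebra_simps abs_le_iff)
  qed (rule B)
qed

text \<open>At 0 the factor \<open>t\<close> makes the formula 0 whatever \<open>q - 2\<close> is,
  and the difference quotient is at most \<open>\<bar>h\<bar> powr (q - 1)\<close>. This is where
  \<open>q > 1\<close> enters; the exponent 1 needs the separate argument at the end.\<close>

lemma powr_has_derivative:
  fixes t q :: real
  assumes "q > 1"
  shows "((\<lambda>t. \<bar>t\<bar> powr q) has_real_derivative q * (\<bar>t\<bar> powr (q - 2) * t)) (at t)"
proof -
  consider "t > 0" | "t < 0" | "t = 0" by linarith
  then show ?thesis
  proof cases
    case 1
    have "((\<lambda>t. t powr q) has_real_derivative q * t powr (q - 1)) (at t)"
      using has_real_derivative_powr[OF 1] by simp
    moreover have "t powr (q - 1) = \<bar>t\<bar> powr (q - 2) * t"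
      using 1 powr_mult_base[of t "q - 2"] by (simp add: mult.commute)
    moreover have "\<forall>\<^sub>F s in nhds t. s powr q = \<bar>s\<bar> powr q"
      using eventually_nhds_in_open[of "{0<..}" t] 1 by (auto elim!: eventually_mono)
    ultimately show ?thesis by (subst (asm) DERIV_cong_ev[OF refl _ refl]) auto
  next
    case 2
    have d: "((\<lambda>t. (- t) powr q) has_real_derivative q * (- t) powr (q - 1) * (- 1)) (at t)"
      by (rule DERIV_chain2[OF has_real_derivative_powr]) (use 2 in \<open>auto intro!: derivative_eq_intros\<close>)
    have e: "- ((- t) powr (q - 1)) = \<bar>t\<bar> powr (q - 2) * t"
      using 2 powr_mult_base[of "- t" "q - 2"] by (simp add: mult.commute)
    from d have "((\<lambda>t. (- t) powr q) has_real_derivative q * (- t) powr (q - 1) * (- 1)) (at t)" .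
    moreover have "\<forall>\<^sub>F s in nhds t. (- s) powr q = \<bar>s\<bar> powr q"
      using eventually_nhds_in_open[of "{..<0}" t] 2 by (auto elim!: eventually_mono)
    ultimately have "((\<lambda>t. \<bar>t\<bar> powr q) has_real_derivative - (q * (- t) powr (q - 1))) (at t)"
      by (subst (asm) DERIV_cong_ev[OF refl _ refl]) auto
    moreover have "- (q * (- t) powr (q - 1)) = q * (\<bar>t\<bar> powr (q - 2) * t)" using e by (metis mult_minus_right)
    ultimately show ?thesis by simp
  next
    case 3
    have "((\<lambda>h. \<bar>h\<bar> powr (q - 1)) \<longlongrightarrow> 0 powr (q - 1)) (at (0::real))"
      by (intro tendsto_powr' tendsto_rabs_zero tendsto_ident_at) (use assms in auto)
    then have "((\<lambda>h. \<bar>h\<bar> powr (q - 1)) \<longlongrightarrow> 0) (at (0::real))" by simp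
    then have "((\<lambda>h. \<bar>h\<bar> powr q / h) \<longlongrightarrow> 0) (at (0::real))"
    proof (rule Lim_null_comparison[rotated])
      show "\<forall>\<^sub>F h in at (0::real). norm (\<bar>h\<bar> powr q / h) \<le> \<bar>h\<bar> powr (q - 1)"
        unfolding eventually_at_filter
      proof (rule always_eventually, intro allI impI)
        fix h :: real assume "h \<noteq> 0"
        then show "norm (\<bar>h\<bar> powr q / h) \<le> \<bar>h\<bar> powr (q - 1)" by (simp add: powr_diff)
      qed
    qed
    then show ?thesis unfolding DERIV_def using 3 by simp
  qed
qed

subsection \<open>Isoperimetry and Sobolev inequalities\<close>

text \<open>The setting of the theorem with the weakest of its dimension bounds, shared by all three
  parts.\<close>

locale cayley = group G for G :: "('a, 'b) monoid_scheme" (structure) +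
  fixes S :: "'a set" and N :: nat
  assumes finS: "finite S" and SG: "S \<subseteq> carrier G" and Sinv: "set_inv\<^bsub>G\<^esub> S = S"
    and gen: "generate G S = carrier G" and growth: "polynomial_growth G S N" and N3: "N \<ge> 3"
begin

abbreviation V :: "'a set" where "V \<equiv> carrier G"

text \<open>A pair \<open>(x, s)\<close> stands for the edge from \<open>x\<close> to
  \<open>x \<otimes> s\<close>. Each edge between distinct vertices thus occurs once in each
  orientation, and \<open>bij_edge_right\<close> is the reversal. This double counting is the source
  of the factors 2 below.\<close>

definition grad :: "('a \<Rightarrow> real) \<Rightarrow> 'a \<times> 'a \<Rightarrow> real" where
  "grad u = (\<lambda>(x, s). u (x \<otimes> s) - u x)"

lemma grad_apply [simp]: "grad u (x, s) = u (x \<otimes> s) - u x"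
  by (simp add: grad_def)

lemma S_carrier [simp]: "s \<in> S \<Longrightarrow> s \<in> V"
  using SG by auto

lemma S_inv [simp]: "s \<in> S \<Longrightarrow> inv s \<in> S"
  using Sinv unfolding SET_INV_def by blast

lemma nbrs_eq: "x \<in> V \<Longrightarrow> nbrs G S x = (\<lambda>s. x \<otimes> s) ` S"
  by (auto simp: nbrs_def cayley_adj_def)

lemma sum_nbrs: "x \<in> V \<Longrightarrow> sum f (nbrs G S x) = (\<Sum>s\<in>S. f (x \<otimes> s))"
  by (simp add: nbrs_eq sum.reindex inj_on_def)

lemma laplacian_eq: "x \<in> V \<Longrightarrow> laplacian G S u x = (\<Sum>s\<in>S. grad u (x, s))"
  by (simp add: laplacian_def sum_nbrs)

lemma bij_left: "g \<in> V \<Longrightarrow> bij_betw (\<lambda>x. g \<otimes> x) V V"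
  by (rule bij_betwI[where g="\<lambda>x. inv g \<otimes> x"]) (auto simp: m_assoc[symmetric])

lemma bij_edge_right: "bij_betw (\<lambda>(x, s). (x \<otimes> s, inv s)) (V \<times> S) (V \<times> S)"
  by (rule bij_betwI[where g="\<lambda>(x, s). (x \<otimes> s, inv s)"]) (auto simp: m_assoc)

text \<open>Generation by \<open>S\<close> read as connectedness. It guarantees that the
  \<open>LEAST\<close> in \<open>word_dist\<close> ranges over a nonempty set.\<close>

lemma adj_paths:
  assumes "x \<in> V" "y \<in> V"
  shows "\<exists>n. (y, y \<otimes> x) \<in> {(v, w). cayley_adj G S v w} ^^ n"
proof -
  have step: "\<exists>n. (y, y \<otimes> s) \<in> {(v, w). cayley_adj G S v w} ^^ n" if "s \<in> S" "y \<in> V" for s y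
    by (rule exI[of _ 1]) (use that in \<open>auto simp: cayley_adj_def m_assoc intro!: bexI[of _ "inv s"]\<close>)
  have "x \<in> generate G S" using assms gen by simp
  then show ?thesis using assms(2)
  proof (induction arbitrary: y rule: generate.induct)
    case one
    then show ?case by (intro exI[of _ 0]) simp
  next
    case (incl h) then show ?case by (rule step)
  next
    case (inv h) then show ?case by (intro step) auto
  next
    case (eng h1 h2)
    have h: "h1 \<in> V" "h2 \<in> V" using eng.hyps gen by auto
    obtain n where n: "(y, y \<otimes> h1) \<in> {(v, w). cayley_adj G S v w} ^^ n" using eng.IH(1)[OF eng.prems] by blast
    obtain m where m: "(y \<otimes> h1, y \<otimes> h1 \<otimes> h2) \<in> {(v, w). cayley_adj G S v w} ^^ m"
      using eng.IH(2)[of "y \<otimes> h1"] eng.prems h by blast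
    show ?case using relpow_add[of n m] n m h eng.prems by (intro exI[of _ "n + m"]) (auto simp: m_assoc)
  qed
qed

lemma adj_closed:
  assumes "P \<one>" "\<And>x s. x \<in> V \<Longrightarrow> s \<in> S \<Longrightarrow> P x \<Longrightarrow> P (x \<otimes> s)" "x \<in> V"
  shows "P x"
proof -
  have "\<forall>y\<in>V. P y \<longrightarrow> P (y \<otimes> x)" if "x \<in> generate G S" for x
    using that
  proof (induction rule: generate.induct)
    case (eng h1 h2)
    have h: "h1 \<in> V" "h2 \<in> V" using eng.hyps gen by auto
    then show ?case using eng.IH by (auto simp: m_assoc[symmetric])
  qed (use assms(2) in auto)
  then show ?thesis using assms(1,3) gen by (metis l_one one_closed)
qed

section \<open>Balls and their growth\<close>

definition wball :: "nat \<Rightarrow> 'a set" where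
  "wball n = {x \<in> V. word_dist G S \<one> x \<le> n}"

lemma card_wball: "card (wball n) = growth G S n"
  by (simp add: wball_def growth_def)

text \<open>The increments are summed along a shortest path from the unit.\<close>

lemma wball_induct:
  assumes "x \<in> wball n" "f \<one> = 0" "M \<ge> 0" "\<And>x s. x \<in> V \<Longrightarrow> s \<in> S \<Longrightarrow> f (x \<otimes> s) \<le> f x + (M::real)"
  shows "f x \<le> real n * M"
proof -
  let ?r = "{(v, w). cayley_adj G S v w}"
  have *: "y \<in> V \<and> f y \<le> real k * M" if "(\<one>, y) \<in> ?r ^^ k" for y k
    using that
  proof (induction k arbitrary: y)
    case 0 then show ?case using assms(2) by auto
  next
    case (Suc k)
    then obtain z where z: "(\<one>, z) \<in> ?r ^^ k" "cayley_adj G S z y" by auto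
    then obtain s where s: "s \<in> S" "z = y \<otimes> s" "y \<in> V" "z \<in> V" by (auto simp: cayley_adj_def)
    then have "y = z \<otimes> inv s" by (simp add: m_assoc)
    then have "f y \<le> f z + M" using assms(4)[of z "inv s"] s by simp
    then show ?case using Suc.IH[OF z(1)] s by (simp add: algebra_simps)
  qed
  have x: "x \<in> V" "word_dist G S \<one> x \<le> n" using assms(1) by (auto simp: wball_def)
  have "(\<one>, x) \<in> ?r ^^ word_dist G S \<one> x"
    unfolding word_dist_def using adj_paths[of x \<one>] x(1) by (auto intro: LeastI_ex)
  then have "f x \<le> real (word_dist G S \<one> x) * M" using * by blast
  also have "\<dots> \<le> real n * M" using x(2) assms(3) by (intro mult_right_mono) auto
  finally show ?thesis .
qed

lemma growth_lower: 
  obtains C where "C > 0" "\<And>n. n \<ge> 1 \<Longrightarrow> C * real n ^ N \<le> real (card (wball n))"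
    "\<And>n. n \<ge> 1 \<Longrightarrow> finite (wball n)"
proof -
  obtain C where C: "C > 0" "\<And>n. n \<ge> 1 \<Longrightarrow> C * real n ^ N \<le> real (card (wball n))"
    using growth unfolding polynomial_growth_def card_wball by blast
  \<comment> \<open>An infinite set has \<open>card\<close> 0, so the positive lower bound on the
    growth yields finiteness as well.\<close>
  moreover have "finite (wball n)" if "n \<ge> 1" for n
    using C(2)[OF that] C(1) that by (intro card_ge_0_finite) (metis less_le_trans mult_pos_pos of_nat_0_less_iff zero_less_power less_one not_le_imp_less)
  ultimately show ?thesis using that by blast
qed

lemma V_infinite: "infinite V"
proof
  assume fin: "finite V"
  obtain C where C: "C > 0" "\<And>n. n \<ge> 1 \<Longrightarrow> C * real n ^ N \<le> real (card (wball n))"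
    using growth_lower by metis
  obtain n :: nat where n: "real (card V) / C < real n" using reals_Archimedean2 by blast
  have "n \<ge> 1" using n C by (cases n) (auto simp: divide_less_0_iff)
  then have "real n \<le> real n ^ N" using N3 by (simp add: self_le_power)
  then have "C * real n \<le> C * real n ^ N" using C(1) by simp
  also have "\<dots> \<le> real (card (wball n))" by (rule C(2)[OF \<open>n \<ge> 1\<close>])
  also have "\<dots> \<le> real (card V)" using fin by (simp add: card_mono wball_def)
  finally show False using n C(1) by (simp add: field_simps)
qed

lemma V_countable: "countable V"
proof -
  have "V = wball 0 \<union> (\<Union>n\<in>{1..}. wball n)"
    by (fastforce simp: wball_def)
  also have "wball 0 \<subseteq> wball 1" by (auto simp: wball_def)
  then have "wball 0 \<union> (\<Union>n\<in>{1..}. wball n) = (\<Union>n\<in>{1..}. wball n)" by auto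
  finally have V: "V = (\<Union>n\<in>{1..}. wball n)" .
  have "finite (wball n)" if "n \<ge> 1" for n using growth_lower that by metis
  then show ?thesis unfolding V by (intro countable_UN) (auto intro: countable_finite)
qed

lemma S_nonunit: "\<exists>s\<in>S. s \<noteq> \<one>"
proof (rule ccontr)
  assume "\<not> ?thesis"
  then have S1: "s = \<one>" if "s \<in> S" for s using that by blast
  have "x = \<one>" if "x \<in> V" for x
    by (rule adj_closed[of "\<lambda>x. x = \<one>", OF _ _ that]) (use S1 in auto)
  then have "V \<subseteq> {\<one>}" by blast
  then show False using V_infinite finite_subset by blast
qed

lemma S_nonempty: "card S > 0"
  using S_nonunit finS by (auto simp: card_gt_0_iff)

text \<open>For \<open>g\<close> in \<open>S\<close> this counts the boundary edges of
  \<open>A\<close> in direction \<open>g\<close>. Allowing every group element makes it subadditive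
  in \<open>g\<close>, hence at most linear in the word length.\<close>

definition bd :: "'a set \<Rightarrow> 'a \<Rightarrow> real" where
  "bd A g = real (card {x \<in> A. x \<otimes> g \<notin> A})"

text \<open>A point that leaves \<open>A\<close> under \<open>g \<otimes> s\<close> either leaves
  under \<open>g\<close>, or is moved by \<open>g\<close> to a point of \<open>A\<close> that leaves
  under \<open>s\<close>; the latter correspondence is injective.\<close>

lemma bd_mult:
  assumes "finite A" "A \<subseteq> V" "g \<in> V" "s \<in> V"
  shows "bd A (g \<otimes> s) \<le> bd A g + bd A s"
proof -
  have "{x \<in> A. x \<otimes> (g \<otimes> s) \<notin> A} \<subseteq> {x \<in> A. x \<otimes> g \<notin> A} \<union> {x \<in> A. x \<otimes> g \<in> A \<and> x \<otimes> g \<otimes> s \<notin> A}"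
    using assms by (auto simp: m_assoc subset_iff)
  then have "card {x \<in> A. x \<otimes> (g \<otimes> s) \<notin> A} \<le> card ({x \<in> A. x \<otimes> g \<notin> A} \<union> {x \<in> A. x \<otimes> g \<in> A \<and> x \<otimes> g \<otimes> s \<notin> A})"
    using assms(1) by (intro card_mono) auto
  also have "\<dots> \<le> card {x \<in> A. x \<otimes> g \<notin> A} + card {x \<in> A. x \<otimes> g \<in> A \<and> x \<otimes> g \<otimes> s \<notin> A}" by (rule card_Un_le)
  also have "card {x \<in> A. x \<otimes> g \<in> A \<and> x \<otimes> g \<otimes> s \<notin> A} \<le> card {z \<in> A. z \<otimes> s \<notin> A}"
    by (rule card_inj_on_le[of "\<lambda>x. x \<otimes> g"]) (use assms in \<open>auto simp: inj_on_def subset_iff\<close>)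
  finally show ?thesis by (simp add: bd_def)
qed

lemma isoperimetric:
  obtains c where "c > 0" "\<And>A. finite A \<Longrightarrow> A \<subseteq> V \<Longrightarrow> A \<noteq> {} \<Longrightarrow>
     real (card A) powr ((real N - 1) / real N) \<le> c * (\<Sum>s\<in>S. bd A s)"
proof -
  obtain C where C: "C > 0" "\<And>n. n \<ge> 1 \<Longrightarrow> C * real n ^ N \<le> real (card (wball n))"
    "\<And>n. n \<ge> 1 \<Longrightarrow> finite (wball n)" using growth_lower by blast
  define k where "k = (2 / C) powr (1 / real N) + 1"
  have k: "k > 0" by (simp add: k_def add_nonneg_pos)
  show thesis
  proof (rule that[of "2 * k"])
    fix A assume A: "finite A" "A \<subseteq> V" "A \<noteq> {}"
    define a where "a = real (card A)"
    define E where "E = (\<Sum>s\<in>S. bd A s)"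
    have a: "a \<ge> 1" using A by (simp add: a_def Suc_le_eq card_gt_0_iff)
    have bd0: "0 \<le> bd A g" for g by (simp add: bd_def)
    have bdE: "bd A s \<le> E" if "s \<in> S" for s unfolding E_def by (rule member_le_sum) (use that finS bd0 in auto)
    have E0: "E \<ge> 0" unfolding E_def by (intro sum_nonneg bd0)
    \<comment> \<open>Chosen so that \<open>C * r ^ N = 2 * a\<close>: a ball of this radius has at
      least twice as many elements as \<open>A\<close>, so for each \<open>x\<close> at least half
      of the products \<open>x \<otimes> g\<close> leave \<open>A\<close>.\<close>
    define r where "r = (2 * a / C) powr (1 / real N)"
    have r: "r > 0" "r ^ N = 2 * a / C"
      using a C(1) N3 by (auto simp: r_def powr_powr simp flip: powr_realpow)
    define n where "n = nat \<lceil>r\<rceil>"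
    have n: "n \<ge> 1" "r \<le> real n" "real n \<le> r + 1" using r(1) unfolding n_def by linarith+
    define b where "b = real (card (wball n))"
    have "2 * a = C * r ^ N" using r C(1) by simp
    also have "\<dots> \<le> C * real n ^ N" using C(1) n r by (intro mult_left_mono power_mono) auto
    also have "\<dots> \<le> b" unfolding b_def by (rule C(2)[OF n(1)])
    finally have b: "2 * a \<le> b" .
    have 1: "bd A g \<le> real n * E" if "g \<in> wball n" for g
    proof (rule wball_induct[OF that _ E0])
      show "bd A \<one> = 0" using A(2) by (auto simp: bd_def subset_iff card_eq_0_iff)
      fix x s assume "x \<in> V" "s \<in> S"
      then show "bd A (x \<otimes> s) \<le> bd A x + E" using bd_mult[OF A(1,2), of x s] bdE[of s] by simp
    qed
    have sw: "(\<Sum>g\<in>wball n. bd A g) = (\<Sum>x\<in>A. real (card {g \<in> wball n. x \<otimes> g \<notin> A}))"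
    proof -
      have "bd A g = (\<Sum>x\<in>A. if x \<otimes> g \<notin> A then 1 else 0)" for g
        using A(1) by (simp add: bd_def sum.If_cases Int_def)
      then have "(\<Sum>g\<in>wball n. bd A g) = (\<Sum>g\<in>wball n. \<Sum>x\<in>A. if x \<otimes> g \<notin> A then 1 else 0)" by simp
      also have "\<dots> = (\<Sum>x\<in>A. \<Sum>g\<in>wball n. if x \<otimes> g \<notin> A then 1 else 0)" by (rule sum.swap)
      also have "\<dots> = (\<Sum>x\<in>A. real (card {g \<in> wball n. x \<otimes> g \<notin> A}))"
        using C(3)[OF n(1)] by (simp add: sum.If_cases Int_def)
      finally show ?thesis .
    qed
    have 2: "b - a \<le> real (card {g \<in> wball n. x \<otimes> g \<notin> A})" if "x \<in> A" for x
    proof -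
      have fin: "finite (wball n)" by (rule C(3)[OF n(1)])
      have "card {g \<in> wball n. x \<otimes> g \<in> A} \<le> card A"
        by (rule card_inj_on_le[of "\<lambda>g. x \<otimes> g"]) (use A that in \<open>auto simp: inj_on_def subset_iff wball_def\<close>)
      moreover have "card (wball n) = card {g \<in> wball n. x \<otimes> g \<in> A} + card {g \<in> wball n. x \<otimes> g \<notin> A}"
        using fin by (subst card_Un_disjoint[symmetric]) (auto intro: arg_cong[where f=card])
      ultimately show ?thesis by (simp add: a_def b_def)
    qed
    have "a * (b - a) = (\<Sum>x\<in>A. b - a)" by (simp add: a_def)
    also have "\<dots> \<le> (\<Sum>g\<in>wball n. bd A g)" unfolding sw by (rule sum_mono) (rule 2)
    also have "\<dots> \<le> (\<Sum>g\<in>wball n. real n * E)" by (rule sum_mono) (rule 1)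
    also have "\<dots> = b * (real n * E)" by (simp add: b_def)
    finally have up: "a * (b - a) \<le> b * (real n * E)" .
    have "a * (b / 2) \<le> a * (b - a)" by (rule mult_left_mono) (use a b in auto)
    with up have "a * (b / 2) \<le> b * (real n * E)" by (rule order_trans[rotated])
    then have "b * a \<le> b * (2 * (real n * E))" by (simp add: mult_ac)
    then have "a \<le> 2 * (real n * E)" using b a by (subst (asm) mult_le_cancel_left_pos) auto
    also have "\<dots> \<le> 2 * ((k * a powr (1 / real N)) * E)"
    proof -
      \<comment> \<open>Since \<open>a\<close> is at least 1, rounding the radius up to an integer
        costs only the \<open>+ 1\<close> in \<open>k\<close>.\<close>
      have "1 \<le> a powr (1 / real N)" using a by (simp add: ge_one_powr_ge_zero)
      moreover have "r = (2 / C) powr (1 / real N) * a powr (1 / real N)"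
        using a C(1) by (simp add: r_def powr_mult[symmetric])
      ultimately have "real n \<le> k * a powr (1 / real N)" using n(3) by (simp add: k_def algebra_simps)
      then show ?thesis using E0 by (simp add: mult_right_mono)
    qed
    finally have *: "a \<le> 2 * k * E * a powr (1 / real N)" by (simp add: mult_ac)
    have "a powr ((real N - 1) / real N) * a powr (1 / real N) = a"
      using a N3 by (simp add: field_simps flip: powr_add)
    then have "a powr ((real N - 1) / real N) * a powr (1 / real N) \<le> 2 * k * E * a powr (1 / real N)"
      using * by simp
    then show "real (card A) powr ((real N - 1) / real N) \<le> 2 * k * (\<Sum>s\<in>S. bd A s)"
      using a by (simp add: a_def E_def)
  qed (use k in simp)
qed

section \<open>The Sobolev inequality for the gradient\<close>

lemma grad_finite_support:
  assumes "finite {x \<in> V. u x \<noteq> 0}"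
  shows "\<exists>E. finite E \<and> (\<forall>e \<in> V \<times> S - E. grad u e = 0)"
proof -
  define F where "F = {x \<in> V. u x \<noteq> 0}"
  define E where "E = (F \<times> S) \<union> (\<lambda>(x, s). (x \<otimes> s, inv s)) ` (F \<times> S)"
  have "grad u e = 0" if e: "e \<in> V \<times> S - E" for e
  proof -
    obtain x s where xs: "e = (x, s)" "x \<in> V" "s \<in> S" using e by auto
    have "(x, s) = (\<lambda>(x, s). (x \<otimes> s, inv s)) (x \<otimes> s, inv s)" using xs by (simp add: m_assoc)
    then have "x \<otimes> s \<notin> F" using e xs unfolding E_def
      by (smt (verit) DiffD2 S_inv UnCI image_eqI mem_Sigma_iff)
    moreover have "x \<notin> F" using e xs by (auto simp: E_def)
    ultimately show ?thesis using xs by (simp add: F_def)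
  qed
  moreover have "finite E" using assms finS by (simp add: E_def F_def)
  ultimately show ?thesis by blast
qed

lemma grad_lp_finite: "finite {x \<in> V. u x \<noteq> 0} \<Longrightarrow> grad u \<in> lp q (V \<times> S)"
  using grad_finite_support[of u] lp_finite_support(1)[of _ "V \<times> S" "grad u" q] by blast

lemma fin_lp: "finite {x \<in> V. u x \<noteq> 0} \<Longrightarrow> u \<in> lp q V"
  by (rule lp_finite_support(1)) auto

text \<open>The orientations that leave \<open>A\<close> alone already account for the left
  side.\<close>

lemma bd_le_grad_indicator:
  assumes "finite A" "A \<subseteq> V"
  shows "(\<Sum>s\<in>S. bd A s) \<le> psum 1 (V \<times> S) (grad (indicator A))"
proof -
  have fs: "finite {x \<in> V. indicator A x \<noteq> (0::real)}"
    using assms by (auto simp: indicator_def intro: rev_finite_subset)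
  define E where "E = (SIGMA s:S. {x \<in> A. x \<otimes> s \<notin> A})"
  have fE: "finite E" using assms finS by (auto simp: E_def)
  have "(\<Sum>s\<in>S. bd A s) = real (card E)" using finS assms by (simp add: bd_def E_def)
  also have "\<dots> = (\<Sum>e\<in>prod.swap ` E. 1)" by (simp add: card_image)
  also have "\<dots> = (\<Sum>e\<in>prod.swap ` E. \<bar>grad (indicator A) e\<bar> powr 1)"
    by (rule sum.cong) (auto simp: E_def)
  also have "\<dots> \<le> psum 1 (V \<times> S) (grad (indicator A))"
    by (rule lp_sum_le[OF grad_lp_finite[OF fs]]) (use fE assms in \<open>auto simp: E_def\<close>)
  finally show ?thesis .
qed

text \<open>The co-area formula as an induction on the size of the support. If \<open>m\<close> is
  the least positive value and \<open>A\<close> the support, then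
  \<open>u = m * indicator A + v\<close> with \<open>v\<close> of smaller support. The gradient sums
  of the two layers add up exactly, the norms on the left are subadditive, and the bottom layer is
  the isoperimetric inequality.\<close>

lemma sobolev_1_finite:
  obtains c where "c > 0" "\<And>u. finite {x \<in> V. u x \<noteq> 0} \<Longrightarrow> (\<And>x. x \<in> V \<Longrightarrow> 0 \<le> u x) \<Longrightarrow>
    psum (N / (real N - 1)) V u powr ((real N - 1) / N) \<le> c * psum 1 (V \<times> S) (grad u)"
proof -
  obtain c where c: "c > 0" "\<And>A. finite A \<Longrightarrow> A \<subseteq> V \<Longrightarrow> A \<noteq> {} \<Longrightarrow>
     real (card A) powr ((real N - 1) / real N) \<le> c * (\<Sum>s\<in>S. bd A s)" using isoperimetric by blast
  define \<sigma> where "\<sigma> = N / (real N - 1)"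
  have \<sigma>: "\<sigma> \<ge> 1" "1 / \<sigma> = (real N - 1) / N" using N3 by (auto simp: \<sigma>_def field_simps)
  have claim: "psum \<sigma> V u powr (1/\<sigma>) \<le> c * psum 1 (V \<times> S) (grad u)"
    if "finite {x \<in> V. u x \<noteq> 0}" "\<And>x. x \<in> V \<Longrightarrow> 0 \<le> u x" for u
    using that
  proof (induction "card {x \<in> V. u x \<noteq> 0}" arbitrary: u rule: less_induct)
    case (less u)
    define A where "A = {x \<in> V. u x \<noteq> 0}"
    show ?case
    proof (cases "A = {}")
      case True
      then have "psum \<sigma> V u = 0" unfolding psum_def by (intro infsum_0) (auto simp: A_def)
      then show ?thesis using c by simp
    next
      case False
      have fA: "finite A" "A \<subseteq> V" using less.prems by (auto simp: A_def)
      define m where "m = Min (u ` A)"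
      obtain z where z: "z \<in> A" "u z = m" using Min_in[of "u ` A"] fA False
        unfolding m_def by (metis (no_types, lifting) finite_imageI image_iff image_is_empty)
      have m: "m > 0" "\<And>x. x \<in> A \<Longrightarrow> m \<le> u x"
        using z less.prems(2)[of z] fA by (auto simp: A_def m_def)
      define v where "v x = max (u x - m) 0" for x
      have uv: "u x = m * indicator A x + v x" if "x \<in> V" for x
        using m(1) m(2)[of x] that by (cases "x \<in> A") (auto simp: v_def A_def)
      have sv: "{x \<in> V. v x \<noteq> 0} \<subset> A"
      proof
        show "{x \<in> V. v x \<noteq> 0} \<subseteq> A" using m(1) by (auto simp: v_def A_def)
        show "{x \<in> V. v x \<noteq> 0} \<noteq> A" using z by (auto simp: v_def)
      qed
      have fv: "finite {x \<in> V. v x \<noteq> 0}" using sv fA finite_subset by blast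
      have IH: "psum \<sigma> V v powr (1/\<sigma>) \<le> c * psum 1 (V \<times> S) (grad v)"
        by (rule less.hyps) (use sv fA fv in \<open>auto simp: psubset_card_mono v_def A_def[symmetric]\<close>)
      have fi: "finite {x \<in> V. (indicator A x :: real) \<noteq> 0}"
        using fA by (auto simp: indicator_def intro: rev_finite_subset)
      have fmi: "finite {x \<in> V. m * (indicator A x :: real) \<noteq> 0}"
        by (rule finite_subset[OF _ fi]) auto
      have pi: "psum \<sigma> V (\<lambda>x. m * indicator A x) powr (1/\<sigma>) = m * real (card A) powr (1/\<sigma>)"
      proof -
        have "psum \<sigma> V (indicator A) = (\<Sum>x\<in>V \<inter> A. \<bar>indicator A x\<bar> powr \<sigma>)"
          by (rule lp_finite_support(2)) (use fA in auto)
        also have "\<dots> = card A" using fA by (simp add: Int_absorb1)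
        finally show ?thesis using m \<sigma>(1) by (simp add: lp_cmult(2) powr_mult powr_powr)
      qed
      \<comment> \<open>No cancellation occurs: along an edge that leaves \<open>A\<close>, both
        layers fall to 0, and inside \<open>A\<close> the bottom layer is constant.\<close>
      have ge: "\<bar>grad u e\<bar> = m * \<bar>grad (indicator A) e\<bar> + \<bar>grad v e\<bar>" if "e \<in> V \<times> S" for e
      proof -
        obtain x s where e: "e = (x, s)" "x \<in> V" "s \<in> S" "x \<otimes> s \<in> V" using \<open>e \<in> V \<times> S\<close> by auto
        have v0: "v y \<ge> 0" "y \<notin> A \<Longrightarrow> y \<in> V \<Longrightarrow> v y = 0" for y using sv by (auto simp: v_def)
        show ?thesis using uv[OF e(2)] uv[OF e(4)] m(1) v0(1)[of x] v0(1)[of "x \<otimes> s"] v0(2)[of x] v0(2)[of "x \<otimes> s"] e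
          by (cases "x \<in> A"; cases "x \<otimes> s \<in> A") auto
      qed
      have gs: "grad u \<in> lp 1 (V \<times> S)" "grad (indicator A) \<in> lp 1 (V \<times> S)" "grad v \<in> lp 1 (V \<times> S)"
        using grad_lp_finite less.prems(1) fi fv by auto
      have gsum: "psum 1 (V \<times> S) (grad u) = m * psum 1 (V \<times> S) (grad (indicator A)) + psum 1 (V \<times> S) (grad v)"
      proof -
        have "psum 1 (V \<times> S) (grad u) = (\<Sum>\<^sub>\<infinity>e\<in>V \<times> S. m * (\<bar>grad (indicator A) e\<bar> powr 1) + \<bar>grad v e\<bar> powr 1)"
          unfolding psum_def
        proof (rule infsum_cong)
          fix e assume "e \<in> V \<times> S"
          from ge[OF this] m(1) show "\<bar>grad u e\<bar> powr 1 = m * (\<bar>grad (indicator A) e\<bar> powr 1) + \<bar>grad v e\<bar> powr 1"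
            by (simp del: grad_apply)
        qed
        also have "\<dots> = m * psum 1 (V \<times> S) (grad (indicator A)) + psum 1 (V \<times> S) (grad v)"
          unfolding psum_def infsum_cmult_right'[symmetric]
          by (intro infsum_add summable_on_cmult_right) (use gs in \<open>auto simp only: lp_def mem_Collect_eq\<close>)
        finally show ?thesis .
      qed
      have "psum \<sigma> V u powr (1/\<sigma>) = psum \<sigma> V (\<lambda>x. m * indicator A x + v x) powr (1/\<sigma>)"
        using lp_cong(2)[of V u "\<lambda>x. m * indicator A x + v x" \<sigma>] uv by simp
      also have "\<dots> \<le> psum \<sigma> V (\<lambda>x. m * indicator A x) powr (1/\<sigma>) + psum \<sigma> V v powr (1/\<sigma>)"
        by (rule lp_minkowski[OF fin_lp[OF fmi] fin_lp[OF fv] \<sigma>(1)])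
      also have "\<dots> \<le> m * (c * (\<Sum>s\<in>S. bd A s)) + c * psum 1 (V \<times> S) (grad v)"
        unfolding pi using c(2)[OF fA False] m IH \<sigma>(2) by (intro add_mono mult_left_mono) auto
      also have "\<dots> \<le> m * (c * psum 1 (V \<times> S) (grad (indicator A))) + c * psum 1 (V \<times> S) (grad v)"
        using bd_le_grad_indicator[OF fA] m c by (intro add_mono mult_left_mono) auto
      also have "\<dots> = c * psum 1 (V \<times> S) (grad u)" by (simp add: gsum algebra_simps)
      finally show ?thesis .
    qed
  qed
  show thesis
    by (rule that[OF c(1)]) (use claim in \<open>simp only: \<sigma>(2)[symmetric] \<sigma>_def[symmetric]\<close>)
qed

end

text \<open>Discrete version of the differential inequality
  \<open>\<psi>' \<le> - c \<psi>^(1 + a)\<close>: the quantity \<open>\<psi> n powr (- a)\<close>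
  grows by at least \<open>a * c\<close> in each step.\<close>

lemma recursion_decay:
  fixes \<psi> :: "nat \<Rightarrow> real"
  assumes pos: "\<And>n. 0 < \<psi> n" and le1: "\<And>n. \<psi> n \<le> 1" and c: "c > 0" and a: "a > 0"
    and rec: "\<And>n. \<psi> (Suc n) \<le> \<psi> n - c * \<psi> n powr (1 + a)"
  shows "\<exists>K>0. \<forall>n. \<psi> n \<le> K * real (Suc n) powr (- 1 / a)"
proof -
  have step: "\<psi> n powr (- a) + a * c \<le> \<psi> (Suc n) powr (- a)" for n
  proof -
    define x where "x = c * \<psi> n powr a"
    have 1: "\<psi> (Suc n) \<le> \<psi> n * (1 - x)" using rec[of n] pos[of n] by (simp add: x_def powr_add algebra_simps)
    have x: "1 - x > 0" using 1 pos[of "Suc n"] pos[of n] by (smt (verit) mult_nonneg_nonpos)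
    have "1 - x \<le> exp (- x)" using exp_ge_add_one_self[of "- x"] by simp
    then have "(exp (- x)) powr (- a) \<le> (1 - x) powr (- a)" using x a by (intro powr_mono2') auto
    then have "exp (a * x) \<le> (1 - x) powr (- a)" by (simp add: powr_def mult.commute)
    moreover have "1 + a * x \<le> exp (a * x)" by (rule exp_ge_add_one_self)
    ultimately have 2: "1 + a * x \<le> (1 - x) powr (- a)" by linarith
    have "\<psi> n powr (- a) + a * c = \<psi> n powr (- a) * (1 + a * x)"
      using pos[of n] by (simp add: x_def algebra_simps flip: powr_add)
    also have "\<dots> \<le> \<psi> n powr (- a) * (1 - x) powr (- a)" by (intro mult_left_mono 2) auto
    also have "\<dots> = (\<psi> n * (1 - x)) powr (- a)" using pos[of n] x by (simp add: powr_mult)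
    also have "\<dots> \<le> \<psi> (Suc n) powr (- a)" using 1 pos[of "Suc n"] a by (intro powr_mono2') auto
    finally show ?thesis .
  qed
  \<comment> \<open>The bound 1 serves the start of the induction, where only
    \<open>\<psi> 0 \<le> 1\<close> is known.\<close>
  define k where "k = min 1 (a * c)"
  have k: "k > 0" using a c by (simp add: k_def)
  have lower: "k * real (Suc n) \<le> \<psi> n powr (- a)" for n
  proof (induction n)
    case 0
    have "1 powr (- a) \<le> \<psi> 0 powr (- a)" using pos le1 a by (intro powr_mono2') auto
    then show ?case by (simp add: k_def)
  next
    case (Suc n)
    have "k * real (Suc (Suc n)) = k * real (Suc n) + k" by (simp add: algebra_simps)
    also have "\<dots> \<le> \<psi> n powr (- a) + a * c" using Suc by (intro add_mono) (auto simp: k_def)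
    finally show ?case using step[of n] by linarith
  qed
  have "\<psi> n \<le> k powr (- 1 / a) * real (Suc n) powr (- 1 / a)" for n
  proof -
    have "(\<psi> n powr (- a)) powr (- 1 / a) \<le> (k * real (Suc n)) powr (- 1 / a)"
      by (rule powr_mono2') (use lower[of n] k a in auto)
    then show ?thesis using pos[of n] a k by (simp add: powr_powr powr_mult)
  qed
  then show ?thesis using k by (intro exI[of _ "k powr (- 1 / a)"]) auto
qed

text \<open>Mean value theorem. Adding the terms of both endpoints makes the bound symmetric, as
  needed for an unoriented edge.\<close>

lemma powr_diff_bound:
  fixes a b g :: real
  assumes "a \<ge> 0" "b \<ge> 0" "g \<ge> 1"
  shows "\<bar>a powr g - b powr g\<bar> \<le> g * (\<bar>a - b\<bar> * (a powr (g - 1) + b powr (g - 1)))"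
proof -
  have *: "\<bar>a powr g - b powr g\<bar> \<le> g * (\<bar>a - b\<bar> * (a powr (g - 1) + b powr (g - 1)))"
    if "b \<le> a" "b \<ge> 0" for a b
  proof (cases "a = b \<or> b = 0")
    case True
    then show ?thesis
    proof
      assume "b = 0"
      have "a powr g = a * a powr (g - 1)" using powr_mult_base[of a "g - 1"] that by simp
      also have "\<dots> \<le> g * (a * a powr (g - 1))"
        using mult_right_mono[of 1 g "a * a powr (g - 1)"] assms(3) that by simp
      finally show ?thesis using \<open>b = 0\<close> that by (cases "a = 0") auto
    qed auto
  next
    case False
    then have ab: "0 < b" "b < a" using that by auto
    have "((\<lambda>x. x powr g) has_real_derivative g * x powr (g - 1)) (at x)" if "b \<le> x" for x
      using ab that by (intro has_real_derivative_powr) auto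
    then obtain z where z: "b < z" "z < a" "a powr g - b powr g = (a - b) * (g * z powr (g - 1))"
      using MVT2[OF ab(2), of "\<lambda>x. x powr g" "\<lambda>z. g * z powr (g - 1)"] by blast
    have "z powr (g - 1) \<le> a powr (g - 1)" using z ab assms by (intro powr_mono2) auto
    then have "(a - b) * (g * z powr (g - 1)) \<le> (a - b) * (g * (a powr (g - 1) + b powr (g - 1)))"
      using ab assms by (intro mult_left_mono) (auto intro: add_increasing2)
    moreover have "b powr g \<le> a powr g" using ab assms by (intro powr_mono2) auto
    ultimately show ?thesis using z ab by (simp add: mult_ac)
  qed
  show ?thesis
  proof (cases "b \<le> a")
    case False
    then show ?thesis using *[of a b] assms by (simp add: abs_minus_commute add.commute)
  qed (use * assms in auto)
qed

context cayley
begin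

lemma infsum_edge_right:
  "infsum (\<lambda>(x, s). f (x \<otimes> s)) (V \<times> S) = infsum (\<lambda>(x, s). f x) (V \<times> S)"
  "(\<lambda>(x, s). f (x \<otimes> s)) summable_on (V \<times> S) \<longleftrightarrow> (\<lambda>(x, s). f x) summable_on (V \<times> S)"
  using infsum_reindex_bij_betw[OF bij_edge_right, of "\<lambda>(x, s). f x"]
    summable_on_reindex_bij_betw[OF bij_edge_right, of "\<lambda>(x, s). f x"]
  by (auto simp: case_prod_unfold)

lemma summable_edge:
  fixes f :: "'a \<Rightarrow> real"
  assumes "f summable_on V" "\<And>x. x \<in> V \<Longrightarrow> f x \<ge> 0"
  shows "(\<lambda>(x, s). f x) summable_on (V \<times> S)" and "infsum (\<lambda>(x, s). f x) (V \<times> S) = card S * infsum f V"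
proof -
  show s: "(\<lambda>(x, s). f x) summable_on (V \<times> S)"
  proof (rule summable_on_SigmaI)
    show "(\<lambda>x. real (card S) * f x) summable_on V" by (intro summable_on_cmult_right assms)
    show "((\<lambda>s. case (x, s) of (x, s) \<Rightarrow> f x) has_sum real (card S) * f x) S" for x
      using finS by (intro has_sum_finiteI) auto
  qed (use assms in auto)
  have "infsum (\<lambda>(x, s). f x) (V \<times> S) = (\<Sum>\<^sub>\<infinity>x\<in>V. \<Sum>\<^sub>\<infinity>s\<in>S. f x)"
    using infsum_Sigma_banach[OF s] by simp
  then show "infsum (\<lambda>(x, s). f x) (V \<times> S) = card S * infsum f V"
    using finS by (simp add: infsum_cmult_right')
qed

lemma lp_edge:
  assumes "u \<in> lp q V"
  shows "(\<lambda>(x, s). u x) \<in> lp q (V \<times> S)" "psum q (V \<times> S) (\<lambda>(x, s). u x) = card S * psum q V u"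
    "(\<lambda>(x, s). u (x \<otimes> s)) \<in> lp q (V \<times> S)" "psum q (V \<times> S) (\<lambda>(x, s). u (x \<otimes> s)) = card S * psum q V u"
  using summable_edge[of "\<lambda>x. \<bar>u x\<bar> powr q"] infsum_edge_right[of "\<lambda>x. \<bar>u x\<bar> powr q"] assms
  by (auto simp: lp_def psum_def case_prod_unfold)

text \<open>The case of exponent 1 is applied to \<open>u powr \<gamma>\<close>. The power is fixed
  by \<open>\<gamma> * N / (N - 1) = m\<close>; then also \<open>(\<gamma> - 1) * p' = m\<close> for
  the dual exponent, so Hoelder's inequality returns the same power sum of \<open>u\<close>, with a
  smaller exponent, and it can be divided out.\<close>

lemma sobolev_p_finite:
  fixes p :: real
  assumes p: "1 \<le> p" "p < N"
  obtains C where "C \<ge> 0" "\<And>u. finite {x \<in> V. u x \<noteq> 0} \<Longrightarrow> (\<And>x. x \<in> V \<Longrightarrow> 0 \<le> u x) \<Longrightarrow>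
    psum (N * p / (N - p)) V u \<le> C * psum p (V \<times> S) (grad u) powr ((N * p / (N - p)) / p)"
proof -
  obtain c where c: "c > 0" "\<And>u. finite {x \<in> V. u x \<noteq> 0} \<Longrightarrow> (\<And>x. x \<in> V \<Longrightarrow> 0 \<le> u x) \<Longrightarrow>
    psum (N / (real N - 1)) V u powr ((real N - 1) / N) \<le> c * psum 1 (V \<times> S) (grad u)"
    using sobolev_1_finite by blast
  define m where "m = N * p / (N - p)"
  have m: "m > 0" "1 / m = 1 / p - 1 / N" using p by (auto simp: m_def field_simps)
  define \<gamma> where "\<gamma> = p * (real N - 1) / (N - p)"
  have \<gamma>: "\<gamma> \<ge> 1" using p N3 by (simp add: \<gamma>_def field_simps)
  have \<gamma>s: "\<gamma> * (N / (real N - 1)) = m"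
  proof -
    have "real N - 1 \<noteq> 0" using N3 by simp
    then show ?thesis by (simp add: \<gamma>_def m_def)
  qed
  have key: "\<exists>K\<ge>0. \<forall>u. finite {x \<in> V. u x \<noteq> 0} \<longrightarrow> (\<forall>x\<in>V. 0 \<le> u x) \<longrightarrow>
     psum 1 (V \<times> S) (grad (\<lambda>x. u x powr \<gamma>)) \<le> K * psum p (V \<times> S) (grad u) powr (1/p) * psum m V u powr (1 - 1/p)"
  proof (cases "p = 1")
    case True
    have "\<gamma> = 1" using True N3 by (simp add: \<gamma>_def)
    have "psum 1 (V \<times> S) (grad (\<lambda>x. u x powr \<gamma>)) \<le> 1 * psum p (V \<times> S) (grad u) powr (1/p) * psum m V u powr (1 - 1/p)"
      if u: "finite {x \<in> V. u x \<noteq> 0}" "\<forall>x\<in>V. 0 \<le> u x" for u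
    proof -
      have "psum 1 (V \<times> S) (grad (\<lambda>x. u x powr \<gamma>)) = psum 1 (V \<times> S) (grad u)"
        by (rule lp_cong) (use u \<open>\<gamma> = 1\<close> in auto)
      \<comment> \<open>The last factor is \<open>psum m V u powr 0\<close>, which is 0 instead of 1
        when the base vanishes; the left side vanishes then too.\<close>
      moreover have "psum 1 (V \<times> S) (grad u) = 0" if "psum m V u = 0"
      proof -
        have "u x = 0" if "x \<in> V" for x using psum_eq_0D[OF fin_lp[OF u(1)] \<open>psum m V u = 0\<close> that] .
        then show ?thesis unfolding psum_def by (intro infsum_0) auto
      qed
      ultimately show ?thesis using True by (cases "psum m V u = 0") auto
    qed
    then show ?thesis using zero_le_one by blast
  next
    case False
    define p' where "p' = p / (p - 1)"
    have p1: "p > 1" using p False by simp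
    have p': "p' > 1" "1 / p + 1 / p' = 1" "1 / p' = 1 - 1 / p" using p1 by (auto simp: p'_def field_simps)
    have "\<gamma> - 1 = N * (p - 1) / (N - p)" using p by (simp add: \<gamma>_def field_simps)
    then have gp: "(\<gamma> - 1) * p' = m" using p1 by (simp add: p'_def m_def)
    define K where "K = \<gamma> * (2 powr p' * (2 * card S)) powr (1/p')"
    have "psum 1 (V \<times> S) (grad (\<lambda>x. u x powr \<gamma>)) \<le> K * psum p (V \<times> S) (grad u) powr (1/p) * psum m V u powr (1 - 1/p)"
      if u: "finite {x \<in> V. u x \<noteq> 0}" "\<forall>x\<in>V. 0 \<le> u x" for u
    proof -
      define w where "w x = u x powr (\<gamma> - 1)" for x
      have fw: "finite {x \<in> V. w x \<noteq> 0}" using u(1) by (rule rev_finite_subset) (auto simp: w_def)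
      have f\<gamma>: "finite {x \<in> V. u x powr \<gamma> \<noteq> 0}" using u(1) by (rule rev_finite_subset) auto
      have wp: "psum p' V w = psum m V u" unfolding psum_def
        by (rule infsum_cong) (use u gp in \<open>auto simp: w_def powr_powr\<close>)
      define h where "h = (\<lambda>e. (case e of (x, s) \<Rightarrow> w x) + (case e of (x, s) \<Rightarrow> w (x \<otimes> s)))"
      have h: "h \<in> lp p' (V \<times> S)" "psum p' (V \<times> S) h \<le> 2 powr p' * (2 * card S) * psum m V u"
        using lp_add(1,2)[OF lp_edge(1)[OF fin_lp[OF fw]] lp_edge(3)[OF fin_lp[OF fw]], of p'] p'
        unfolding h_def by (auto simp: lp_edge(2,4)[OF fin_lp[OF fw]] wp)
      note hol = lp_hoelder[OF grad_lp_finite[OF u(1)] h(1) p1 p'(1,2)]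
      have "psum 1 (V \<times> S) (grad (\<lambda>x. u x powr \<gamma>)) \<le> (\<Sum>\<^sub>\<infinity>e\<in>V \<times> S. \<gamma> * \<bar>grad u e * h e\<bar>)"
        unfolding psum_def
      proof (rule infsum_mono)
        show "(\<lambda>e. \<bar>grad (\<lambda>x. u x powr \<gamma>) e\<bar> powr 1) summable_on V \<times> S"
          using grad_lp_finite[OF f\<gamma>, of 1] by (simp add: lp_def)
        show "(\<lambda>e. \<gamma> * \<bar>grad u e * h e\<bar>) summable_on V \<times> S"
          by (intro summable_on_cmult_right hol(1))
        fix e assume "e \<in> V \<times> S"
        then obtain x s where e: "e = (x, s)" "x \<in> V" "s \<in> S" "x \<otimes> s \<in> V" by auto
        have "h e \<ge> 0" by (simp add: h_def w_def e)
        then show "\<bar>grad (\<lambda>x. u x powr \<gamma>) e\<bar> powr 1 \<le> \<gamma> * \<bar>grad u e * h e\<bar>"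
          using powr_diff_bound[of "u (x \<otimes> s)" "u x" \<gamma>] u(2) e \<gamma>
          by (simp add: h_def w_def abs_mult add.commute)
      qed
      also have "\<dots> = \<gamma> * (\<Sum>\<^sub>\<infinity>e\<in>V \<times> S. \<bar>grad u e * h e\<bar>)" by (simp add: infsum_cmult_right')
      also have "\<dots> \<le> \<gamma> * (psum p (V \<times> S) (grad u) powr (1/p) * (2 powr p' * (2 * card S) * psum m V u) powr (1/p'))"
        using \<gamma> p' p1 h(2) hol(2)
        by (intro mult_left_mono order_trans[OF hol(2)] powr_mono2) auto
      also have "\<dots> = K * psum p (V \<times> S) (grad u) powr (1/p) * psum m V u powr (1 - 1/p)"
        unfolding p'(3)[symmetric] K_def by (simp add: powr_mult)
      finally show ?thesis .
    qed
    moreover have "K \<ge> 0" using \<gamma> by (simp add: K_def)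
    ultimately show ?thesis by blast
  qed
  then obtain K where K: "K \<ge> 0" "\<And>u. finite {x \<in> V. u x \<noteq> 0} \<Longrightarrow> (\<And>x. x\<in>V \<Longrightarrow> 0 \<le> u x) \<Longrightarrow>
     psum 1 (V \<times> S) (grad (\<lambda>x. u x powr \<gamma>)) \<le> K * psum p (V \<times> S) (grad u) powr (1/p) * psum m V u powr (1 - 1/p)"
    by blast
  show thesis
  proof (rule that[of "(c * K) powr m"])
    fix u :: "'a \<Rightarrow> real" assume u: "finite {x \<in> V. u x \<noteq> 0}" "\<And>x. x \<in> V \<Longrightarrow> 0 \<le> u x"
    define X where "X = psum m V u"
    define Y where "Y = psum p (V \<times> S) (grad u)"
    have f\<gamma>: "finite {x \<in> V. u x powr \<gamma> \<noteq> 0}" using u(1) by (rule rev_finite_subset) auto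
    have "psum (N / (real N - 1)) V (\<lambda>x. u x powr \<gamma>) = X" unfolding X_def psum_def
      by (rule infsum_cong) (use u \<gamma>s in \<open>auto simp: powr_powr\<close>)
    then have "X powr ((real N - 1) / N) \<le> c * (K * Y powr (1/p) * X powr (1 - 1/p))"
      using order_trans[OF c(2)[OF f\<gamma>] mult_left_mono[OF K(2)[OF u]]] c(1) by (simp add: X_def Y_def)
    moreover have "(real N - 1) / N = 1 / m + (1 - 1/p)" using m p N3 by (simp add: field_simps)
    ultimately have le: "X powr (1/m) * X powr (1 - 1/p) \<le> (c * K * Y powr (1/p)) * X powr (1 - 1/p)"
      by (simp add: powr_add mult_ac)
    have "X \<le> (c * K) powr m * Y powr (m / p)"
    proof (cases "X = 0")
      case False
      then have X: "X > 0" by (metis X_def psum_nonneg order_le_less)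
      then have "X powr (1/m) \<le> c * K * Y powr (1/p)" using le by simp
      then have "(X powr (1/m)) powr m \<le> (c * K * Y powr (1/p)) powr m" using m by (intro powr_mono2) auto
      moreover have "(X powr (1/m)) powr m = X" using X m(1) by (simp add: powr_powr)
      ultimately show ?thesis using c(1) K(1) by (simp add: powr_powr powr_mult)
    qed simp
    then show "psum (N * p / (N - p)) V u \<le> (c * K) powr m * psum p (V \<times> S) (grad u) powr ((N * p / (N - p)) / p)"
      by (simp add: X_def Y_def m_def)
  qed simp
qed

text \<open>Lowering \<open>\<bar>u\<bar>\<close> by \<open>1 / (n + 1)\<close> and cutting at 0
  leaves a finite support, because \<open>u\<close> has a summable power, and does not increase
  differences; the limit is taken with Fatou's lemma.\<close>

lemma sobolev_p:
  fixes p :: real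
  assumes p: "1 \<le> p" "p < N"
  obtains C where "C \<ge> 0" "\<And>u. u \<in> lp (N * p / (N - p)) V \<Longrightarrow> grad u \<in> lp p (V \<times> S) \<Longrightarrow>
    psum (N * p / (N - p)) V u \<le> C * psum p (V \<times> S) (grad u) powr ((N * p / (N - p)) / p)"
proof -
  obtain C where C: "C \<ge> 0" "\<And>u. finite {x \<in> V. u x \<noteq> 0} \<Longrightarrow> (\<And>x. x \<in> V \<Longrightarrow> 0 \<le> u x) \<Longrightarrow>
    psum (N * p / (N - p)) V u \<le> C * psum p (V \<times> S) (grad u) powr ((N * p / (N - p)) / p)"
    using sobolev_p_finite[OF p] by blast
  define m where "m = N * p / (N - p)"
  have m: "m > 0" using p by (simp add: m_def)
  show thesis
  proof (rule that[OF C(1)], fold m_def)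
    fix u assume u: "u \<in> lp m V" "grad u \<in> lp p (V \<times> S)"
    define w where "w n x = max (\<bar>u x\<bar> - 1 / real (Suc n)) 0" for n x
    have fw: "finite {x \<in> V. w n x \<noteq> 0}" for n
      by (rule finite_subset[OF _ lp_finite_superlevel[OF u(1), of "1 / real (Suc n)"]])
        (use m in \<open>auto simp: w_def max_def split: if_splits\<close>)
    have "psum m V (w n) \<le> C * psum p (V \<times> S) (grad u) powr (m / p)" for n
    proof -
      have "psum m V (w n) \<le> C * psum p (V \<times> S) (grad (w n)) powr (m / p)"
        unfolding m_def by (rule C(2)[OF fw]) (simp add: w_def)
      also have "\<dots> \<le> C * psum p (V \<times> S) (grad u) powr (m / p)"
      proof (intro mult_left_mono powr_mono2 C(1))
        show "psum p (V \<times> S) (grad (w n)) \<le> psum p (V \<times> S) (grad u)"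
          by (rule lp_mono(2)[OF u(2)]) (use p in \<open>auto simp: w_def max_def\<close>)
      qed (use m p in auto)
      finally show ?thesis .
    qed
    then have "psum m V (\<lambda>x. \<bar>u x\<bar>) \<le> C * psum p (V \<times> S) (grad u) powr (m / p)"
    proof (rule lp_fatou(2)[OF fin_lp[OF fw] _ _ m])
      fix x
      have "(\<lambda>n. max (\<bar>u x\<bar> - 1 / real (Suc n)) 0) \<longlonglongrightarrow> max (\<bar>u x\<bar> - 0) 0"
        by (intro tendsto_intros LIMSEQ_Suc[OF lim_1_over_n])
      then show "(\<lambda>n. w n x) \<longlonglongrightarrow> \<bar>u x\<bar>" by (simp add: w_def)
    qed
    then show "psum m V u \<le> C * psum p (V \<times> S) (grad u) powr (m / p)" by (simp add: psum_def)
  qed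
qed

end

subsection \<open>Decay of the lazy random walk\<close>

context cayley
begin

abbreviation fin :: "('a \<Rightarrow> real) \<Rightarrow> bool" where
  "fin u \<equiv> finite {x \<in> V. u x \<noteq> 0}"

lemma fin_summable:
  fixes w f :: "'a \<Rightarrow> real"
  assumes "fin w" "\<And>x. x \<in> V \<Longrightarrow> w x = 0 \<Longrightarrow> f x = 0"
  shows "f summable_on V"
  by (rule finite_nonzero_values_imp_summable_on, rule finite_subset[OF _ assms(1)]) (use assms(2) in auto)

section \<open>Laplacian and summation by parts\<close>

lemma laplacian_cong: "(\<And>x. x \<in> V \<Longrightarrow> u x = v x) \<Longrightarrow> laplacian G S u x = laplacian G S v x"
  by (cases "x \<in> V") (auto simp: laplacian_eq laplacian_def nbrs_def cayley_adj_def intro!: sum.cong)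

lemma laplacian_linear: 
  "laplacian G S (\<lambda>x. a * u x + b * v x) x = a * laplacian G S u x + b * laplacian G S v x"
  by (simp add: laplacian_def sum_distrib_left sum_subtractf[symmetric] sum.distrib[symmetric] algebra_simps)

lemma laplacian_translate:
  "g \<in> V \<Longrightarrow> x \<in> V \<Longrightarrow> laplacian G S (\<lambda>z. u (g \<otimes> z)) x = laplacian G S u (g \<otimes> x)"
  by (simp add: laplacian_eq m_assoc)

lemma fin_laplacian: assumes "fin u" shows "fin (laplacian G S u)"
proof (rule finite_subset)
  let ?F = "{x \<in> V. u x \<noteq> 0}"
  show "finite (?F \<union> (\<Union>s\<in>S. (\<lambda>x. x \<otimes> inv s) ` ?F))" using assms finS by auto
  show "{x \<in> V. laplacian G S u x \<noteq> 0} \<subseteq> ?F \<union> (\<Union>s\<in>S. (\<lambda>x. x \<otimes> inv s) ` ?F)"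
  proof clarify
    fix x assume x: "x \<in> V" "laplacian G S u x \<noteq> 0" "x \<notin> (\<Union>s\<in>S. (\<lambda>x. x \<otimes> inv s) ` ?F)" "u x = 0"
    have "u (x \<otimes> s) = 0" if "s \<in> S" for s
    proof (rule ccontr)
      assume "u (x \<otimes> s) \<noteq> 0"
      then have "(x \<otimes> s) \<otimes> inv s \<in> (\<lambda>x. x \<otimes> inv s) ` ?F" using x(1) that by (intro imageI) simp
      then show False using x(1,3) that by (auto simp: m_assoc)
    qed
    then show False using x by (simp add: laplacian_eq)
  qed
qed

text \<open>Reversing the edges turns the sum of \<open>g\<close> times the value of
  \<open>w\<close> at the endpoint into minus the sum with the value at the starting point, whence
  the factor \<open>- 2\<close>.\<close>

lemma div_formula_gen:
  fixes g :: "'a \<times> 'a \<Rightarrow> real"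
  assumes anti: "\<And>x s. x \<in> V \<Longrightarrow> s \<in> S \<Longrightarrow> g (x \<otimes> s, inv s) = - g (x, s)"
    and sm: "(\<lambda>(x, s). g (x, s) * w x) summable_on V \<times> S"
  shows "(\<lambda>e. g e * grad w e) summable_on V \<times> S"
    and "(\<Sum>\<^sub>\<infinity>e\<in>V \<times> S. g e * grad w e) = - 2 * (\<Sum>\<^sub>\<infinity>x\<in>V. (\<Sum>s\<in>S. g (x, s)) * w x)"
proof -
  define h where "h = (\<lambda>(x, s). g (x, s) * w x)"
  define k where "k = (\<lambda>(x, s). g (x, s) * w (x \<otimes> s))"
  have hs: "h summable_on V \<times> S" using sm by (simp add: h_def)
  have kh: "k e = - h ((\<lambda>(x, s). (x \<otimes> s, inv s)) e)" if "e \<in> V \<times> S" for e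
    using that anti by (auto simp: h_def k_def)
  have "(\<lambda>e. - h ((\<lambda>(x, s). (x \<otimes> s, inv s)) e)) summable_on V \<times> S"
    using summable_on_reindex_bij_betw[OF bij_edge_right, of h] hs by (simp add: summable_on_uminus)
  then have ks: "k summable_on V \<times> S" using kh by (simp cong: summable_on_cong)
  have "infsum k (V \<times> S) = (\<Sum>\<^sub>\<infinity>e\<in>V \<times> S. - h ((\<lambda>(x, s). (x \<otimes> s, inv s)) e))"
    using kh by (rule infsum_cong)
  then have ki: "infsum k (V \<times> S) = - infsum h (V \<times> S)"
    using infsum_reindex_bij_betw[OF bij_edge_right, of h] by (simp add: infsum_uminus)
  have gk: "g e * grad w e = k e + - h e" for e by (cases e) (simp add: h_def k_def algebra_simps)
  show "(\<lambda>e. g e * grad w e) summable_on V \<times> S"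
    unfolding gk using ks hs by (intro summable_on_add) (simp_all add: summable_on_uminus)
  have "infsum h (V \<times> S) = (\<Sum>\<^sub>\<infinity>x\<in>V. \<Sum>\<^sub>\<infinity>s\<in>S. h (x, s))"
    using infsum_Sigma_banach[OF hs] by simp
  also have "\<dots> = (\<Sum>\<^sub>\<infinity>x\<in>V. (\<Sum>s\<in>S. g (x, s)) * w x)"
    using finS by (intro infsum_cong) (simp add: h_def sum_distrib_right)
  finally have hi: "infsum h (V \<times> S) = (\<Sum>\<^sub>\<infinity>x\<in>V. (\<Sum>s\<in>S. g (x, s)) * w x)" .
  have "(\<Sum>\<^sub>\<infinity>e\<in>V \<times> S. g e * grad w e) = infsum k (V \<times> S) + (\<Sum>\<^sub>\<infinity>e\<in>V \<times> S. - h e)"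
    unfolding gk using ks hs by (intro infsum_add) (simp_all add: summable_on_uminus)
  then show "(\<Sum>\<^sub>\<infinity>e\<in>V \<times> S. g e * grad w e) = - 2 * (\<Sum>\<^sub>\<infinity>x\<in>V. (\<Sum>s\<in>S. g (x, s)) * w x)"
    by (simp add: ki hi infsum_uminus)
qed

lemma fin_summable_edge:
  fixes w :: "'a \<Rightarrow> real" and f :: "'a \<times> 'a \<Rightarrow> real"
  assumes "fin w" "\<And>x s. x \<in> V \<Longrightarrow> w x = 0 \<Longrightarrow> f (x, s) = 0"
  shows "f summable_on V \<times> S"
  by (rule finite_nonzero_values_imp_summable_on, rule finite_subset[of _ "{x \<in> V. w x \<noteq> 0} \<times> S"])
    (use assms finS in auto)

lemma div_formula:
  fixes g :: "'a \<times> 'a \<Rightarrow> real"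
  assumes anti: "\<And>x s. x \<in> V \<Longrightarrow> s \<in> S \<Longrightarrow> g (x \<otimes> s, inv s) = - g (x, s)" and w: "fin w"
  shows "(\<lambda>e. g e * grad w e) summable_on V \<times> S"
    and "(\<Sum>\<^sub>\<infinity>e\<in>V \<times> S. g e * grad w e) = - 2 * (\<Sum>\<^sub>\<infinity>x\<in>V. (\<Sum>s\<in>S. g (x, s)) * w x)"
  by (rule div_formula_gen[OF anti], assumption+, rule fin_summable_edge[OF w], simp)+

lemma grad_anti: "x \<in> V \<Longrightarrow> s \<in> S \<Longrightarrow> grad u (x \<otimes> s, inv s) = - grad u (x, s)"
  by (simp add: m_assoc)

lemma green_formula:
  assumes "fin w"
  shows "(\<Sum>\<^sub>\<infinity>x\<in>V. laplacian G S u x * w x) = - (\<Sum>\<^sub>\<infinity>e\<in>V \<times> S. grad u e * grad w e) / 2"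
proof -
  have "(\<Sum>\<^sub>\<infinity>x\<in>V. laplacian G S u x * w x) = (\<Sum>\<^sub>\<infinity>x\<in>V. (\<Sum>s\<in>S. grad u (x, s)) * w x)"
    by (rule infsum_cong) (simp add: laplacian_eq)
  then show ?thesis using div_formula(2)[of "grad u", OF grad_anti assms] by simp
qed

text \<open>Edge reversal moves the shift from one function to the other. Finite support of
  \<open>w\<close> alone keeps all sums finite, so \<open>u\<close> may be arbitrary: the constant 1
  in \<open>sum_laplacian\<close>, the nonlinear term in the Euler--Lagrange equation.\<close>

lemma laplacian_symmetric:
  assumes "fin w"
  shows "(\<Sum>\<^sub>\<infinity>x\<in>V. u x * laplacian G S w x) = (\<Sum>\<^sub>\<infinity>x\<in>V. laplacian G S u x * w x)"
proof -
  define k where "k = (\<lambda>(x, s). u (x \<otimes> s) * w x)"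
  have ks: "k summable_on V \<times> S" by (rule fin_summable_edge[OF assms]) (simp add: k_def)
  define h where "h = (\<lambda>(x, s). u x * w (x \<otimes> s))"
  have hk: "h e = k ((\<lambda>(x, s). (x \<otimes> s, inv s)) e)" if "e \<in> V \<times> S" for e
    using that by (auto simp: h_def k_def m_assoc)
  have "(\<lambda>e. k ((\<lambda>(x, s). (x \<otimes> s, inv s)) e)) summable_on V \<times> S"
    using summable_on_reindex_bij_betw[OF bij_edge_right, of k] ks by simp
  then have hs: "h summable_on V \<times> S" using hk by (simp cong: summable_on_cong)
  have "infsum h (V \<times> S) = (\<Sum>\<^sub>\<infinity>e\<in>V \<times> S. k ((\<lambda>(x, s). (x \<otimes> s, inv s)) e))" using hk by (rule infsum_cong)
  then have e: "infsum h (V \<times> S) = infsum k (V \<times> S)"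
    using infsum_reindex_bij_betw[OF bij_edge_right, of k] by simp
  have hx: "infsum h (V \<times> S) = (\<Sum>\<^sub>\<infinity>x\<in>V. \<Sum>s\<in>S. h (x, s))" "(\<lambda>x. \<Sum>s\<in>S. h (x, s)) summable_on V"
    using infsum_Sigma_banach[OF hs] summable_on_SigmaD[OF hs] finS by simp_all
  have kx: "infsum k (V \<times> S) = (\<Sum>\<^sub>\<infinity>x\<in>V. \<Sum>s\<in>S. k (x, s))" "(\<lambda>x. \<Sum>s\<in>S. k (x, s)) summable_on V"
    using infsum_Sigma_banach[OF ks] summable_on_SigmaD[OF ks] finS by simp_all
  have d: "(\<lambda>x. - (real (card S) * (u x * w x))) summable_on V" by (rule fin_summable[OF assms]) simp
  have "(\<Sum>\<^sub>\<infinity>x\<in>V. u x * laplacian G S w x) = (\<Sum>\<^sub>\<infinity>x\<in>V. (\<Sum>s\<in>S. h (x, s)) + - (real (card S) * (u x * w x)))"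
    by (rule infsum_cong) (simp add: h_def laplacian_eq sum_subtractf sum_distrib_left algebra_simps)
  also have "\<dots> = infsum h (V \<times> S) + (\<Sum>\<^sub>\<infinity>x\<in>V. - (real (card S) * (u x * w x)))"
    unfolding hx(1) by (rule infsum_add[OF hx(2) d])
  also have "\<dots> = (\<Sum>\<^sub>\<infinity>x\<in>V. (\<Sum>s\<in>S. k (x, s)) + - (real (card S) * (u x * w x)))"
    unfolding e kx(1) by (rule infsum_add[OF kx(2) d, symmetric])
  also have "\<dots> = (\<Sum>\<^sub>\<infinity>x\<in>V. laplacian G S u x * w x)"
    by (rule infsum_cong) (simp add: k_def laplacian_eq sum_subtractf sum_distrib_left sum_distrib_right algebra_simps)
  finally show ?thesis .
qed

section \<open>The lazy walk operator and Nash's inequality\<close>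

definition deg :: real where "deg = real (card S)"

lemma deg_pos [simp]: "deg > 0" using S_nonempty by (simp add: deg_def)

lemma deg_nonzero [simp]: "deg \<noteq> 0" using deg_pos by linarith

text \<open>One step of the lazy random walk. Laziness makes the operator nonnegative, so the \<open>\<ell>\<^sup>2\<close> norm of
  its iterates dissipates at least the Dirichlet energy, and \<open>\<Delta> = 2 * deg * (lazy - id)\<close> turns the
  heat semigroup into a Poisson mixture of these iterates.\<close>

definition lazy :: "('a \<Rightarrow> real) \<Rightarrow> 'a \<Rightarrow> real" where
  "lazy u x = u x + laplacian G S u x / (2 * deg)"

lemma lazy_eq: "x \<in> V \<Longrightarrow> lazy u x = u x / 2 + (\<Sum>s\<in>S. u (x \<otimes> s)) / (2 * deg)"
  using deg_pos by (simp add: lazy_def laplacian_eq sum_subtractf deg_def field_simps)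

lemma lazy_cong: "(\<And>x. x \<in> V \<Longrightarrow> u x = v x) \<Longrightarrow> x \<in> V \<Longrightarrow> lazy u x = lazy v x"
  by (simp add: lazy_def laplacian_cong[of u v])

lemma fin_lazy: assumes "fin u" shows "fin (lazy u)"
  by (rule finite_subset[OF _ finite_UnI[OF assms fin_laplacian[OF assms]]]) (auto simp: lazy_def)

lemma lazy_translate:
  "g \<in> V \<Longrightarrow> x \<in> V \<Longrightarrow> lazy (\<lambda>z. u (g \<otimes> z)) x = lazy u (g \<otimes> x)"
  by (simp add: lazy_def laplacian_translate)

definition ip :: "('a \<Rightarrow> real) \<Rightarrow> ('a \<Rightarrow> real) \<Rightarrow> real" where
  "ip u v = (\<Sum>\<^sub>\<infinity>x\<in>V. u x * v x)"

lemma ip_commute: "ip u v = ip v u" by (simp add: ip_def mult.commute)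

lemma ip_add_right: 
  assumes "fin u" shows "ip u (\<lambda>x. a * v x + b * w x) = a * ip u v + b * ip u w"
proof -
  have "ip u (\<lambda>x. a * v x + b * w x) = (\<Sum>\<^sub>\<infinity>x\<in>V. a * (u x * v x) + b * (u x * w x))"
    unfolding ip_def by (rule infsum_cong) (simp add: algebra_simps)
  also have "\<dots> = a * ip u v + b * ip u w"
    unfolding ip_def infsum_cmult_right'[symmetric]
    by (rule infsum_add) (auto intro!: fin_summable[OF assms])
  finally show ?thesis .
qed

lemma ip_lazy:
  assumes "fin u" shows "ip u (lazy v) = ip u v + ip u (laplacian G S v) / (2 * deg)"
proof -
  have "lazy v = (\<lambda>x. 1 * v x + 1 / (2 * deg) * laplacian G S v x)" by (rule ext) (simp add: lazy_def)
  then show ?thesis using ip_add_right[OF assms, of 1 v "1 / (2 * deg)" "laplacian G S v"] by simp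
qed

lemma ip_laplacian: "fin w \<Longrightarrow> ip u (laplacian G S w) = ip (laplacian G S u) w"
  unfolding ip_def by (rule laplacian_symmetric)

lemma ip_lazy_symmetric:
  assumes "fin u" "fin w" shows "ip u (lazy w) = ip (lazy u) w"
  using ip_lazy[OF assms(1), of w] ip_lazy[OF assms(2), of u] ip_laplacian[OF assms(2), of u]
  by (simp add: ip_commute)

lemma ip_lazy_pow: 
  assumes "fin u" "fin w" 
  shows "fin ((lazy ^^ n) w)" "ip u ((lazy ^^ n) w) = ip ((lazy ^^ n) u) w"
proof -
  have f: "fin ((lazy ^^ n) w)" if "fin w" for w n by (induction n) (use that fin_lazy in auto)
  show "fin ((lazy ^^ n) w)" using f assms by blast
  show "ip u ((lazy ^^ n) w) = ip ((lazy ^^ n) u) w" using assms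
  proof (induction n arbitrary: w)
    case (Suc n)
    have "ip u ((lazy ^^ Suc n) w) = ip u ((lazy ^^ n) (lazy w))" by (simp add: funpow_swap1)
    also have "\<dots> = ip ((lazy ^^ n) u) (lazy w)" using Suc fin_lazy by blast
    also have "\<dots> = ip ((lazy ^^ Suc n) u) w" using ip_lazy_symmetric[OF f[OF Suc.prems(1)] Suc.prems(2)] by simp
    finally show ?case .
  qed simp
qed

lemma dirichlet: "fin u \<Longrightarrow> ip u (laplacian G S u) = - psum 2 (V \<times> S) (grad u) / 2"
  unfolding ip_commute[of u] unfolding ip_def green_formula by (simp add: psum_def power2_eq_square)

lemma laplacian_sq_le: "x \<in> V \<Longrightarrow> (laplacian G S u x)\<^sup>2 \<le> deg * (\<Sum>s\<in>S. (grad u (x, s))\<^sup>2)"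
  using Cauchy_Schwarz_ineq_sum[of "\<lambda>s. grad u (x, s)" "\<lambda>_. 1" S]
  by (simp add: laplacian_eq deg_def mult.commute)

lemma infsum_edge_fin:
  assumes "fin u" "q \<ge> 0"
  shows "(\<lambda>x. \<Sum>s\<in>S. \<bar>grad u (x, s)\<bar> powr q) summable_on V"
    and "psum q (V \<times> S) (grad u) = (\<Sum>\<^sub>\<infinity>x\<in>V. \<Sum>s\<in>S. \<bar>grad u (x, s)\<bar> powr q)"
proof -
  have s: "(\<lambda>e. \<bar>grad u e\<bar> powr q) summable_on V \<times> S" using grad_lp_finite[OF assms(1)] by (simp add: lp_def)
  show "(\<lambda>x. \<Sum>s\<in>S. \<bar>grad u (x, s)\<bar> powr q) summable_on V"
    using summable_on_SigmaD[OF s] finS by simp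
  show "psum q (V \<times> S) (grad u) = (\<Sum>\<^sub>\<infinity>x\<in>V. \<Sum>s\<in>S. \<bar>grad u (x, s)\<bar> powr q)"
    using infsum_Sigma_banach[OF s] finS by (simp add: psum_def)
qed

text \<open>With \<open>D = psum 2 (V \<times> S) (grad u)\<close>, expanding the square gives a
  first-order term \<open>- D / (2 * deg)\<close> and, by Cauchy--Schwarz, a second-order term of at
  most \<open>D / (4 * deg)\<close>. With the full step \<open>1 / deg\<close> in place of the lazy
  one these bounds would cancel.\<close>

lemma lazy_dissipation:
  assumes "fin u"
  shows "ip (lazy u) (lazy u) \<le> ip u u - psum 2 (V \<times> S) (grad u) / (4 * deg)"
proof -
  let ?L = "laplacian G S u"
  have fL: "fin ?L" by (rule fin_laplacian[OF assms])
  have "ip ?L ?L \<le> (\<Sum>\<^sub>\<infinity>x\<in>V. deg * (\<Sum>s\<in>S. \<bar>grad u (x, s)\<bar> powr 2))"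
    unfolding ip_def
  proof (rule infsum_mono)
    show "(\<lambda>x. ?L x * ?L x) summable_on V" by (rule fin_summable[OF fL]) simp
    show "(\<lambda>x. deg * (\<Sum>s\<in>S. \<bar>grad u (x, s)\<bar> powr 2)) summable_on V"
      by (intro summable_on_cmult_right infsum_edge_fin[OF assms]) simp
    show "?L x * ?L x \<le> deg * (\<Sum>s\<in>S. \<bar>grad u (x, s)\<bar> powr 2)" if "x \<in> V" for x
      using laplacian_sq_le[OF that, of u] by (simp add: power2_eq_square)
  qed
  also have "\<dots> = deg * psum 2 (V \<times> S) (grad u)"
    using infsum_edge_fin(2)[OF assms, of 2] by (simp add: infsum_cmult_right')
  finally have LL: "ip ?L ?L \<le> deg * psum 2 (V \<times> S) (grad u)" .
  have "ip (lazy u) (lazy u) = ip u (lazy u) + ip ?L (lazy u) / (2 * deg)"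
    using ip_lazy[OF fin_lazy[OF assms], of u] by (simp add: ip_commute)
  also have "\<dots> = ip u u + 2 * (ip u ?L / (2 * deg)) + ip ?L ?L / (2 * deg) / (2 * deg)"
    using ip_lazy[OF assms, of u] ip_lazy[OF fL, of u] by (simp add: ip_commute[of ?L u] add_divide_distrib)
  also have "\<dots> \<le> ip u u + 2 * (ip u ?L / (2 * deg)) + deg * psum 2 (V \<times> S) (grad u) / (2 * deg) / (2 * deg)"
    using LL less_imp_le[OF deg_pos] by (intro add_left_mono divide_right_mono) auto
  also have "\<dots> = ip u u - psum 2 (V \<times> S) (grad u) / (4 * deg)"
    using deg_pos by (simp add: dirichlet[OF assms] field_simps)
  finally show ?thesis .
qed

lemma nash:
  obtains c where "c > 0" "\<And>u. fin u \<Longrightarrow> psum 1 V u = 1 \<Longrightarrow> c * ip u u powr (1 + 2 / N) \<le> psum 2 (V \<times> S) (grad u)"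
proof -
  have N: "real N > 2" using N3 by simp
  define m where "m = N * 2 / (real N - 2)"
  have m: "m > 2" using N by (simp add: m_def field_simps)
  obtain C where C: "C \<ge> 0" "\<And>u. u \<in> lp (N * 2 / (real N - 2)) V \<Longrightarrow> grad u \<in> lp 2 (V \<times> S) \<Longrightarrow>
    psum (N * 2 / (real N - 2)) V u \<le> C * psum 2 (V \<times> S) (grad u) powr ((N * 2 / (real N - 2)) / 2)"
    using sobolev_p[of 2] N by auto
  \<comment> \<open>The solution of \<open>t + m * (1 - t) = 2\<close>: Hoelder's inequality with
    exponents \<open>1 / t\<close> and \<open>1 / (1 - t)\<close> then interpolates the square
    between exponent 1 and the Sobolev exponent.\<close>
  define t where "t = 4 / (real N + 2)"
  have t: "0 < t" "t < 1" using N by (auto simp: t_def)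
  have tm: "t + m * (1 - t) = 2"
  proof -
    have "1 - t = (real N - 2) / (real N + 2)" by (simp add: t_def field_simps)
    then have "m * (1 - t) = 2 * N / (real N + 2)" using N by (simp add: m_def)
    then have "t + m * (1 - t) = (4 + 2 * real N) / (real N + 2)" by (simp add: t_def add_divide_distrib)
    also have "\<dots> = 2" by (subst divide_eq_eq) auto
    finally show ?thesis .
  qed
  have mt: "m / 2 * (1 - t) = N / (real N + 2)"
  proof -
    have "1 - t = (real N - 2) / (real N + 2)" by (simp add: t_def field_simps)
    moreover have "m / 2 = N / (real N - 2)" using N by (simp add: m_def field_simps)
    ultimately have "m / 2 * (1 - t) = N / (real N - 2) * ((real N - 2) / (real N + 2))" by (simp only:)
    also have "\<dots> = N / (real N + 2)" using N by simp
    finally show ?thesis .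
  qed
  have B: "ip u u \<le> (C + 1) powr (1 - t) * psum 2 (V \<times> S) (grad u) powr (N / (real N + 2))"
    if u: "fin u" "psum 1 V u = 1" for u
  proof -
    define f where "f x = \<bar>u x\<bar> powr t" for x
    define g where "g x = \<bar>u x\<bar> powr (m * (1 - t))" for x
    have ff: "fin f" by (rule finite_subset[OF _ u(1)]) (auto simp: f_def)
    have fg: "fin g" by (rule finite_subset[OF _ u(1)]) (auto simp: g_def)
    have "ip u u = (\<Sum>\<^sub>\<infinity>x\<in>V. \<bar>f x * g x\<bar>)" unfolding ip_def
      by (rule infsum_cong) (simp add: f_def g_def tm power2_eq_square flip: powr_add)
    also have "\<dots> \<le> psum (1/t) V f powr (1 / (1/t)) * psum (1/(1-t)) V g powr (1 / (1/(1-t)))"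
      by (rule lp_hoelder(2)[OF fin_lp[OF ff] fin_lp[OF fg]]) (use t in auto)
    also have "psum (1/t) V f = psum 1 V u" unfolding psum_def
      by (rule infsum_cong) (use t in \<open>simp add: f_def powr_powr\<close>)
    also have "psum (1/(1-t)) V g = psum m V u" unfolding psum_def
      by (rule infsum_cong) (use t in \<open>simp add: g_def powr_powr\<close>)
    also have "psum 1 V u powr (1 / (1/t)) * psum m V u powr (1 / (1/(1-t))) = psum m V u powr (1 - t)"
      using u(2) by simp
    also have "\<dots> \<le> ((C + 1) * psum 2 (V \<times> S) (grad u) powr (m / 2)) powr (1 - t)"
    proof (intro powr_mono2)
      have "psum m V u \<le> C * psum 2 (V \<times> S) (grad u) powr (m / 2)"
        unfolding m_def by (rule C(2)[OF fin_lp[OF u(1)] grad_lp_finite[OF u(1)]])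
      also have "\<dots> \<le> (C + 1) * psum 2 (V \<times> S) (grad u) powr (m / 2)" by (intro mult_right_mono) auto
      finally show "psum m V u \<le> (C + 1) * psum 2 (V \<times> S) (grad u) powr (m / 2)" .
    qed (use t in auto)
    also have "\<dots> = (C + 1) powr (1 - t) * psum 2 (V \<times> S) (grad u) powr (N / (real N + 2))"
      by (simp only: powr_mult powr_powr mt)
    finally show ?thesis .
  qed
  \<comment> \<open>Using \<open>C + 1\<close> instead of \<open>C\<close> ensures that
    \<open>K\<close> is positive, also for \<open>C = 0\<close>.\<close>
  define K where "K = ((C + 1) powr (1 - t)) powr ((real N + 2) / N)"
  have K: "K > 0" using C(1) by (simp add: K_def)
  have e: "1 + 2 / real N = (real N + 2) / N" using N by (simp add: field_simps)
  show thesis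
  proof (rule that[of "1 / K"])
    fix u assume u: "fin u" "psum 1 V u = 1"
    have "0 \<le> ip u u" unfolding ip_def by (rule infsum_nonneg) simp
    then have "ip u u powr ((real N + 2) / N) \<le> ((C + 1) powr (1 - t) * psum 2 (V \<times> S) (grad u) powr (N / (real N + 2))) powr ((real N + 2) / N)"
      using B[OF u] N by (intro powr_mono2) auto
    also have "\<dots> = K * psum 2 (V \<times> S) (grad u)"
      using N by (simp add: powr_mult powr_powr K_def)
    finally show "1 / K * ip u u powr (1 + 2 / N) \<le> psum 2 (V \<times> S) (grad u)"
      unfolding e using K by (simp add: field_simps)
  qed (use K in simp)
qed

text \<open>The probability that the lazy walk started at \<open>x\<close> is at \<open>y\<close>
  after \<open>n\<close> steps, taken as a function of \<open>x\<close>.\<close>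

definition kern :: "nat \<Rightarrow> 'a \<Rightarrow> 'a \<Rightarrow> real" where
  "kern n y = (lazy ^^ n) (indicator {y})"

lemma kern_0: "kern 0 y = indicator {y}" by (simp add: kern_def)
lemma kern_Suc: "kern (Suc n) y = lazy (kern n y)" by (simp add: kern_def)

lemma fin_indicator: "fin (indicator {y})"
  by (rule finite_subset[of _ "{y}"]) (auto simp: indicator_def)

lemma fin_kern: "fin (kern n y)"
  unfolding kern_def by (rule ip_lazy_pow(1)[OF fin_indicator fin_indicator])

lemma kern_nonneg: "x \<in> V \<Longrightarrow> 0 \<le> kern n y x"
proof (induction n arbitrary: x)
  case (Suc n) then show ?case using deg_pos by (auto simp: kern_Suc lazy_eq intro!: add_nonneg_nonneg sum_nonneg divide_nonneg_nonneg less_imp_le[OF deg_pos])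
qed (simp add: kern_0)

lemma ip_indicator: "x \<in> V \<Longrightarrow> ip u (indicator {x}) = u x"
proof -
  assume x: "x \<in> V"
  have "ip u (indicator {x}) = (\<Sum>\<^sub>\<infinity>z\<in>{x}. u z * indicator {x} z)"
    unfolding ip_def by (rule infsum_cong_neutral) (use x in auto)
  then show ?thesis by simp
qed

lemma kern_symmetric: "x \<in> V \<Longrightarrow> y \<in> V \<Longrightarrow> kern n y x = kern n x y"
  using ip_lazy_pow(2)[OF fin_indicator[of x] fin_indicator[of y], of n] ip_indicator[of x "kern n y"] ip_indicator[of y "kern n x"]
  by (simp add: kern_def ip_commute)

lemma kern_translate:
  assumes "g \<in> V" "x \<in> V" "y \<in> V" shows "kern n (g \<otimes> y) (g \<otimes> x) = kern n y x"
  using assms(2)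
proof (induction n arbitrary: x)
  case 0
  then show ?case using assms by (auto simp: kern_0 indicator_def)
next
  case (Suc n)
  have "kern (Suc n) (g \<otimes> y) (g \<otimes> x) = lazy (\<lambda>z. kern n (g \<otimes> y) (g \<otimes> z)) x"
    unfolding kern_Suc by (rule lazy_translate[OF assms(1) Suc.prems, symmetric])
  also have "\<dots> = lazy (kern n y) x" by (rule lazy_cong[OF Suc.IH Suc.prems])
  finally show ?case by (simp add: kern_Suc)
qed

lemma sum_laplacian: "fin u \<Longrightarrow> (\<Sum>\<^sub>\<infinity>x\<in>V. laplacian G S u x) = 0"
proof -
  have "laplacian G S (\<lambda>_. 1) x = 0" for x by (simp add: laplacian_def)
  then show "fin u \<Longrightarrow> (\<Sum>\<^sub>\<infinity>x\<in>V. laplacian G S u x) = 0"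
    using laplacian_symmetric[of u "\<lambda>_. 1"] by simp
qed

lemma kern_sum: "y \<in> V \<Longrightarrow> infsum (kern n y) V = 1"
proof (induction n)
  case 0
  then show ?case using ip_indicator[of y "\<lambda>_. 1"] by (simp add: kern_0 ip_def)
next
  case (Suc n)
  have s: "kern n y summable_on V" "laplacian G S (kern n y) summable_on V"
    using fin_summable[OF fin_kern] fin_summable[OF fin_laplacian[OF fin_kern]] by blast+
  have "infsum (kern (Suc n) y) V = (\<Sum>\<^sub>\<infinity>x\<in>V. kern n y x + 1 / (2 * deg) * laplacian G S (kern n y) x)"
    by (rule infsum_cong) (simp add: kern_Suc lazy_def)
  also have "\<dots> = infsum (kern n y) V + 1 / (2 * deg) * infsum (laplacian G S (kern n y)) V"
    unfolding infsum_cmult_right'[symmetric] using s by (intro infsum_add summable_on_cmult_right)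
  finally show ?case using Suc sum_laplacian[OF fin_kern] by simp
qed

lemma kern_summable: "kern n y summable_on V" using fin_summable[OF fin_kern] by blast

lemma kern_psum1: "y \<in> V \<Longrightarrow> psum 1 V (kern n y) = 1"
proof -
  assume y: "y \<in> V"
  have "psum 1 V (kern n y) = infsum (kern n y) V" unfolding psum_def
    by (rule infsum_cong) (use kern_nonneg in auto)
  then show ?thesis using kern_sum[OF y] by simp
qed

lemma kern_le_1: "y \<in> V \<Longrightarrow> x \<in> V \<Longrightarrow> kern n y x \<le> 1"
  using lp_point_le[of "kern n y" 1 V x, OF fin_lp[OF fin_kern]] kern_psum1[of y n] kern_nonneg[of x n y] by simp

text \<open>The Chapman--Kolmogorov identity, by self-adjointness of the walk operator.\<close>

lemma kern_even: "x \<in> V \<Longrightarrow> y \<in> V \<Longrightarrow> kern (n + m) y x = ip (kern n x) (kern m y)"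
proof -
  assume xy: "x \<in> V" "y \<in> V"
  have "kern (n + m) y x = ip ((lazy ^^ n) ((lazy ^^ m) (indicator {y}))) (indicator {x})"
    using xy by (simp add: ip_indicator kern_def funpow_add)
  also have "\<dots> = ip ((lazy ^^ m) (indicator {y})) ((lazy ^^ n) (indicator {x}))"
    by (rule ip_lazy_pow(2)[symmetric]) (auto intro: fin_indicator ip_lazy_pow(1))
  finally show ?thesis by (simp add: kern_def ip_commute)
qed

text \<open>As the walk preserves total mass 1, Nash's inequality bounds the Dirichlet energy below
  by a power of the squared norm; inserted into the dissipation estimate it gives the recursion of
  \<open>recursion_decay\<close> with \<open>a = 2 / N\<close>.\<close>

lemma kern_decay:
  obtains K where "K > 0" "\<And>n x y. x \<in> V \<Longrightarrow> y \<in> V \<Longrightarrow> kern n y x \<le> K * real (Suc n) powr (- (real N / 2))"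
proof -
  obtain c where c: "c > 0" "\<And>u. fin u \<Longrightarrow> psum 1 V u = 1 \<Longrightarrow> c * ip u u powr (1 + 2 / N) \<le> psum 2 (V \<times> S) (grad u)"
    using nash by blast
  \<comment> \<open>Both the squared norm, to which dissipation applies, and the return probability
    after \<open>2 n\<close> steps.\<close>
  define \<psi> where "\<psi> n = ip (kern n \<one>) (kern n \<one>)" for n
  have \<psi>: "\<psi> n = kern (n + n) \<one> \<one>" for n by (simp add: \<psi>_def kern_even)
  have pos: "\<psi> n > 0" for n
  proof -
    have "\<psi> n \<ge> 0" unfolding \<psi> by (simp add: kern_nonneg)
    moreover have "\<psi> n \<noteq> 0"
    proof
      assume "\<psi> n = 0"
      then have "psum 2 V (kern n \<one>) = 0" by (simp add: \<psi>_def ip_def psum_def power2_eq_square)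
      then have "kern n \<one> x = 0" if "x \<in> V" for x using psum_eq_0D[OF fin_lp[OF fin_kern] _ that] by blast
      then have "infsum (kern n \<one>) V = 0" by (rule infsum_0)
      then show False using kern_sum[of \<one> n] by simp
    qed
    ultimately show ?thesis by simp
  qed
  have "\<psi> (Suc n) \<le> \<psi> n - c / (4 * deg) * \<psi> n powr (1 + 2 / N)" for n
  proof -
    have "c * \<psi> n powr (1 + 2 / N) / (4 * deg) \<le> psum 2 (V \<times> S) (grad (kern n \<one>)) / (4 * deg)"
      unfolding \<psi>_def by (intro divide_right_mono c(2) fin_kern kern_psum1) (use deg_pos in \<open>auto intro: less_imp_le\<close>)
    then show ?thesis using lazy_dissipation[OF fin_kern[of n \<one>]] by (simp add: \<psi>_def kern_Suc)
  qed
  then obtain K where K: "K > 0" "\<And>n. \<psi> n \<le> K * real (Suc n) powr (- 1 / (2 / real N))"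
    using recursion_decay[of \<psi> "c / (4 * deg)" "2 / real N"] pos kern_le_1[of \<one> \<one>] \<psi> c(1) N3 by auto
  \<comment> \<open>Off the diagonal \<open>2 a b \<le> a\<^sup>2 + b\<^sup>2\<close> suffices,
    since by translation invariance the squared norm is the same for every starting point.\<close>
  have even: "kern (n + n) y x \<le> \<psi> n" if "x \<in> V" "y \<in> V" for n x y
  proof -
    have inv: "ip (kern n z) (kern n z) = \<psi> n" if "z \<in> V" for z
      using kern_even[OF that that, of n n] kern_translate[OF that one_closed one_closed, of "n + n"] that \<psi> by simp
    have s: "(\<lambda>z. kern n y' z * kern n x' z) summable_on V" for x' y'
      by (rule fin_summable[OF fin_kern[of n y']]) simp
    have "ip (kern n x) (kern n y) \<le> (\<Sum>\<^sub>\<infinity>z\<in>V. 1/2 * (kern n x z * kern n x z) + 1/2 * (kern n y z * kern n y z))"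
      unfolding ip_def
    proof (rule infsum_mono)
      show "kern n x z * kern n y z \<le> 1/2 * (kern n x z * kern n x z) + 1/2 * (kern n y z * kern n y z)" for z
        using sum_squares_bound[of "kern n x z" "kern n y z"] by (simp add: power2_eq_square)
    qed (intro s summable_on_add summable_on_cmult_right)+
    also have "\<dots> = 1/2 * ip (kern n x) (kern n x) + 1/2 * ip (kern n y) (kern n y)"
      unfolding ip_def infsum_cmult_right'[symmetric] by (intro infsum_add s summable_on_cmult_right)
    finally show ?thesis using inv that by (simp add: kern_even)
  qed
  have bd: "kern n y x \<le> \<psi> (n div 2)" if "x \<in> V" "y \<in> V" for n x y
  proof (cases "even n")
    case True
    then have "n = n div 2 + n div 2" by (metis dvd_mult_div_cancel mult_2)
    then show ?thesis using even[OF that, of "n div 2"] by metis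
  next
    case False
    define k where "k = n div 2"
    have n: "n = Suc (k + k)" using False by (simp add: k_def) (metis False Suc_1 mult_2 odd_two_times_div_two_succ plus_1_eq_Suc add.commute)
    \<comment> \<open>An odd time is one averaging step after an even one, which does not raise the
      maximum.\<close>
    have "kern n y x = kern (k + k) y x / 2 + (\<Sum>s\<in>S. kern (k + k) y (x \<otimes> s)) / (2 * deg)"
      unfolding n using that by (simp add: kern_Suc lazy_eq)
    also have "\<dots> \<le> \<psi> k / 2 + (\<Sum>s\<in>S. \<psi> k) / (2 * deg)"
      using that deg_pos by (intro add_mono divide_right_mono sum_mono even) (auto intro: less_imp_le)
    also have "\<dots> = \<psi> k" using deg_pos by (simp add: deg_def[symmetric] field_simps)
    finally show ?thesis by (simp add: k_def)
  qed
  show thesis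
  proof (rule that[of "K * 2 powr (real N / 2)"])
    fix n x y assume xy: "x \<in> V" "y \<in> V"
    have "kern n y x \<le> K * real (Suc (n div 2)) powr (- (real N / 2))"
      using order_trans[OF bd[OF xy] K(2)] by simp
    also have "real (Suc (n div 2)) powr (- (real N / 2)) \<le> (real (Suc n) / 2) powr (- (real N / 2))"
      by (rule powr_mono2') (use N3 in auto)
    also have "(real (Suc n) / 2) powr (- (real N / 2)) = 2 powr (real N / 2) * real (Suc n) powr (- (real N / 2))"
      by (simp add: powr_divide powr_minus field_simps)
    finally show "kern n y x \<le> K * 2 powr (real N / 2) * real (Suc n) powr (- (real N / 2))"
      using K(1) by (simp add: mult_ac)
  qed (use K in simp)
qed

end

subsection \<open>The Green function\<close>

lemma nonneg_infsum_nat: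
  fixes f :: "nat \<Rightarrow> real"
  assumes "\<And>n. 0 \<le> f n" "summable f"
  shows "f summable_on UNIV" "infsum f UNIV = suminf f"
proof -
  show "f summable_on UNIV" using assms by (simp add: summable_on_UNIV_nonneg_real_iff)
  then show "infsum f UNIV = suminf f"
    using has_sum_imp_sums[OF has_sum_infsum] sums_unique by metis
qed

text \<open>Integrates one term of the Poisson series of the heat kernel against the weight of the
  Green function; it is Euler's integral after the substitution \<open>s = l * t\<close>.\<close>

lemma Gamma_integral_scaled:
  fixes b :: real
  assumes "b > 0" "l > 0"
  shows "has_bochner_integral lborel (\<lambda>t. indicator {0<..} t * (exp (- (l * t)) * (l * t) ^ n * t powr (b - 1)))
     (l powr (- b) * Gamma (real n + b))"
proof -
  define g where "g s = indicator {0..} s * s powr (real n + b - 1) / exp s" for s :: real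
  have [measurable]: "g \<in> borel_measurable borel" unfolding g_def[abs_def] by measurable
  have pos: "real n + b > 0" using assms by simp
  have "(\<integral>\<^sup>+s. ennreal (g s) \<partial>lborel) = ennreal (Gamma (real n + b))"
    using Gamma_conv_nn_integral_real[OF pos] by (simp add: g_def)
  then have "integrable lborel g \<and> integral\<^sup>L lborel g = Gamma (real n + b)"
    by (subst (asm) nn_integral_eq_integrable) (use pos in \<open>auto simp: g_def Gamma_real_pos less_imp_le\<close>)
  then have "has_bochner_integral lborel g (Gamma (real n + b))" by (simp add: has_bochner_integral_iff)
  then have "has_bochner_integral lborel (\<lambda>t. g (0 + l * t)) (Gamma (real n + b) /\<^sub>R \<bar>l\<bar>)"
    using assms by (subst (asm) lborel_has_bochner_integral_real_affine_iff[of l _ _ 0]) auto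
  then have "has_bochner_integral lborel (\<lambda>t. l powr (1 - b) * g (0 + l * t)) (l powr (1 - b) * (Gamma (real n + b) /\<^sub>R \<bar>l\<bar>))"
    by (rule has_bochner_integral_mult_right)
  moreover have "l powr (1 - b) * g (0 + l * t) = indicator {0<..} t * (exp (- (l * t)) * (l * t) ^ n * t powr (b - 1))" for t
  proof (cases "t > 0")
    case True
    have "(l * t) powr (real n + b - 1) = (l * t) ^ n * (l powr (b - 1) * t powr (b - 1))"
      using True assms by (simp only: add_diff_eq[symmetric] powr_add) (simp add: powr_realpow powr_mult power_mult_distrib)
    moreover have "l powr (1 - b) * l powr (b - 1) = 1" using assms by (simp flip: powr_add)
    ultimately show ?thesis using True assms
      by (simp add: g_def exp_minus divide_inverse)
  next
    \<comment> \<open>Euler's integral runs over the closed half-line, the Green function over the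
      open one. They agree at 0, where \<open>powr\<close> is 0.\<close>
    case False
    then have "g (0 + l * t) = 0" using assms by (cases "t = 0") (auto simp: g_def zero_le_mult_iff)
    then show ?thesis using False by simp
  qed
  moreover have "l powr (1 - b) * (Gamma (real n + b) /\<^sub>R \<bar>l\<bar>) = l powr (- b) * Gamma (real n + b)"
    using assms by (simp add: powr_diff powr_minus field_simps)
  ultimately show ?thesis by (simp only:)
qed

text \<open>The coefficients of the binomial series of \<open>(1 - z)^(-b)\<close>. The bound is
  Euler's limit for the Gamma function. Its term with index \<open>k\<close> contains
  \<open>pochhammer b (k + 1)\<close> and \<open>ln k\<close>, which explains the shift by one and
  the separate cases \<open>n = 0\<close> and \<open>n = 1\<close>.\<close>

lemma pochhammer_fact_bound:
  fixes b :: real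
  assumes "b > 0"
  obtains B where "B > 0" "\<And>n. pochhammer b n / fact n \<le> B * real (Suc n) powr (b - 1)"
proof -
  have lim: "(\<lambda>n. inverse (Gamma_series b n)) \<longlonglongrightarrow> inverse (Gamma b)"
    by (intro tendsto_inverse Gamma_series_LIMSEQ) (use Gamma_real_pos[OF assms] in simp)
  then have "Bseq (\<lambda>n. inverse (Gamma_series b n))" by (rule convergentI[THEN convergent_imp_Bseq])
  then obtain K where K: "K > 0" "\<And>n. norm (inverse (Gamma_series b n)) \<le> K" by (auto elim: BseqE)
  define B where "B = (1 + b + K) * 2 powr \<bar>b - 1\<bar>"
  have two: "1 \<le> 2 powr \<bar>b - 1\<bar>" by (simp add: ge_one_powr_ge_zero)
  have half: "real m powr (b - 1) \<le> 2 powr \<bar>b - 1\<bar> * real (Suc m) powr (b - 1)" if "m \<ge> 1" for m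
  proof (cases "b \<ge> 1")
    case True
    have "real m powr (b - 1) \<le> 1 * real (Suc m) powr (b - 1)" using True by (auto intro!: powr_mono2)
    also have "\<dots> \<le> 2 powr \<bar>b - 1\<bar> * real (Suc m) powr (b - 1)" by (intro mult_right_mono two) auto
    finally show ?thesis .
  next
    case False
    have "real m powr (b - 1) \<le> (real (Suc m) / 2) powr (b - 1)"
      using that False by (intro powr_mono2') auto
    also have "\<dots> = 2 powr \<bar>b - 1\<bar> * real (Suc m) powr (b - 1)"
      using False powr_minus_divide[of 2 "b - 1"] by (simp add: powr_divide)
    finally show ?thesis .
  qed
  have "pochhammer b n / fact n \<le> B * real (Suc n) powr (b - 1)" for n
  proof -
    consider "n = 0" | "n = 1" | k where "n = Suc k" "k \<ge> 1" by (cases n; cases "n - 1") auto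
    then show ?thesis
    proof cases
      case 1
      then show ?thesis using mult_mono[of 1 "1 + b + K" 1 "2 powr \<bar>b - 1\<bar>"] two assms K by (simp add: B_def)
    next
      case 2
      have "b * real 1 powr (b - 1) \<le> (1 + b + K) * (2 powr \<bar>b - 1\<bar> * real (Suc 1) powr (b - 1))"
        using half[of 1] assms K by (intro mult_mono) auto
      then show ?thesis using 2 by (simp add: B_def mult_ac)
    next
      case 3
      have e: "exp (b * ln (real k)) = real k powr b" using 3 by (simp add: powr_def)
      have "inverse (Gamma_series b k) \<le> K" using K(2)[of k] unfolding real_norm_def by linarith
      then have "pochhammer b n / (fact k * real k powr b) \<le> K"
        using 3 by (simp add: Gamma_series_def e)
      then have "pochhammer b n \<le> K * (fact k * real k powr b)"
        using 3 by (simp add: divide_le_eq)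
      then have "pochhammer b n / fact n \<le> K * (fact k * real k powr b) / fact n" by (simp add: divide_right_mono)
      also have "\<dots> = K * (real k powr b / real n)"
        unfolding 3(1) fact_Suc by simp
      also have "\<dots> \<le> K * (real n powr b / real n)"
        using K 3 assms by (intro mult_left_mono divide_right_mono powr_mono2) auto
      also have "\<dots> = K * real n powr (b - 1)" using 3 by (simp add: powr_diff)
      also have "\<dots> \<le> (1 + b + K) * (2 powr \<bar>b - 1\<bar> * real (Suc n) powr (b - 1))"
        using half[of n] assms K 3 by (intro mult_mono) auto
      finally show ?thesis by (simp add: B_def mult_ac)
    qed
  qed
  then show thesis using that[of B] assms K two by (simp add: B_def add_pos_pos)
qed

context cayley
begin

section \<open>Heat kernel and Green function as series in the walk\<close>

lemma laplacian_lazy: "laplacian G S u x = 2 * deg * (lazy u x - u x)"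
  by (simp add: lazy_def)

lemma laplacian_sum:
  "laplacian G S (\<lambda>x. \<Sum>i\<in>I. c i * f i x) x = (\<Sum>i\<in>I. c i * laplacian G S (f i) x)"
proof -
  have "(\<Sum>y\<in>nbrs G S x. (\<Sum>i\<in>I. c i * f i y) - (\<Sum>i\<in>I. c i * f i x)) = (\<Sum>y\<in>nbrs G S x. \<Sum>i\<in>I. c i * (f i y - f i x))"
    by (simp add: sum_subtractf[symmetric] algebra_simps)
  also have "\<dots> = (\<Sum>i\<in>I. \<Sum>y\<in>nbrs G S x. c i * (f i y - f i x))" by (rule sum.swap)
  finally show ?thesis by (simp add: laplacian_def sum_distrib_left)
qed

text \<open>The binomial theorem for \<open>2 * deg * (lazy - id)\<close>. Reciprocal factorials in
  place of binomial coefficients are the shape needed for the Cauchy product that follows.\<close>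

lemma laplacian_pow:
  "(laplacian G S ^^ n) u = (\<lambda>x. (2 * deg) ^ n * fact n *
      (\<Sum>i\<le>n. (- 1) ^ i / fact i / fact (n - i) * (lazy ^^ (n - i)) u x))"
proof (induction n)
  case 0 show ?case by simp
next
  case (Suc n)
  define c where "c m i = (- 1) ^ i / fact i / (fact (m - i) :: real)" for m i :: nat
  define a where "a k x = (lazy ^^ k) u x" for k x
  show ?case
  proof
    fix x
    have ak: "a k = (lazy ^^ k) u" for k by (rule ext) (simp add: a_def)
    have L: "laplacian G S (a k) x = 2 * deg * (a (Suc k) x - a k x)" for k
      by (simp add: ak laplacian_lazy)
    \<comment> \<open>Pascal's rule in this notation: the factor \<open>n + 1\<close> is split as
      \<open>(n + 1 - i) + i\<close>, and each part lowers one of the two factorials.\<close>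
    have 1: "(\<Sum>i\<le>Suc n. real (Suc n - i) * c (Suc n) i * a (Suc n - i) x) = (\<Sum>i\<le>n. c n i * a (Suc (n - i)) x)"
    proof -
      have "(\<Sum>i\<le>Suc n. real (Suc n - i) * c (Suc n) i * a (Suc n - i) x) =
          (\<Sum>i\<le>n. real (Suc n - i) * c (Suc n) i * a (Suc n - i) x)" by simp
      also have "\<dots> = (\<Sum>i\<le>n. c n i * a (Suc (n - i)) x)"
        by (rule sum.cong) (auto simp: c_def Suc_diff_le simp del: of_nat_Suc)
      finally show ?thesis .
    qed
    have 2: "(\<Sum>i\<le>Suc n. real i * c (Suc n) i * a (Suc n - i) x) = - (\<Sum>i\<le>n. c n i * a (n - i) x)"
      unfolding sum.atMost_Suc_shift by (simp add: c_def sum_negf[symmetric] field_simps del: of_nat_Suc)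
    have "real (Suc n) * (\<Sum>i\<le>Suc n. c (Suc n) i * a (Suc n - i) x) =
       (\<Sum>i\<le>Suc n. real (Suc n - i) * c (Suc n) i * a (Suc n - i) x + real i * c (Suc n) i * a (Suc n - i) x)"
      unfolding sum_distrib_left
      by (rule sum.cong) (auto simp: algebra_simps of_nat_diff)
    also have "\<dots> = (\<Sum>i\<le>n. c n i * (a (Suc (n - i)) x - a (n - i) x))"
      by (simp only: sum.distrib 1 2) (simp add: sum_subtractf algebra_simps)
    finally have rec: "(\<Sum>i\<le>n. c n i * (a (Suc (n - i)) x - a (n - i) x)) = real (Suc n) * (\<Sum>i\<le>Suc n. c (Suc n) i * a (Suc n - i) x)" by simp
    have "(laplacian G S ^^ Suc n) u x = laplacian G S (\<lambda>x. \<Sum>i\<le>n. (2 * deg) ^ n * fact n * c n i * a (n - i) x) x"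
      by (simp add: Suc.IH c_def a_def sum_distrib_left mult.assoc)
    also have "\<dots> = (\<Sum>i\<le>n. (2 * deg) ^ n * fact n * c n i * (2 * deg * (a (Suc (n - i)) x - a (n - i) x)))"
      unfolding laplacian_sum L ..
    also have "\<dots> = (2 * deg) ^ n * fact n * (2 * deg) * (\<Sum>i\<le>n. c n i * (a (Suc (n - i)) x - a (n - i) x))"
      unfolding sum_distrib_left by (rule sum.cong[OF refl]) (simp only: mult_ac)
    also have "\<dots> = (2 * deg) ^ Suc n * fact (Suc n) * (\<Sum>i\<le>Suc n. c (Suc n) i * a (Suc n - i) x)"
      unfolding rec by (simp add: mult_ac del: sum.atMost_Suc)
    finally show "(laplacian G S ^^ Suc n) u x = (2 * deg) ^ Suc n * fact (Suc n) *
      (\<Sum>i\<le>Suc n. (- 1) ^ i / fact i / fact (Suc n - i) * (lazy ^^ (Suc n - i)) u x)"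
      by (simp only: c_def a_def)
  qed
qed

text \<open>The exponential series of the semigroup is the Cauchy product of
  \<open>exp (- \<tau>)\<close> with a series whose terms are nonnegative for nonnegative times;
  only the latter form shows positivity and allows termwise integration.\<close>

lemma heat_kernel_poisson:
  assumes xy: "x \<in> V" "y \<in> V"
  shows "summable (\<lambda>k. (2 * deg * t) ^ k / fact k * kern k y x)"
    and "heat_kernel G S t x y = exp (- (2 * deg * t)) * (\<Sum>k. (2 * deg * t) ^ k / fact k * kern k y x)"
proof -
  define \<tau> where "\<tau> = 2 * deg * t"
  define A where "A i = (- \<tau>) ^ i / fact i" for i
  define B where "B k = \<tau> ^ k / fact k * kern k y x" for k
  have e: "summable (\<lambda>n. norm (s ^ n / fact n :: real))" for s :: real
    using summable_norm_exp[of s] by (simp add: divide_inverse mult.commute)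
  have sA: "summable (\<lambda>n. norm (A n))" unfolding A_def by (rule e)
  have sB: "summable (\<lambda>n. norm (B n))"
  proof (rule summable_comparison_test'[OF e[of \<tau>]])
    show "norm (norm (B n)) \<le> norm (\<tau> ^ n / fact n)" for n
      using mult_left_mono[OF kern_le_1[OF xy(2,1), of n], of "norm (\<tau> ^ n / fact n)"] kern_nonneg[OF xy(1), of n y]
      by (simp add: B_def abs_mult)
  qed
  show "summable (\<lambda>k. (2 * deg * t) ^ k / fact k * kern k y x)"
    using summable_norm_cancel[OF sB] by (simp add: B_def \<tau>_def)
  have "t ^ n / fact n * (laplacian G S ^^ n) (indicator {y}) x = (\<Sum>i\<le>n. A i * B (n - i))" for n
  proof -
    have "A i * B (n - i) = \<tau> ^ n * ((- 1) ^ i / fact i / fact (n - i) * kern (n - i) y x)" if "i \<le> n" for i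
    proof -
      have "\<tau> ^ n = \<tau> ^ i * \<tau> ^ (n - i)" using that by (simp flip: power_add)
      then show ?thesis by (simp add: A_def B_def power_minus[of \<tau>])
    qed
    then have "(\<Sum>i\<le>n. A i * B (n - i)) = \<tau> ^ n * (\<Sum>i\<le>n. (- 1) ^ i / fact i / fact (n - i) * kern (n - i) y x)"
      by (simp add: sum_distrib_left)
    then show ?thesis by (simp add: laplacian_pow kern_def \<tau>_def power_mult_distrib)
  qed
  then have "heat_kernel G S t x y = (\<Sum>n. \<Sum>i\<le>n. A i * B (n - i))"
    by (simp add: heat_kernel_def heat_semigroup_def)
  also have "\<dots> = suminf A * suminf B" by (rule Cauchy_product[OF sA sB, symmetric])
  also have "suminf A = exp (- \<tau>)" unfolding exp_def by (rule suminf_cong) (simp add: A_def divide_inverse)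
  finally show "heat_kernel G S t x y = exp (- (2 * deg * t)) * (\<Sum>k. (2 * deg * t) ^ k / fact k * kern k y x)"
    by (simp add: \<tau>_def B_def)
qed

text \<open>Coefficient of the \<open>n\<close>-th step of the walk in the binomial series of
  \<open>(2 * deg * (id - lazy))^(- \<beta>)\<close>; thus \<open>pot \<beta>\<close> is the kernel
  of \<open>(- \<Delta>)^(- \<beta>)\<close>.\<close>

definition bcoef :: "real \<Rightarrow> nat \<Rightarrow> real" where
  "bcoef \<beta> n = (2 * deg) powr (- \<beta>) * (pochhammer \<beta> n / fact n)"

lemma bcoef_pos: "\<beta> > 0 \<Longrightarrow> bcoef \<beta> n > 0"
  using deg_pos by (simp add: bcoef_def pochhammer_pos)

lemma bcoef_1: "bcoef 1 n = 1 / (2 * deg)"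
proof -
  have "pochhammer 1 n = (fact n :: real)" by (rule pochhammer_fact[symmetric])
  then have "bcoef 1 n = (2 * deg) powr (- 1)" by (simp add: bcoef_def)
  also have "\<dots> = 1 / (2 * deg)" using less_imp_le[OF deg_pos] by (simp add: powr_minus_divide)
  finally show ?thesis .
qed

lemma bcoef_bound:
  assumes "\<beta> > 0"
  obtains B where "B > 0" "\<And>n. bcoef \<beta> n \<le> B * real (Suc n) powr (\<beta> - 1)"
proof -
  obtain B where B: "B > 0" "\<And>n. pochhammer \<beta> n / fact n \<le> B * real (Suc n) powr (\<beta> - 1)"
    using pochhammer_fact_bound[OF assms] by blast
  show thesis
  proof (rule that[of "(2 * deg) powr (- \<beta>) * B"])
    show "bcoef \<beta> n \<le> (2 * deg) powr (- \<beta>) * B * real (Suc n) powr (\<beta> - 1)" for n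
      unfolding bcoef_def mult.assoc by (intro mult_left_mono B) auto
  qed (use B in simp)
qed

definition pot :: "real \<Rightarrow> 'a \<Rightarrow> 'a \<Rightarrow> real" where
  "pot \<beta> x y = (\<Sum>n. bcoef \<beta> n * kern n y x)"

lemma pot_summable:
  assumes "0 < \<beta>" "\<beta> < N / 2" "x \<in> V" "y \<in> V"
  shows "summable (\<lambda>n. bcoef \<beta> n * kern n y x)"
proof -
  obtain B where B: "B > 0" "\<And>n. bcoef \<beta> n \<le> B * real (Suc n) powr (\<beta> - 1)" using bcoef_bound[OF assms(1)] by blast
  obtain K where K: "K > 0" "\<And>n x y. x \<in> V \<Longrightarrow> y \<in> V \<Longrightarrow> kern n y x \<le> K * real (Suc n) powr (- (real N / 2))"
    using kern_decay by blast
  have "summable (\<lambda>n. real n powr (\<beta> - 1 - real N / 2))"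
    using assms by (subst summable_real_powr_iff) simp
  then have "summable (\<lambda>n. real (Suc n) powr (\<beta> - 1 - real N / 2))" by (subst summable_Suc_iff)
  then have "summable (\<lambda>n. B * K * real (Suc n) powr (\<beta> - 1 - real N / 2))" by (rule summable_mult)
  then show ?thesis
  proof (rule summable_comparison_test'[where N=0])
    fix n :: nat
    have "bcoef \<beta> n * kern n y x \<le> (B * real (Suc n) powr (\<beta> - 1)) * (K * real (Suc n) powr (- (real N / 2)))"
      using B K bcoef_pos[OF assms(1), of n] kern_nonneg[OF assms(3), of n y] assms
      by (intro mult_mono B(2) K(2)) auto
    also have "\<dots> = B * K * real (Suc n) powr (\<beta> - 1 - real N / 2)"
      by (simp add: powr_add[symmetric] algebra_simps)
    finally show "norm (bcoef \<beta> n * kern n y x) \<le> B * K * real (Suc n) powr (\<beta> - 1 - real N / 2)"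
      using bcoef_pos[OF assms(1), of n] kern_nonneg[OF assms(3), of n y] by simp
  qed
qed

lemma pot_nonneg:
  assumes "0 < \<beta>" "\<beta> < N / 2" "x \<in> V" "y \<in> V" shows "0 \<le> pot \<beta> x y"
  unfolding pot_def by (rule suminf_nonneg[OF pot_summable[OF assms]])
    (use bcoef_pos[OF assms(1)] kern_nonneg assms in \<open>simp add: less_imp_le\<close>)

lemma pot_symmetric: "x \<in> V \<Longrightarrow> y \<in> V \<Longrightarrow> pot \<beta> x y = pot \<beta> y x"
  by (simp add: pot_def kern_symmetric)

lemma pot_translate: "g \<in> V \<Longrightarrow> x \<in> V \<Longrightarrow> y \<in> V \<Longrightarrow> pot \<beta> (g \<otimes> x) (g \<otimes> y) = pot \<beta> x y"
  by (simp add: pot_def kern_translate)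

text \<open>One step of the walk already connects the two points. This keeps the energy from
  vanishing identically.\<close>

lemma pot_edge_pos:
  assumes "0 < \<beta>" "\<beta> < N / 2" "s \<in> S" "s \<noteq> \<one>"
  shows "0 < pot \<beta> \<one> s"
proof -
  have "kern 1 s \<one> = (\<Sum>s'\<in>S. indicator {s} s') / (2 * deg)"
    using assms by (simp add: kern_Suc kern_0 lazy_eq)
  also have "(\<Sum>s'\<in>S. indicator {s} s') = (\<Sum>s'\<in>{s}. indicator {s} s' :: real)"
    by (rule sum.mono_neutral_right) (use assms finS in auto)
  finally have k: "kern 1 s \<one> > 0" using deg_pos by simp
  show ?thesis unfolding pot_def
    by (rule suminf_pos2[OF pot_summable[OF assms(1,2)], of _ _ 1])
      (use k bcoef_pos[OF assms(1)] kern_nonneg assms in \<open>auto simp: less_imp_le\<close>)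
qed

text \<open>Termwise integration of the Poisson series, legitimate because all terms are nonnegative
  with convergent sum. The identity
  \<open>Gamma (n + \<beta>) = pochhammer \<beta> n * Gamma \<beta>\<close> yields the binomial
  coefficients and cancels the normalising factor.\<close>

lemma green_eq_pot:
  fixes \<alpha> :: real
  assumes \<alpha>: "0 < \<alpha>" "\<alpha> < N" and xy: "x \<in> V" "y \<in> V"
  shows "green G S \<alpha> x y = pot (\<alpha> / 2) x y"
proof -
  define \<beta> where "\<beta> = \<alpha> / 2"
  have \<beta>: "0 < \<beta>" "\<beta> < N / 2" using \<alpha> by (auto simp: \<beta>_def)
  define l where "l = 2 * deg"
  have l: "l > 0" by (simp add: l_def)
  define h where "h n t = indicator {0<..} t * (exp (- (l * t)) * (l * t) ^ n * t powr (\<beta> - 1))" for n :: nat and t :: real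
  define f where "f n t = kern n y x / fact n * h n t" for n t
  have h: "has_bochner_integral lborel (h n) (l powr (- \<beta>) * Gamma (real n + \<beta>))" for n
    unfolding h_def by (rule Gamma_integral_scaled[OF \<beta>(1) l])
  have G: "Gamma (real n + \<beta>) = pochhammer \<beta> n * Gamma \<beta>" for n
  proof -
    have "\<beta> \<notin> \<int>\<^sub>\<le>\<^sub>0" using \<beta>(1) by (auto elim: nonpos_Ints_cases)
    moreover have "Gamma \<beta> \<noteq> 0" using Gamma_real_pos[OF \<beta>(1)] by simp
    ultimately show ?thesis using pochhammer_Gamma[of \<beta> n] by (simp add: add.commute)
  qed
  have f: "has_bochner_integral lborel (f n) (Gamma \<beta> * (bcoef \<beta> n * kern n y x))" for n
  proof -
    have "has_bochner_integral lborel (f n) (kern n y x / fact n * (l powr (- \<beta>) * Gamma (real n + \<beta>)))"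
      unfolding f_def by (rule has_bochner_integral_mult_right) (use h in auto)
    then show ?thesis by (simp add: G bcoef_def l_def mult_ac)
  qed
  have f0: "0 \<le> f n t" for n t
    using kern_nonneg[OF xy(1), of n y] l by (auto simp: f_def h_def indicator_def intro!: mult_nonneg_nonneg)
  have f_series: "(\<lambda>n. f n t) = (\<lambda>n. indicator {0<..} t * exp (- (l * t)) * t powr (\<beta> - 1) * ((l * t) ^ n / fact n * kern n y x))" for t
    by (rule ext) (simp add: f_def h_def)
  have sf: "summable (\<lambda>n. f n t)" for t
    unfolding f_series by (rule summable_mult) (use heat_kernel_poisson(1)[OF xy, of t] in \<open>simp add: l_def\<close>)
  have hk: "(\<Sum>n. f n t) = indicator {0<..} t *\<^sub>R (heat_kernel G S t x y * t powr (- 1 + \<alpha> / 2))" for t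
  proof -
    have "(\<Sum>n. f n t) = indicator {0<..} t * exp (- (l * t)) * t powr (\<beta> - 1) * (\<Sum>n. (l * t) ^ n / fact n * kern n y x)"
      unfolding f_series by (rule suminf_mult) (use heat_kernel_poisson(1)[OF xy, of t] in \<open>simp add: l_def\<close>)
    then show ?thesis using heat_kernel_poisson(2)[OF xy, of t] by (simp add: l_def \<beta>_def)
  qed
  have i: "integrable lborel (f n)" "integral\<^sup>L lborel (f n) = Gamma \<beta> * (bcoef \<beta> n * kern n y x)" for n
    using f[of n] by (auto simp: has_bochner_integral_iff)
  have "(\<integral>t. (\<Sum>n. f n t) \<partial>lborel) = (\<Sum>n. integral\<^sup>L lborel (f n))"
  proof (rule integral_suminf)
    show "AE t in lborel. summable (\<lambda>n. norm (f n t))" using sf f0 by simp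
    show "summable (\<lambda>n. \<integral>t. norm (f n t) \<partial>lborel)"
      using summable_mult[OF pot_summable[OF \<beta> xy], of "Gamma \<beta>"] f0 i by simp
  qed (rule i)
  also have "\<dots> = Gamma \<beta> * pot \<beta> x y"
    unfolding i pot_def by (rule suminf_mult[OF pot_summable[OF \<beta> xy]])
  finally have "(LINT t:{0<..}|lborel. heat_kernel G S t x y * t powr (- 1 + \<alpha> / 2)) = Gamma \<beta> * pot \<beta> x y"
    unfolding set_lebesgue_integral_def hk .
  then show ?thesis using Gamma_real_pos[OF \<beta>(1)] by (simp add: green_def \<beta>_def[symmetric])
qed

lemma summable_power_bound: "r < -1 \<Longrightarrow> summable (\<lambda>n. real (Suc n) powr r)"
  using summable_real_powr_iff[of r] summable_Suc_iff[of "\<lambda>n. real n powr r"] by simp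

text \<open>Interpolating \<open>kern n\<close> between \<open>\<ell>\<^sup>1\<close> and \<open>\<ell>\<^sup>\<infinity>\<close> would give the critical exponent only in the weak
  sense; the strict inequality leaves room for the summable weights \<open>(n + 1) powr (- 1 - \<eta>)\<close>.\<close>

lemma pot_lp:
  fixes \<beta> c :: real
  assumes \<beta>: "0 < \<beta>" "\<beta> < N / 2" and c: "N < c * (N - 2 * \<beta>)" and x: "x \<in> V"
  shows "pot \<beta> x \<in> lp c V"
proof -
  obtain B where B: "B > 0" "\<And>n. bcoef \<beta> n \<le> B * real (Suc n) powr (\<beta> - 1)" using bcoef_bound[OF \<beta>(1)] by blast
  obtain K where K: "K > 0" "\<And>n x y. x \<in> V \<Longrightarrow> y \<in> V \<Longrightarrow> kern n y x \<le> K * real (Suc n) powr (- (real N / 2))"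
    using kern_decay by blast
  have c1: "c > 1"
  proof (rule ccontr)
    assume "\<not> c > 1"
    then have "c * (N - 2 * \<beta>) \<le> 1 * (N - 2 * \<beta>)" using \<beta> by (intro mult_right_mono) auto
    then have "N < 1 * (N - 2 * \<beta>)" using c by (rule less_le_trans[rotated])
    then show False using \<beta> by simp
  qed
  \<comment> \<open>The strict inequality leaves a surplus decay of \<open>2 * \<kappa>\<close>. One
    half pays for the weights \<open>w\<close>, since \<open>\<eta> * (c - 1) = \<kappa>\<close>;
    the other makes \<open>E\<close> summable.\<close>
  define \<kappa> where "\<kappa> = (c * (N - 2 * \<beta>) - N) / 4"
  have \<kappa>: "\<kappa> > 0" using c by (simp add: \<kappa>_def)
  define \<eta> where "\<eta> = \<kappa> / (c - 1)"
  have \<eta>: "\<eta> > 0" using \<kappa> c1 by (simp add: \<eta>_def)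
  define w where "w n = real (Suc n) powr (- 1 - \<eta>)" for n
  have w: "w n > 0" "summable w" for n using \<eta> summable_power_bound[of "- 1 - \<eta>"] by (auto simp: w_def[abs_def])
  define c' where "c' = c / (c - 1)"
  have c': "c' > 1" "1 / c' + 1 / c = 1" using c1 by (auto simp: c'_def field_simps)
  define E where "E n = B powr c * K powr (c - 1) * real (Suc n) powr (- 1 - \<kappa>)" for n
  have E: "summable E" unfolding E_def by (rule summable_mult, rule summable_power_bound) (use \<kappa> in simp)
  define z where "z y n = bcoef \<beta> n * kern n y x / w n" for y n
  have z0: "0 \<le> z y n" for y n
    using bcoef_pos[OF \<beta>(1), of n] kern_nonneg[OF x, of n y] w(1)[of n] by (simp add: z_def)
  \<comment> \<open>Of the \<open>c\<close> powers of \<open>kern\<close>, one is kept so that the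
    sum over \<open>y\<close> is at most 1, and \<open>c - 1\<close> are estimated by the uniform
    decay.\<close>
  have wz: "w n * z y n powr c \<le> E n * kern n y x" if y: "y \<in> V" for y n
  proof -
    have "w n * z y n powr c = w n powr (1 - c) * (bcoef \<beta> n powr c * (kern n y x powr (c - 1) * kern n y x))"
    proof -
      have "kern n y x powr c = kern n y x powr (c - 1) * kern n y x"
        using kern_nonneg[OF x, of n y] powr_add[of "kern n y x" "c - 1" 1] by simp
      then show ?thesis using w(1)[of n] by (simp add: z_def powr_divide powr_mult powr_diff)
    qed
    also have "\<dots> \<le> w n powr (1 - c) * ((B * real (Suc n) powr (\<beta> - 1)) powr c *
        ((K * real (Suc n) powr (- (real N / 2))) powr (c - 1) * kern n y x))"
      using c1 bcoef_pos[OF \<beta>(1), of n] kern_nonneg[OF x, of n y]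
      by (intro mult_left_mono mult_mono mult_right_mono powr_mono2 B(2) K(2) x y) auto
    also have "\<dots> = B powr c * K powr (c - 1) *
        (real (Suc n) powr ((- 1 - \<eta>) * (1 - c) + (\<beta> - 1) * c + - (real N / 2) * (c - 1))) * kern n y x"
      by (simp only: w_def powr_mult powr_powr powr_add) (simp only: mult_ac)
    also have "(- 1 - \<eta>) * (1 - c) + (\<beta> - 1) * c + - (real N / 2) * (c - 1) = - 1 - \<kappa>"
    proof -
      have "\<eta> * (c - 1) = \<kappa>" using c1 by (simp add: \<eta>_def)
      moreover have "(- 1 - \<eta>) * (1 - c) + (\<beta> - 1) * c + - (real N / 2) * (c - 1) =
         - 1 + \<eta> * (c - 1) - 2 * \<kappa>" by (simp add: \<kappa>_def field_simps)
      ultimately show ?thesis by linarith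
    qed
    finally show ?thesis by (simp add: E_def)
  qed
  define W where "W = suminf w"
  have W: "W > 0" unfolding W_def using w by (intro suminf_pos) auto
  have E0: "0 \<le> E n" for n by (simp add: E_def)
  have sE: "summable (\<lambda>n. E n * kern n y x)" if "y \<in> V" for y
    by (rule summable_comparison_test'[OF E, of 0])
      (use mult_left_mono[OF kern_le_1[OF that x] E0] kern_nonneg[OF x] E0 in auto)
  have pt: "\<bar>pot \<beta> x y\<bar> powr c \<le> W powr (c / c') * (\<Sum>n. E n * kern n y x)" if y: "y \<in> V" for y
  proof -
    define f where "f n = w n powr (1 / c')" for n
    define g where "g n = w n powr (1 / c) * z y n" for n
    have fc: "\<bar>f n\<bar> powr c' = w n" for n using c' w(1)[of n] by (simp add: f_def powr_powr)
    have gc: "\<bar>g n\<bar> powr c = w n * z y n powr c" for n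
      using c1 w(1)[of n] z0[of y n] by (simp add: g_def abs_mult powr_mult powr_powr)
    have sg: "summable (\<lambda>n. w n * z y n powr c)"
      by (rule summable_comparison_test'[OF sE[OF y], of 0]) (use wz[OF y] w z0 in \<open>auto simp: less_imp_le\<close>)
    have fl: "f \<in> lp c' UNIV" "psum c' UNIV f = W"
      unfolding lp_def psum_def mem_Collect_eq fc W_def
      using nonneg_infsum_nat[of w] w by (auto simp: less_imp_le)
    have gl: "g \<in> lp c UNIV" "psum c UNIV g = (\<Sum>n. w n * z y n powr c)"
      unfolding lp_def psum_def mem_Collect_eq gc
      using nonneg_infsum_nat[OF _ sg] w by (auto simp: less_imp_le)
    have fg: "\<bar>f n * g n\<bar> = bcoef \<beta> n * kern n y x" for n
    proof -
      have "f n * g n = w n powr (1 / c' + 1 / c) * z y n" by (simp add: f_def g_def powr_add)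
      then show ?thesis using c'(2) w(1)[of n] z0[of y n] bcoef_pos[OF \<beta>(1), of n] kern_nonneg[OF x, of n y]
        by (simp add: z_def)
    qed
    have "pot \<beta> x y = (\<Sum>\<^sub>\<infinity>n. \<bar>f n * g n\<bar>)"
      unfolding fg pot_def
      by (rule nonneg_infsum_nat(2)[symmetric]) (use pot_summable[OF \<beta> x y] bcoef_pos[OF \<beta>(1)] kern_nonneg[OF x] in \<open>auto simp: less_imp_le\<close>)
    also have "\<dots> \<le> psum c' UNIV f powr (1 / c') * psum c UNIV g powr (1 / c)"
      by (rule lp_hoelder(2)[OF fl(1) gl(1) c'(1) c1 c'(2)])
    finally have le: "pot \<beta> x y \<le> W powr (1 / c') * (\<Sum>n. w n * z y n powr c) powr (1 / c)"
      by (simp add: fl gl)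
    have "\<bar>pot \<beta> x y\<bar> powr c \<le> (W powr (1 / c') * (\<Sum>n. w n * z y n powr c) powr (1 / c)) powr c"
      using le pot_nonneg[OF \<beta> x y] c1 by (intro powr_mono2) auto
    also have "\<dots> = W powr (c / c') * (\<Sum>n. w n * z y n powr c)"
      using c1 suminf_nonneg[OF sg] w by (simp add: powr_mult powr_powr less_imp_le)
    also have "\<dots> \<le> W powr (c / c') * (\<Sum>n. E n * kern n y x)"
      by (intro mult_left_mono suminf_le sg sE y wz) auto
    finally show ?thesis .
  qed
  show ?thesis
  proof (rule lp_boundedI(1))
    fix F assume F: "finite F" "F \<subseteq> V"
    have "(\<Sum>y\<in>F. \<bar>pot \<beta> x y\<bar> powr c) \<le> (\<Sum>y\<in>F. W powr (c / c') * (\<Sum>n. E n * kern n y x))"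
      by (rule sum_mono) (use pt F in auto)
    also have "\<dots> = W powr (c / c') * (\<Sum>n. \<Sum>y\<in>F. E n * kern n y x)"
      by (subst suminf_sum) (use sE F in \<open>auto simp: sum_distrib_left\<close>)
    also have "(\<Sum>n. \<Sum>y\<in>F. E n * kern n y x) \<le> suminf E"
    proof (rule suminf_le)
      fix n
      have "(\<Sum>y\<in>F. kern n x y) \<le> infsum (kern n x) V"
        by (rule finite_sum_le_infsum[OF kern_summable F]) (use kern_nonneg in auto)
      then have "(\<Sum>y\<in>F. kern n y x) \<le> 1"
        using kern_sum[OF x, of n] F kern_symmetric[OF x] by (simp add: subset_iff)
      then show "(\<Sum>y\<in>F. E n * kern n y x) \<le> E n"
        unfolding sum_distrib_left[symmetric] using mult_left_mono[of "\<Sum>y\<in>F. kern n y x" 1 "E n"] E0 by simp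
    qed (use sE E F in \<open>auto intro!: summable_sum\<close>)
    finally show "(\<Sum>y\<in>F. \<bar>pot \<beta> x y\<bar> powr c) \<le> W powr (c / c') * suminf E"
      by (simp add: mult_left_mono)
  qed
qed

text \<open>For exponent 1 the coefficients are constant and the series telescopes. The boundary
  term at infinity vanishes because the walk is transient, \<open>1 < N / 2\<close>.\<close>

lemma laplacian_pot_1:
  assumes "x \<in> V" "y \<in> V"
  shows "laplacian G S (\<lambda>x. pot 1 x y) x = - indicator {y} x"
proof -
  have N: "(0::real) < 1" "1 < real N / 2" using N3 by auto
  note sm = pot_summable[OF N _ assms(2)]
  have t: "(\<lambda>n. kern n y x) \<longlonglongrightarrow> 0"
    using summable_LIMSEQ_zero[OF sm[OF assms(1)]] deg_pos tendsto_mult_left[of "\<lambda>n. bcoef 1 n * kern n y x" 0 sequentially "2 * deg"]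
    by (simp add: bcoef_1)
  have "laplacian G S (\<lambda>x. pot 1 x y) x = (\<Sum>s\<in>S. (\<Sum>n. bcoef 1 n * kern n y (x \<otimes> s)) - (\<Sum>n. bcoef 1 n * kern n y x))"
    using assms by (simp add: laplacian_eq pot_def)
  also have "\<dots> = (\<Sum>s\<in>S. \<Sum>n. bcoef 1 n * kern n y (x \<otimes> s) - bcoef 1 n * kern n y x)"
    by (intro sum.cong refl suminf_diff sm) (use assms in auto)
  also have "\<dots> = (\<Sum>n. \<Sum>s\<in>S. bcoef 1 n * kern n y (x \<otimes> s) - bcoef 1 n * kern n y x)"
    by (rule suminf_sum[symmetric]) (use assms in \<open>auto intro!: summable_diff sm\<close>)
  also have "\<dots> = (\<Sum>n. kern (Suc n) y x - kern n y x)"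
  proof (rule suminf_cong)
    fix n
    have "(\<Sum>s\<in>S. bcoef 1 n * kern n y (x \<otimes> s) - bcoef 1 n * kern n y x) = laplacian G S (kern n y) x / (2 * deg)"
      using assms by (simp add: laplacian_eq bcoef_1 sum_divide_distrib diff_divide_distrib)
    then show "(\<Sum>s\<in>S. bcoef 1 n * kern n y (x \<otimes> s) - bcoef 1 n * kern n y x) = kern (Suc n) y x - kern n y x"
      by (simp add: kern_Suc lazy_def)
  qed
  also have "\<dots> = 0 - kern 0 y x" by (rule sums_unique[symmetric], rule telescope_sums[OF t])
  finally show ?thesis by (simp add: kern_0)
qed

lemma lp_translate:
  assumes "g \<in> V"
  shows "(\<lambda>x. u (g \<otimes> x)) \<in> lp q V \<longleftrightarrow> u \<in> lp q V" "psum q V (\<lambda>x. u (g \<otimes> x)) = psum q V u"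
  using summable_on_reindex_bij_betw[OF bij_left[OF assms], of "\<lambda>x. \<bar>u x\<bar> powr q"]
    infsum_reindex_bij_betw[OF bij_left[OF assms], of "\<lambda>x. \<bar>u x\<bar> powr q"]
  by (auto simp: lp_def psum_def)

end

subsection \<open>The Choquard energy\<close>

lemma infsum_diff_real:
  fixes f g :: "'i \<Rightarrow> real"
  assumes "f summable_on A" "g summable_on A"
  shows "(\<lambda>x. f x - g x) summable_on A" "infsum (\<lambda>x. f x - g x) A = infsum f A - infsum g A"
  using summable_on_add[of f A "\<lambda>x. - g x"] infsum_add[of f A "\<lambda>x. - g x"] assms
  by (simp_all add: summable_on_uminus infsum_uminus)

text \<open>By \<open>powr_abs_diff_le\<close> the pointwise defect is at most \<open>e\<close>
  times the remainder, which has bounded power sums, plus a multiple of the fixed summable function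
  \<open>\<bar>h x\<bar> powr q\<close>; this is the situation of
  \<open>infsum_tendsto_zero\<close>.\<close>

lemma brezis_lieb:
  fixes g :: "nat \<Rightarrow> 'i \<Rightarrow> real"
  assumes q: "q \<ge> 1" and gn: "\<And>n. g n \<in> lp q A" "\<And>n. psum q A (g n) \<le> M"
    and lim: "\<And>x. x \<in> A \<Longrightarrow> (\<lambda>n. g n x) \<longlonglongrightarrow> h x"
    and L: "(\<lambda>n. psum q A (g n)) \<longlonglongrightarrow> L"
  shows "(\<lambda>n. psum q A (\<lambda>x. g n x - h x)) \<longlonglongrightarrow> L - psum q A h"
proof -
  have h: "h \<in> lp q A" "psum q A h \<le> M" by (rule lp_fatou[OF gn lim], assumption, use q in simp)+
  define d where "d n x = g n x - h x" for n x
  have d: "d n \<in> lp q A" "psum q A (d n) \<le> 2 powr q * (M + M)" for n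
  proof -
    have mh: "(\<lambda>x. - 1 * h x) \<in> lp q A" "psum q A (\<lambda>x. - 1 * h x) = psum q A h"
      using lp_cmult[where f=h and q=q and A=A and c="- 1"] h by auto
    note a = lp_add(1,2)[OF gn(1)[of n] mh(1) q]
    show "d n \<in> lp q A" using a(1) by (simp add: d_def[abs_def])
    have "psum q A (d n) \<le> 2 powr q * (psum q A (g n) + psum q A h)"
      using a(2) mh(2) by (simp add: d_def[abs_def])
    also have "\<dots> \<le> 2 powr q * (M + M)" by (intro mult_left_mono add_mono gn h) auto
    finally show "psum q A (d n) \<le> 2 powr q * (M + M)" .
  qed
  have s: "(\<lambda>x. \<bar>g n x\<bar> powr q) summable_on A" "(\<lambda>x. \<bar>d n x\<bar> powr q) summable_on A"
    "(\<lambda>x. \<bar>h x\<bar> powr q) summable_on A" for n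
    using gn d h by (auto simp: lp_def)
  define f where "f n x = \<bar>\<bar>g n x\<bar> powr q - (\<bar>d n x\<bar> powr q + \<bar>h x\<bar> powr q)\<bar>" for n x
  have fs: "f n summable_on A" for n
    by (rule summable_on_abs_le[of "\<lambda>x. \<bar>g n x\<bar> powr q + (\<bar>d n x\<bar> powr q + \<bar>h x\<bar> powr q)"])
      (use s in \<open>auto simp: f_def abs_le_iff intro!: summable_on_add add_nonneg_nonneg\<close>)
  have f0: "(\<lambda>n. infsum (f n) A) \<longlonglongrightarrow> 0"
  proof (rule infsum_tendsto_zero[where g="\<lambda>n x. \<bar>d n x\<bar> powr q" and M="2 powr q * (M + M)"])
    show "(\<lambda>n. f n x) \<longlonglongrightarrow> 0" if "x \<in> A" for x
    proof -
      have "(\<lambda>n. \<bar>\<bar>g n x\<bar> powr q - (\<bar>g n x - h x\<bar> powr q + \<bar>h x\<bar> powr q)\<bar>) \<longlonglongrightarrow> \<bar>\<bar>h x\<bar> powr q - (\<bar>h x - h x\<bar> powr q + \<bar>h x\<bar> powr q)\<bar>"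
        by (intro tendsto_intros tendsto_powr' lim that) (use q in auto)
      then show ?thesis using q by (simp add: f_def d_def)
    qed
    fix e :: real assume "e > 0"
    obtain C where C: "C \<ge> 0" "\<And>a b. \<bar>\<bar>a + b\<bar> powr q - \<bar>a\<bar> powr q\<bar> \<le> e * \<bar>a\<bar> powr q + C * \<bar>b\<bar> powr q"
      using powr_abs_diff_le[OF q \<open>e > 0\<close>] by blast
    have "f n x \<le> e * \<bar>d n x\<bar> powr q + (C + 1) * \<bar>h x\<bar> powr q" for n x
      using C(2)[of "d n x" "h x"] powr_ge_zero[of "\<bar>h x\<bar>" q]
      by (simp add: f_def d_def algebra_simps abs_le_iff del: powr_ge_zero)
    then show "\<exists>k. k summable_on A \<and> (\<forall>n. \<forall>x\<in>A. f n x \<le> e * \<bar>d n x\<bar> powr q + k x)"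
      by (intro exI[of _ "\<lambda>x. (C + 1) * \<bar>h x\<bar> powr q"]) (use s in \<open>auto intro!: summable_on_cmult_right\<close>)
  qed (use fs s d in \<open>auto simp: f_def psum_def[symmetric]\<close>)
  have "(\<lambda>n. psum q A (g n) - psum q A (d n) - psum q A h) \<longlonglongrightarrow> 0"
  proof (rule Lim_null_comparison[OF _ f0], rule always_eventually, rule allI)
    fix n
    have "psum q A (g n) - psum q A (d n) - psum q A h = (\<Sum>\<^sub>\<infinity>x\<in>A. \<bar>g n x\<bar> powr q - (\<bar>d n x\<bar> powr q + \<bar>h x\<bar> powr q))"
      unfolding psum_def by (subst infsum_diff_real) (use s in \<open>auto simp: infsum_add intro!: summable_on_add\<close>)
    also have "norm \<dots> \<le> infsum (f n) A"
      unfolding real_norm_def by (rule infsum_abs_le[OF fs]) (simp add: f_def)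
    finally show "norm (psum q A (g n) - psum q A (d n) - psum q A h) \<le> infsum (f n) A" .
  qed
  from tendsto_diff[OF tendsto_diff[OF L this] tendsto_const[of "psum q A h"]]
  show ?thesis by (simp add: d_def[abs_def])
qed

lemma pair_sum:
  fixes F :: "'i \<Rightarrow> 'j \<Rightarrow> real"
  assumes "\<And>x y. x \<in> A \<Longrightarrow> y \<in> B \<Longrightarrow> 0 \<le> F x y" "\<And>x. x \<in> A \<Longrightarrow> (F x has_sum H x) B" "H summable_on A"
  shows "(\<lambda>(x, y). F x y) summable_on A \<times> B" "infsum (\<lambda>(x, y). F x y) (A \<times> B) = infsum H A"
proof -
  show s: "(\<lambda>(x, y). F x y) summable_on A \<times> B"
    by (rule summable_on_SigmaI[where g=H]) (use assms in auto)
  have "infsum (\<lambda>(x, y). F x y) (A \<times> B) = (\<Sum>\<^sub>\<infinity>x\<in>A. \<Sum>\<^sub>\<infinity>y\<in>B. F x y)"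
    using infsum_Sigma_banach[OF s] by simp
  also have "\<dots> = infsum H A" by (rule infsum_cong) (use assms(2) infsumI in blast)
  finally show "infsum (\<lambda>(x, y). F x y) (A \<times> B) = infsum H A" .
qed

lemma pair_swap:
  fixes F :: "'i \<Rightarrow> 'i \<Rightarrow> real"
  shows "(\<lambda>(x, y). F y x) summable_on A \<times> A \<longleftrightarrow> (\<lambda>(x, y). F x y) summable_on A \<times> A"
    "infsum (\<lambda>(x, y). F y x) (A \<times> A) = infsum (\<lambda>(x, y). F x y) (A \<times> A)"
proof -
  have b: "bij_betw (\<lambda>(x, y). (y, x)) (A \<times> A) (A \<times> A)"
    by (rule bij_betwI[of _ _ _ "\<lambda>(x, y). (y, x)"]) auto
  show "(\<lambda>(x, y). F y x) summable_on A \<times> A \<longleftrightarrow> (\<lambda>(x, y). F x y) summable_on A \<times> A"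
    "infsum (\<lambda>(x, y). F y x) (A \<times> A) = infsum (\<lambda>(x, y). F x y) (A \<times> A)"
    using summable_on_reindex_bij_betw[OF b, of "\<lambda>(x, y). F x y"] infsum_reindex_bij_betw[OF b, of "\<lambda>(x, y). F x y"]
    by (simp_all add: case_prod_unfold)
qed

text \<open>Young's convolution inequality at the level of single terms: with \<open>c = 1 / (2 * \<theta>)\<close> and
  \<open>\<rho> = 1 / (1 - \<theta>)\<close> one has
  \<open>k * f * g = (f^\<rho> * k^c)^\<theta> * (g^\<rho> * k^c)^\<theta> * (f^\<rho> * g^\<rho>)^(1 - 2 * \<theta>)\<close>, and the first factor can be
  given an arbitrarily large weight in the arithmetic-geometric mean inequality.\<close>

lemma young_term:
  fixes f g k \<theta> \<mu> :: real
  assumes "0 \<le> f" "0 \<le> g" "0 \<le> k" "0 < \<theta>" "\<theta> \<le> 1/2" "0 < \<mu>"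
  defines "c \<equiv> 1 / (2 * \<theta>)" and "\<rho> \<equiv> 1 / (1 - \<theta>)"
  shows "k * (f * g) \<le> \<mu> powr (- (1 - \<theta>) / \<theta>) * (f powr \<rho> * k powr c) + \<mu> * (g powr \<rho> * k powr c + f powr \<rho> * g powr \<rho>)"
proof -
  define X where "X = f powr \<rho> * k powr c"
  define Y where "Y = g powr \<rho> * k powr c"
  define Z where "Z = f powr \<rho> * g powr \<rho>"
  \<comment> \<open>The factors \<open>Y\<close> and \<open>Z\<close> are merged first, so that the
    free parameter acts on \<open>X\<close> alone. That \<open>a\<close> is at most 1 is the
    condition \<open>\<theta> \<le> 1/2\<close>, that is \<open>r \<le> 2 * p\<close>.\<close>
  define a where "a = \<theta> / (1 - \<theta>)"
  have a: "0 \<le> a" "a \<le> 1" using assms by (auto simp: a_def)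
  have XYZ: "X \<ge> 0" "Y \<ge> 0" "Z \<ge> 0" by (auto simp: X_def Y_def Z_def)
  define W where "W = Z powr (1 - a) * Y powr a"
  have W: "W \<le> Y + Z" "W \<ge> 0"
  proof -
    have "W \<le> (1 - a) * Z + a * Y" unfolding W_def by (rule weighted_am_gm2) (use XYZ a in auto)
    also have "\<dots> \<le> Z + Y" using mult_right_mono[of "1 - a" 1 Z] mult_right_mono[of a 1 Y] a XYZ by simp
    finally show "W \<le> Y + Z" by simp
  qed (simp add: W_def)
  have e: "\<rho> * \<theta> + \<rho> * (1 - 2 * \<theta>) = 1" "c * \<theta> + c * \<theta> = 1" 
  proof -
    have "\<rho> * (1 - \<theta>) = 1" using assms by (simp add: \<rho>_def)
    then show "\<rho> * \<theta> + \<rho> * (1 - 2 * \<theta>) = 1" by (simp add: algebra_simps)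
    show "c * \<theta> + c * \<theta> = 1" using assms by (simp add: c_def field_simps)
  qed
  have "(1 - \<theta>) * (1 - a) = 1 - 2 * \<theta>" "(1 - \<theta>) * a = \<theta>" using assms by (auto simp: a_def field_simps)
  then have "X powr \<theta> * W powr (1 - \<theta>) = X powr \<theta> * (Z powr (1 - 2 * \<theta>) * Y powr \<theta>)"
    by (simp add: W_def powr_mult powr_powr mult.commute)
  also have "\<dots> = (f powr (\<rho> * \<theta>) * f powr (\<rho> * (1 - 2 * \<theta>))) * (g powr (\<rho> * \<theta>) * g powr (\<rho> * (1 - 2 * \<theta>))) * (k powr (c * \<theta>) * k powr (c * \<theta>))"
    by (simp add: X_def Y_def Z_def powr_mult powr_powr mult_ac)
  also have "\<dots> = f * g * k" unfolding powr_add[symmetric] e using assms by simp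
  finally have kfg: "k * (f * g) = X powr \<theta> * W powr (1 - \<theta>)" by simp
  \<comment> \<open>Determined by
    \<open>l powr \<theta> * \<mu> powr (1 - \<theta>) = 1\<close>.\<close>
  define l where "l = \<mu> powr (- (1 - \<theta>) / \<theta>)"
  have l: "l > 0" "l powr \<theta> * \<mu> powr (1 - \<theta>) = 1"
    using assms by (auto simp: l_def powr_powr simp flip: powr_add)
  have "X powr \<theta> * W powr (1 - \<theta>) = (\<mu> * W) powr (1 - \<theta>) * (l * X) powr \<theta>"
    using l(2) XYZ W assms by (simp add: powr_mult) (metis mult.assoc mult.commute mult_1)
  also have "\<dots> \<le> (1 - \<theta>) * (\<mu> * W) + \<theta> * (l * X)"
    by (rule weighted_am_gm2) (use W XYZ assms l in auto)
  also have "\<dots> \<le> 1 * (\<mu> * W) + 1 * (l * X)"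
    using assms W XYZ l by (intro add_mono mult_right_mono) auto
  also have "\<dots> \<le> l * X + \<mu> * (Y + Z)" using W(1) assms by simp
  finally show ?thesis unfolding kfg by (simp add: l_def X_def Y_def Z_def)
qed

text \<open>All that is used of the Green function. The exponent in \<open>k_lp\<close> is the one
  Young's convolution inequality demands when \<open>\<bar>u\<bar> powr p\<close> has summable
  powers of exponent \<open>r / p\<close>; \<open>k_diag\<close> expresses that the nonlocal term
  omits the diagonal.\<close>

locale choquard_kernel = cayley +
  fixes k :: "'a \<Rightarrow> 'a \<Rightarrow> real" and p r :: real
  assumes p1: "1 \<le> p" and pr: "p < r" "r \<le> 2 * p"
    and k_nonneg: "\<And>x y. x \<in> V \<Longrightarrow> y \<in> V \<Longrightarrow> 0 \<le> k x y"
    and k_sym: "\<And>x y. x \<in> V \<Longrightarrow> y \<in> V \<Longrightarrow> k x y = k y x"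
    and k_inv: "\<And>g x y. g \<in> V \<Longrightarrow> x \<in> V \<Longrightarrow> y \<in> V \<Longrightarrow> k (g \<otimes> x) (g \<otimes> y) = k x y"
    and k_diag: "\<And>x. k x x = 0"
    and k_pos: "\<exists>x\<in>V. \<exists>y\<in>V. 0 < k x y"
    and k_lp: "k \<one> \<in> lp (1 / (2 * (1 - p / r))) V"
begin

section \<open>Bounds and splitting of the energy\<close>

definition \<theta> :: real where "\<theta> = 1 - p / r"
definition c :: real where "c = 1 / (2 * \<theta>)"
definition \<rho> :: real where "\<rho> = 1 / (1 - \<theta>)"

lemma exps: "0 < \<theta>" "\<theta> \<le> 1/2" "p * \<rho> = r" "0 < c" "0 < r" "0 < p" "0 < \<rho>"
  using p1 pr by (auto simp: \<theta>_def \<rho>_def c_def field_simps)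

lemma k_has_sum:
  assumes "x \<in> V" shows "((\<lambda>y. k x y powr c) has_sum psum c V (k \<one>)) V"
proof -
  have "((\<lambda>y. \<bar>k \<one> y\<bar> powr c) has_sum psum c V (k \<one>)) V"
    unfolding psum_def using k_lp by (intro has_sum_infsum) (simp add: lp_def c_def \<theta>_def)
  then have "((\<lambda>y. \<bar>k \<one> (inv x \<otimes> y)\<bar> powr c) has_sum psum c V (k \<one>)) V"
    using has_sum_reindex_bij_betw[OF bij_left[of "inv x"], of "\<lambda>y. \<bar>k \<one> y\<bar> powr c"] assms by simp
  moreover have "\<bar>k \<one> (inv x \<otimes> y)\<bar> powr c = k x y powr c" if "y \<in> V" for y
    using k_inv[of x \<one> "inv x \<otimes> y"] k_nonneg[of x y] assms that by (simp add: m_assoc[symmetric])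
  ultimately show ?thesis by (simp cong: has_sum_cong)
qed

definition \<kappa> :: real where "\<kappa> = psum c V (k \<one>)"

lemma \<kappa>_nonneg: "\<kappa> \<ge> 0" by (simp add: \<kappa>_def)

definition pw :: "('a \<Rightarrow> real) \<Rightarrow> 'a \<Rightarrow> real" where "pw u x = \<bar>u x\<bar> powr p"

lemma pw_nonneg [simp]: "0 \<le> pw u x" by (simp add: pw_def)

lemma pw_rho: "pw u x powr \<rho> = \<bar>u x\<bar> powr r" by (simp add: pw_def powr_powr exps)

lemma Y_sum:
  assumes "u \<in> lp r V"
  shows "(\<lambda>(x, y). pw u x powr \<rho> * k x y powr c) summable_on V \<times> V"
    "infsum (\<lambda>(x, y). pw u x powr \<rho> * k x y powr c) (V \<times> V) = psum r V u * \<kappa>"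
    "(\<lambda>(x, y). pw u y powr \<rho> * k x y powr c) summable_on V \<times> V"
    "infsum (\<lambda>(x, y). pw u y powr \<rho> * k x y powr c) (V \<times> V) = psum r V u * \<kappa>"
proof -
  have *: "(\<lambda>(x, y). pw u x powr \<rho> * k x y powr c) summable_on V \<times> V"
    "infsum (\<lambda>(x, y). pw u x powr \<rho> * k x y powr c) (V \<times> V) = (\<Sum>\<^sub>\<infinity>x\<in>V. pw u x powr \<rho> * \<kappa>)"
    by (rule pair_sum[where H="\<lambda>x. pw u x powr \<rho> * \<kappa>"];
        use assms k_has_sum in \<open>auto simp: pw_rho lp_def \<kappa>_def intro!: has_sum_cmult_right summable_on_cmult_left\<close>)+
  then show "(\<lambda>(x, y). pw u x powr \<rho> * k x y powr c) summable_on V \<times> V"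
    "infsum (\<lambda>(x, y). pw u x powr \<rho> * k x y powr c) (V \<times> V) = psum r V u * \<kappa>"
    by (simp_all add: pw_rho psum_def infsum_cmult_left')
  moreover have "(\<lambda>(x, y). pw u y powr \<rho> * k x y powr c) summable_on V \<times> V \<longleftrightarrow> (\<lambda>(x, y). pw u y powr \<rho> * k y x powr c) summable_on V \<times> V"
    "infsum (\<lambda>(x, y). pw u y powr \<rho> * k x y powr c) (V \<times> V) = infsum (\<lambda>(x, y). pw u y powr \<rho> * k y x powr c) (V \<times> V)"
    by (intro summable_on_cong infsum_cong; auto simp: k_sym)+
  ultimately show "(\<lambda>(x, y). pw u y powr \<rho> * k x y powr c) summable_on V \<times> V"
    "infsum (\<lambda>(x, y). pw u y powr \<rho> * k x y powr c) (V \<times> V) = psum r V u * \<kappa>"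
    using pair_swap[of "\<lambda>x y. pw u x powr \<rho> * k x y powr c" V] by simp_all
qed

lemma Z_sum:
  assumes "u \<in> lp r V" "v \<in> lp r V"
  shows "(\<lambda>(x, y). pw u x powr \<rho> * pw v y powr \<rho>) summable_on V \<times> V"
    "infsum (\<lambda>(x, y). pw u x powr \<rho> * pw v y powr \<rho>) (V \<times> V) = psum r V u * psum r V v"
proof -
  have *: "(\<lambda>(x, y). pw u x powr \<rho> * pw v y powr \<rho>) summable_on V \<times> V"
    "infsum (\<lambda>(x, y). pw u x powr \<rho> * pw v y powr \<rho>) (V \<times> V) = (\<Sum>\<^sub>\<infinity>x\<in>V. pw u x powr \<rho> * psum r V v)"
    by (rule pair_sum[where H="\<lambda>x. pw u x powr \<rho> * psum r V v"];
        use assms in \<open>auto simp: pw_rho lp_def psum_def intro!: has_sum_cmult_right has_sum_infsum summable_on_cmult_left\<close>)+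
  then show "(\<lambda>(x, y). pw u x powr \<rho> * pw v y powr \<rho>) summable_on V \<times> V"
    "infsum (\<lambda>(x, y). pw u x powr \<rho> * pw v y powr \<rho>) (V \<times> V) = psum r V u * psum r V v"
    by (simp_all add: pw_rho psum_def infsum_cmult_left')
qed

definition B :: "('a \<Rightarrow> real) \<Rightarrow> ('a \<Rightarrow> real) \<Rightarrow> real" where
  "B u v = infsum (\<lambda>(x, y). k x y * (pw u x * pw v y)) (V \<times> V)"

abbreviation Q :: "('a \<Rightarrow> real) \<Rightarrow> real" where "Q u \<equiv> B u u"

text \<open>The part of Young's majorant that receives the factor \<open>\<mu>\<close>; all of it
  contains \<open>v\<close>.\<close>

definition YZ :: "('a \<Rightarrow> real) \<Rightarrow> ('a \<Rightarrow> real) \<Rightarrow> 'a \<times> 'a \<Rightarrow> real" where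
  "YZ u v = (\<lambda>(x, y). pw v y powr \<rho> * k x y powr c + pw u x powr \<rho> * pw v y powr \<rho>)"

lemma YZ_sum:
  assumes "u \<in> lp r V" "v \<in> lp r V"
  shows "YZ u v summable_on V \<times> V" "infsum (YZ u v) (V \<times> V) = psum r V v * \<kappa> + psum r V u * psum r V v"
proof -
  have e: "YZ u v = (\<lambda>e. (\<lambda>(x, y). pw v y powr \<rho> * k x y powr c) e + (\<lambda>(x, y). pw u x powr \<rho> * pw v y powr \<rho>) e)"
    by (auto simp: YZ_def)
  show "YZ u v summable_on V \<times> V" unfolding e by (intro summable_on_add Y_sum(3) Z_sum(1) assms)
  show "infsum (YZ u v) (V \<times> V) = psum r V v * \<kappa> + psum r V u * psum r V v"
    unfolding e by (subst infsum_add) (use assms in \<open>auto simp: Y_sum Z_sum\<close>)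
qed

lemma young_pw:
  assumes "x \<in> V" "y \<in> V" "\<mu> > 0"
  shows "k x y * (pw u x * pw v y) \<le> \<mu> powr (- (1 - \<theta>) / \<theta>) * (pw u x powr \<rho> * k x y powr c) + \<mu> * YZ u v (x, y)"
  unfolding YZ_def c_def \<rho>_def prod.case by (rule young_term) (use assms exps k_nonneg in auto)

lemma B_bound:
  assumes "u \<in> lp r V" "v \<in> lp r V"
  shows "(\<lambda>(x, y). k x y * (pw u x * pw v y)) summable_on V \<times> V"
    and "B u v \<le> psum r V u * \<kappa> + psum r V v * \<kappa> + psum r V u * psum r V v" and "0 \<le> B u v"
proof -
  let ?R = "\<lambda>e. (\<lambda>(x, y). pw u x powr \<rho> * k x y powr c) e + YZ u v e"
  have R: "?R summable_on V \<times> V" by (intro summable_on_add Y_sum YZ_sum assms)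
  have b: "\<bar>(\<lambda>(x, y). k x y * (pw u x * pw v y)) e\<bar> \<le> ?R e" if "e \<in> V \<times> V" for e
    using young_pw[of "fst e" "snd e" 1 u v] that k_nonneg[of "fst e" "snd e"] by (cases e) auto
  show s: "(\<lambda>(x, y). k x y * (pw u x * pw v y)) summable_on V \<times> V" by (rule summable_on_abs_le[OF R b])
  have "B u v \<le> infsum ?R (V \<times> V)" unfolding B_def by (rule infsum_mono[OF s R]) (use b in \<open>force simp: abs_le_iff\<close>)
  also have "\<dots> = psum r V u * \<kappa> + (psum r V v * \<kappa> + psum r V u * psum r V v)"
    by (subst infsum_add) (use assms in \<open>auto simp: Y_sum YZ_sum\<close>)
  finally show "B u v \<le> psum r V u * \<kappa> + psum r V v * \<kappa> + psum r V u * psum r V v" by simp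
  show "0 \<le> B u v" unfolding B_def by (rule infsum_nonneg) (use k_nonneg in auto)
qed

lemma Q_scale: "Q (\<lambda>x. a * u x) = \<bar>a\<bar> powr (2 * p) * Q u"
proof -
  have "\<bar>a\<bar> powr (2 * p) = \<bar>a\<bar> powr p * \<bar>a\<bar> powr p" by (simp flip: powr_add)
  then have "Q (\<lambda>x. a * u x) = infsum (\<lambda>e. \<bar>a\<bar> powr (2 * p) * (\<lambda>(x, y). k x y * (pw u x * pw u y)) e) (V \<times> V)"
    unfolding B_def by (intro infsum_cong) (auto simp: pw_def abs_mult powr_mult)
  then show ?thesis by (simp add: infsum_cmult_right' B_def)
qed

text \<open>Homogeneity: the inhomogeneous \<open>B_bound\<close> is applied to the multiple of
  \<open>u\<close> with unit power sum.\<close>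

lemma Q_le:
  assumes "u \<in> lp r V"
  shows "Q u \<le> (2 * \<kappa> + 1) * psum r V u powr (2 * p / r)"
proof (cases "psum r V u = 0")
  case True
  then have "pw u x = 0" if "x \<in> V" for x using psum_eq_0D[OF assms True that] by (simp add: pw_def)
  then have "Q u = 0" unfolding B_def by (intro infsum_0) auto
  then show ?thesis using True by simp
next
  case False
  then have P: "psum r V u > 0" by (metis psum_nonneg order_le_less)
  define a where "a = psum r V u powr (- 1 / r)"
  have a: "\<bar>a\<bar> powr r * psum r V u = 1" "a > 0"
    using P exps(5) powr_minus_divide[of "psum r V u" 1] by (auto simp: a_def powr_powr)
  have "Q (\<lambda>x. a * u x) \<le> 2 * \<kappa> + 1"
    using B_bound(2)[OF lp_cmult(1)[where c=a, OF assms] lp_cmult(1)[where c=a, OF assms]]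
    by (simp only: lp_cmult(2) a mult_1)
  then have "a powr (2 * p) * Q u \<le> 2 * \<kappa> + 1" using a(2) by (simp add: Q_scale)
  then have "psum r V u powr (2 * p / r) * (a powr (2 * p) * Q u) \<le> psum r V u powr (2 * p / r) * (2 * \<kappa> + 1)"
    by (intro mult_left_mono) auto
  moreover have "psum r V u powr (2 * p / r) * a powr (2 * p) = 1"
    using P by (simp add: a_def powr_powr flip: powr_add)
  ultimately show ?thesis by (simp only: mult.assoc[symmetric] mult_1) (simp only: mult.commute)
qed

lemma Q_mono: 
  assumes "v \<in> lp r V" "\<And>x. x \<in> V \<Longrightarrow> \<bar>u x\<bar> \<le> \<bar>v x\<bar>"
  shows "Q u \<le> Q v"
proof -
  have u: "u \<in> lp r V" by (rule lp_mono(1)[OF assms]) (use exps in auto)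
  show ?thesis unfolding B_def
    by (rule infsum_mono[OF B_bound(1)[OF u u] B_bound(1)[OF assms(1) assms(1)]])
      (use assms(2) k_nonneg exps in \<open>auto simp: pw_def intro!: mult_left_mono mult_mono powr_mono2\<close>)
qed

lemma Q_translate:
  assumes "g \<in> V" shows "Q (\<lambda>x. u (g \<otimes> x)) = Q u"
proof -
  have b: "bij_betw (\<lambda>(x, y). (g \<otimes> x, g \<otimes> y)) (V \<times> V) (V \<times> V)"
    by (rule bij_betwI[where g="\<lambda>(x, y). (inv g \<otimes> x, inv g \<otimes> y)"]) (use assms in \<open>auto simp: m_assoc[symmetric]\<close>)
  show ?thesis unfolding B_def
    by (subst infsum_reindex_bij_betw[OF b, symmetric], rule infsum_cong)
      (use k_inv assms in \<open>auto simp: pw_def\<close>)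
qed

text \<open>The mixed terms of \<open>u n = d n + w\<close> are the difficulty, as they are small
  neither in size nor by a fixed majorant. Young's inequality with a small weight on the part
  containing \<open>d n\<close> leaves a bounded family times \<open>e\<close> and a summable
  function of \<open>w\<close> alone.\<close>

lemma brezis_lieb_Q:
  assumes un: "\<And>n. u n \<in> lp r V" "\<And>n. psum r V (u n) \<le> M"
    and lim: "\<And>x. x \<in> V \<Longrightarrow> (\<lambda>n. u n x) \<longlonglongrightarrow> w x"
  shows "(\<lambda>n. Q (u n) - Q (\<lambda>x. u n x - w x) - Q w) \<longlonglongrightarrow> 0"
proof -
  have r1: "r \<ge> 1" using p1 pr by simp
  have w: "w \<in> lp r V" "psum r V w \<le> M" by (rule lp_fatou[OF un lim], assumption, use exps in simp)+
  define d where "d n x = u n x - w x" for n x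
  define M' where "M' = 2 powr r * (M + M)"
  have d: "d n \<in> lp r V" "psum r V (d n) \<le> M'" for n
  proof -
    have mw: "(\<lambda>x. - 1 * w x) \<in> lp r V" "psum r V (\<lambda>x. - 1 * w x) = psum r V w"
      using lp_cmult[where f=w and q=r and A=V and c="- 1"] w by auto
    note a = lp_add(1,2)[OF un(1)[of n] mw(1) r1]
    show "d n \<in> lp r V" using a(1) by (simp add: d_def[abs_def])
    have "psum r V (d n) \<le> 2 powr r * (psum r V (u n) + psum r V w)" using a(2) mw(2) by (simp add: d_def[abs_def])
    also have "\<dots> \<le> M'" unfolding M'_def by (intro mult_left_mono add_mono un w) auto
    finally show "psum r V (d n) \<le> M'" .
  qed
  have M0: "0 \<le> M" using order_trans[OF psum_nonneg un(2)] .
  define qt where "qt u = (\<lambda>(x, y). k x y * (pw u x * pw u y))" for u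
  have qs: "qt u summable_on V \<times> V" "infsum (qt u) (V \<times> V) = Q u" if "u \<in> lp r V" for u
    using B_bound(1)[OF that that] by (auto simp: qt_def B_def)
  define f where "f n e = \<bar>qt (u n) e - (qt (d n) e + qt w e)\<bar>" for n e
  \<comment> \<open>Both orders of a pair occur, because either point may carry the remainder in a
    mixed term.\<close>
  define gg where "gg n e = qt (d n) e + (YZ w (d n) e + (\<lambda>(x, y). YZ w (d n) (y, x)) e)" for n e
  have sw: "(\<lambda>(x, y). YZ w (d n) (y, x)) summable_on V \<times> V"
    "infsum (\<lambda>(x, y). YZ w (d n) (y, x)) (V \<times> V) = infsum (YZ w (d n)) (V \<times> V)" for n
    using pair_swap[of "\<lambda>x y. YZ w (d n) (x, y)" V] YZ_sum(1)[OF w(1) d(1)] by auto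
  have fs: "f n summable_on V \<times> V" for n
  proof (rule summable_on_abs_le)
    show "(\<lambda>e. qt (u n) e + (qt (d n) e + qt w e)) summable_on V \<times> V" by (intro summable_on_add qs un d w)
    show "\<bar>f n e\<bar> \<le> qt (u n) e + (qt (d n) e + qt w e)" if "e \<in> V \<times> V" for e
    proof -
      have "0 \<le> qt v e" for v using that k_nonneg by (auto simp: qt_def)
      from this[of "u n"] this[of "d n"] this[of w] show ?thesis by (simp add: f_def abs_le_iff)
    qed
  qed
  have f0: "(\<lambda>n. infsum (f n) (V \<times> V)) \<longlonglongrightarrow> 0"
  proof (rule infsum_tendsto_zero[where g=gg and M="(M' * \<kappa> + M' * \<kappa> + M' * M') + 2 * (M' * \<kappa> + M * M')"])
    show "(\<lambda>n. f n e) \<longlonglongrightarrow> 0" if "e \<in> V \<times> V" for e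
    proof -
      obtain x y where e: "e = (x, y)" "x \<in> V" "y \<in> V" using \<open>e \<in> V \<times> V\<close> by auto
      have l: "(\<lambda>n. pw (u n) z) \<longlonglongrightarrow> pw w z" "(\<lambda>n. pw (d n) z) \<longlonglongrightarrow> 0" if "z \<in> V" for z
      proof -
        show "(\<lambda>n. pw (u n) z) \<longlonglongrightarrow> pw w z" unfolding pw_def
          by (intro tendsto_powr' tendsto_rabs lim that) (use exps in auto)
        have "(\<lambda>n. \<bar>u n z - w z\<bar> powr p) \<longlonglongrightarrow> \<bar>w z - w z\<bar> powr p"
          by (intro tendsto_powr' tendsto_intros lim that) (use exps in auto)
        then show "(\<lambda>n. pw (d n) z) \<longlonglongrightarrow> 0" by (simp add: pw_def d_def)
      qed
      have "(\<lambda>n. \<bar>k x y * (pw (u n) x * pw (u n) y) - (k x y * (pw (d n) x * pw (d n) y) + k x y * (pw w x * pw w y))\<bar>)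
         \<longlonglongrightarrow> \<bar>k x y * (pw w x * pw w y) - (k x y * (0 * 0) + k x y * (pw w x * pw w y))\<bar>"
        by (intro tendsto_intros l e)
      then show ?thesis by (simp add: f_def qt_def e)
    qed
    show "gg n summable_on V \<times> V" for n
      unfolding gg_def by (intro summable_on_add qs d YZ_sum w sw)
    show "infsum (gg n) (V \<times> V) \<le> (M' * \<kappa> + M' * \<kappa> + M' * M') + 2 * (M' * \<kappa> + M * M')" for n
    proof -
      have "infsum (gg n) (V \<times> V) = Q (d n) + 2 * infsum (YZ w (d n)) (V \<times> V)"
        unfolding gg_def
        by (subst infsum_add, (intro summable_on_add qs d YZ_sum w sw)+,
            subst infsum_add, (intro summable_on_add qs d YZ_sum w sw)+, simp add: sw qs d)
      also have "\<dots> \<le> (M' * \<kappa> + M' * \<kappa> + M' * M') + 2 * (M' * \<kappa> + M * M')"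
      proof (intro add_mono mult_left_mono)
        have "Q (d n) \<le> psum r V (d n) * \<kappa> + psum r V (d n) * \<kappa> + psum r V (d n) * psum r V (d n)"
          by (rule B_bound(2)[OF d(1) d(1)])
        also have "\<dots> \<le> M' * \<kappa> + M' * \<kappa> + M' * M'"
          by (intro add_mono mult_right_mono mult_mono d \<kappa>_nonneg psum_nonneg order_trans[OF psum_nonneg d(2)])
        finally show "Q (d n) \<le> M' * \<kappa> + M' * \<kappa> + M' * M'" .
        show "infsum (YZ w (d n)) (V \<times> V) \<le> M' * \<kappa> + M * M'"
          unfolding YZ_sum(2)[OF w(1) d(1)]
          by (intro add_mono mult_right_mono mult_mono d w \<kappa>_nonneg psum_nonneg M0)
      qed simp
      finally show ?thesis .
    qed
    show "0 \<le> gg n e" if "e \<in> V \<times> V" for n e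
      using that k_nonneg by (auto simp: gg_def qt_def YZ_def)
    fix e :: real assume e: "e > 0"
    obtain C where C: "C \<ge> 0" "\<And>a b. \<bar>\<bar>a + b\<bar> powr p - \<bar>a\<bar> powr p\<bar> \<le> e * \<bar>a\<bar> powr p + C * \<bar>b\<bar> powr p"
      using powr_abs_diff_le[OF p1 e] by blast
    define D where "D = 2 powr p"
    have D: "D \<ge> 1" using exps by (simp add: D_def ge_one_powr_ge_zero)
    \<comment> \<open>Small enough for \<open>C * D * D * \<mu> \<le> e\<close>; the
      \<open>+ 1\<close> guards against a zero denominator.\<close>
    define \<mu> where "\<mu> = e / (C * D * D + 1)"
    have CD: "C * D * D \<ge> 0" using C D by simp
    have \<mu>: "\<mu> > 0" "C * D * D * \<mu> \<le> e"
      using e CD by (auto simp: \<mu>_def field_simps add_pos_nonneg mult_left_mono)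
    define l where "l = \<mu> powr (- (1 - \<theta>) / \<theta>)"
    define h where "h = (\<lambda>e'. (C * D + 1) * qt w e' + C * D * D * l *
      ((\<lambda>(x, y). pw w x powr \<rho> * k x y powr c) e' + (\<lambda>(x, y). pw w y powr \<rho> * k x y powr c) e'))"
    have "h summable_on V \<times> V" unfolding h_def by (intro summable_on_add summable_on_cmult_right qs w Y_sum)
    moreover have "f n e' \<le> e * gg n e' + h e'" if e': "e' \<in> V \<times> V" for n e'
    proof -
      obtain x y where xy: "e' = (x, y)" "x \<in> V" "y \<in> V" using e' by auto
      \<comment> \<open>With the \<open>p\<close>-th root of the kernel, each pair contributes the
        \<open>p\<close>-th power of a product bilinear in the values of the function. The product
        then splits into the pure parts \<open>E\<close> and \<open>W\<close> and the mixed part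
        \<open>Z\<close>, and the scalar inequality applies.\<close>
      define \<tau> where "\<tau> = k x y powr (1 / p)"
      have \<tau>: "\<tau> \<ge> 0" "\<tau> powr p = k x y" using k_nonneg[OF xy(2,3)] exps by (auto simp: \<tau>_def powr_powr)
      have tp: "\<bar>\<tau> * (a * b)\<bar> powr p = k x y * (\<bar>a\<bar> powr p * \<bar>b\<bar> powr p)" for a b
        using \<tau> by (simp add: abs_mult powr_mult)
      have q: "qt v e' = \<bar>\<tau> * (v x * v y)\<bar> powr p" for v by (simp add: qt_def xy tp pw_def)
      define W where "W = \<tau> * (w x * w y)"
      define Z where "Z = \<tau> * (w x * d n y) + \<tau> * (d n x * w y)"
      define E where "E = \<tau> * (d n x * d n y)"
      have dec: "\<tau> * (u n x * u n y) = E + (W + Z)" by (simp add: E_def W_def Z_def d_def algebra_simps)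
      have Zb: "\<bar>Z\<bar> powr p \<le> D * (k x y * (pw w x * pw (d n) y) + k y x * (pw w y * pw (d n) x))"
        unfolding D_def Z_def
        using powr_abs_add_le2[OF p1, of "\<tau> * (w x * d n y)" "\<tau> * (d n x * w y)"] k_sym[OF xy(2,3)]
        by (simp add: tp pw_def mult_ac)
      have f': "f n e' = \<bar>\<bar>E + (W + Z)\<bar> powr p - (\<bar>E\<bar> powr p + \<bar>W\<bar> powr p)\<bar>"
        unfolding dec[symmetric] by (simp add: f_def q E_def W_def)
      have "f n e' \<le> e * \<bar>E\<bar> powr p + C * \<bar>W + Z\<bar> powr p + \<bar>W\<bar> powr p"
        unfolding f' using C(2)[of E "W + Z"] powr_ge_zero[of "\<bar>W\<bar>" p] by linarith
      also have "\<dots> \<le> e * \<bar>E\<bar> powr p + C * (D * (\<bar>W\<bar> powr p + \<bar>Z\<bar> powr p)) + \<bar>W\<bar> powr p"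
        unfolding D_def by (intro add_mono mult_left_mono powr_abs_add_le2 p1 C) (use e in auto)
      also have "\<dots> = e * \<bar>E\<bar> powr p + (C * D + 1) * \<bar>W\<bar> powr p + C * D * \<bar>Z\<bar> powr p" by (simp add: algebra_simps)
      also have "\<dots> \<le> e * \<bar>E\<bar> powr p + (C * D + 1) * \<bar>W\<bar> powr p + C * D * (D * (
          (l * (pw w x powr \<rho> * k x y powr c) + \<mu> * YZ w (d n) (x, y)) + (l * (pw w y powr \<rho> * k y x powr c) + \<mu> * YZ w (d n) (y, x))))"
        unfolding l_def
        by (intro add_left_mono mult_left_mono order_trans[OF Zb] add_mono young_pw xy \<mu>) (use C D in auto)
      also have "\<dots> = e * \<bar>E\<bar> powr p + (C * D * D * \<mu>) * (YZ w (d n) (x, y) + YZ w (d n) (y, x)) + h e'"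
        using k_sym[OF xy(2,3)] q[of w] by (simp add: h_def W_def xy(1) algebra_simps)
      also have "\<dots> \<le> e * \<bar>E\<bar> powr p + e * (YZ w (d n) (x, y) + YZ w (d n) (y, x)) + h e'"
        by (intro add_mono mult_right_mono \<mu>) (use xy k_nonneg in \<open>auto simp: YZ_def\<close>)
      also have "\<dots> = e * gg n e' + h e'" by (simp add: gg_def q E_def) (simp add: xy(1) algebra_simps)
      finally show ?thesis .
    qed
    ultimately show "\<exists>h. h summable_on V \<times> V \<and> (\<forall>n. \<forall>e'\<in>V \<times> V. f n e' \<le> e * gg n e' + h e')" by blast
  qed (use fs in \<open>auto simp: f_def\<close>)
  have "(\<lambda>n. Q (u n) - Q (d n) - Q w) \<longlonglongrightarrow> 0"
  proof (rule Lim_null_comparison[OF _ f0], rule always_eventually, rule allI)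
    fix n
    have "Q (u n) - Q (d n) - Q w = (\<Sum>\<^sub>\<infinity>e\<in>V \<times> V. qt (u n) e - (qt (d n) e + qt w e))"
      using un d w by (subst infsum_diff_real) (auto simp: qs infsum_add intro!: summable_on_add)
    also have "norm \<dots> \<le> infsum (f n) (V \<times> V)"
      unfolding real_norm_def by (rule infsum_abs_le[OF fs]) (simp add: f_def)
    finally show "norm (Q (u n) - Q (d n) - Q w) \<le> infsum (f n) (V \<times> V)" .
  qed
  then show ?thesis by (simp add: d_def[abs_def])
qed

end

subsection \<open>Existence of maximizers\<close>

lemma powr_split_lt_1:
  fixes a s :: real
  assumes "0 < a" "a < 1" "1 < s"
  shows "a powr s + (1 - a) powr s < 1"
  using powr_less_mono'[of a 1 s] powr_less_mono'[of "1 - a" 1 s] assms by simp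

context choquard_kernel
begin

definition R :: "('a \<Rightarrow> real) \<Rightarrow> 'a \<Rightarrow> real" where
  "R u x = (\<Sum>\<^sub>\<infinity>y\<in>V. k x y * pw u y)"

text \<open>A single row of the pair sum, isolated by a point mass in the first variable.\<close>

lemma R_summable:
  assumes "u \<in> lp r V" "x \<in> V" shows "(\<lambda>y. k x y * pw u y) summable_on V"
proof -
  have "(\<lambda>(z, y). k z y * (pw (indicator {x}) z * pw u y)) summable_on V \<times> V"
    by (rule B_bound(1)[OF fin_lp[OF fin_indicator] assms(1)])
  from summable_on_SigmaD1[OF this assms(2)] show ?thesis by (simp add: pw_def)
qed

lemma Q_iterated:
  assumes "u \<in> lp r V"
  shows "(\<lambda>x. R u x * pw u x) summable_on V" "Q u = (\<Sum>\<^sub>\<infinity>x\<in>V. R u x * pw u x)"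
proof -
  have e: "(\<Sum>\<^sub>\<infinity>y\<in>V. k x y * (pw u x * pw u y)) = R u x * pw u x" for x
    unfolding R_def by (subst infsum_cmult_left'[symmetric], rule infsum_cong) (simp add: mult_ac)
  note s = B_bound(1)[OF assms assms]
  show "Q u = (\<Sum>\<^sub>\<infinity>x\<in>V. R u x * pw u x)"
    using infsum_Sigma_banach[OF s] e by (simp add: B_def)
  have "(\<lambda>x. \<Sum>\<^sub>\<infinity>y\<in>V. k x y * (pw u x * pw u y)) summable_on V"
    using summable_on_SigmaD[OF s] summable_on_SigmaD1[OF s] by simp
  then show "(\<lambda>x. R u x * pw u x) summable_on V" by (simp add: e)
qed

text \<open>Because the kernel vanishes on the diagonal, changing one value of the function changes the energy
  affinely in \<open>pw\<close> of that value.\<close>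

lemma Q_change_point:
  assumes v: "v \<in> lp r V" and w: "w \<in> lp r V" and x: "x \<in> V" and eq: "\<And>y. y \<in> V \<Longrightarrow> y \<noteq> x \<Longrightarrow> w y = v y"
  shows "Q w = Q v + 2 * ((pw w x - pw v x) * R v x)"
proof -
  define a where "a y z = indicator {x} y * (k y z * pw v z)" for y z
  have Rs: "((\<lambda>z. k x z * pw v z) has_sum R v x) V"
    unfolding R_def by (rule has_sum_infsum[OF R_summable[OF v x]])
  have as: "(\<lambda>(y, z). a y z) summable_on V \<times> V" "infsum (\<lambda>(y, z). a y z) (V \<times> V) = (\<Sum>\<^sub>\<infinity>y\<in>V. indicator {x} y * R v x)"
    by (rule pair_sum[where H="\<lambda>y. indicator {x} y * R v x"];
        use Rs k_nonneg fin_summable[OF fin_indicator[of x]] in \<open>auto simp: a_def indicator_def\<close>)+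
  have "(\<Sum>\<^sub>\<infinity>y\<in>V. indicator {x} y * R v x) = R v x"
    using ip_indicator[OF x, of "\<lambda>_. R v x"] by (simp add: ip_def mult.commute)
  then have ai: "infsum (\<lambda>(y, z). a y z) (V \<times> V) = R v x" using as by simp
  note bs = pair_swap[of a V]
  define D where "D = pw w x - pw v x"
  have pt: "k y z * (pw w y * pw w z) = k y z * (pw v y * pw v z) + D * (a y z + a z y)" if "y \<in> V" "z \<in> V" for y z
    using eq[OF that(1)] eq[OF that(2)] k_diag[of x] k_sym[OF that]
    by (cases "y = x"; cases "z = x") (auto simp: a_def D_def pw_def algebra_simps)
  have "Q w = infsum (\<lambda>e. (\<lambda>(y, z). k y z * (pw v y * pw v z)) e + D * ((\<lambda>(y, z). a y z) e + (\<lambda>(y, z). a z y) e)) (V \<times> V)"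
    unfolding B_def by (rule infsum_cong) (use pt in auto)
  also have "\<dots> = Q v + D * (R v x + R v x)"
    using as(1) bs ai B_bound(1)[OF v v]
    by (simp add: infsum_add infsum_cmult_right' summable_on_add summable_on_cmult_right B_def)
  finally show ?thesis by (simp add: D_def)
qed

end

text \<open>The two variational problems differ only in the operator \<open>T\<close>: the gradient, on the edge set
  \<open>I = V \<times> S\<close>, or the Laplacian, on \<open>I = V\<close>.\<close>

locale variational = choquard_kernel G S N k p r
  for G :: "('a, 'b) monoid_scheme" (structure) and S N and k :: "'a \<Rightarrow> 'a \<Rightarrow> real" and p r +
  fixes T :: "('a \<Rightarrow> real) \<Rightarrow> 'i \<Rightarrow> real" and I :: "'i set" and q m Cs :: real
  assumes q1: "1 \<le> q" "q < 2 * p" and m0: "0 < m" "m < r"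
    and T_lin: "\<And>u v a i. i \<in> I \<Longrightarrow> T (\<lambda>x. u x + a * v x) i = T u i + a * T v i"
    and T_lim: "\<And>u w i. (\<And>x. x \<in> V \<Longrightarrow> (\<lambda>n. u n x) \<longlonglongrightarrow> w x) \<Longrightarrow> i \<in> I \<Longrightarrow> (\<lambda>n. T (u n) i) \<longlonglongrightarrow> T w i"
    and T_trans: "\<And>g u. g \<in> V \<Longrightarrow> T u \<in> lp q I \<Longrightarrow> T (\<lambda>x. u (g \<otimes> x)) \<in> lp q I"
      "\<And>g u. g \<in> V \<Longrightarrow> T u \<in> lp q I \<Longrightarrow> psum q I (T (\<lambda>x. u (g \<otimes> x))) = psum q I (T u)"
    and T_fin: "\<And>u. fin u \<Longrightarrow> finite {i \<in> I. T u i \<noteq> 0}"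
    and sob: "\<And>u. u \<in> lp m V \<Longrightarrow> T u \<in> lp q I \<Longrightarrow> psum m V u \<le> Cs * psum q I (T u) powr (m / q)"
begin

section \<open>The function space and its extremal constant\<close>

lemma T_zero: "i \<in> I \<Longrightarrow> T (\<lambda>_. 0) i = 0"
  using T_lin[of i "\<lambda>_. 0" 1 "\<lambda>_. 0"] by simp

lemma T_scale: "i \<in> I \<Longrightarrow> T (\<lambda>x. a * u x) i = a * T u i"
  using T_lin[of i "\<lambda>_. 0" a u] T_zero by simp

lemma T_diff: "i \<in> I \<Longrightarrow> T (\<lambda>x. u x - v x) i = T u i - T v i"
  using T_lin[of i u "- 1" v] by simp

lemma T_lp_fin: "fin u \<Longrightarrow> T u \<in> lp q I"
  by (rule lp_finite_support(1)[OF T_fin]) auto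

definition E :: "('a \<Rightarrow> real) set" where "E = {u \<in> lp m V. T u \<in> lp q I}"

abbreviation nT :: "('a \<Rightarrow> real) \<Rightarrow> real" where "nT u \<equiv> psum q I (T u)"

lemma E_scale: 
  assumes "u \<in> E" shows "(\<lambda>x. a * u x) \<in> E" "nT (\<lambda>x. a * u x) = \<bar>a\<bar> powr q * nT u"
proof -
  have "psum q I (T (\<lambda>x. a * u x)) = psum q I (\<lambda>i. a * T u i)" "T (\<lambda>x. a * u x) \<in> lp q I \<longleftrightarrow> (\<lambda>i. a * T u i) \<in> lp q I"
    using T_scale by (intro lp_cong; auto)+
  then show "(\<lambda>x. a * u x) \<in> E" "nT (\<lambda>x. a * u x) = \<bar>a\<bar> powr q * nT u"
    using assms by (auto simp: E_def lp_cmult)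
qed

lemma E_add:
  assumes "u \<in> E" "v \<in> E" "1 \<le> m" shows "(\<lambda>x. u x + a * v x) \<in> E"
proof -
  have "T (\<lambda>x. u x + a * v x) \<in> lp q I \<longleftrightarrow> (\<lambda>i. T u i + a * T v i) \<in> lp q I"
    using T_lin by (intro lp_cong) auto
  then show ?thesis using assms lp_add(1)[of u m V "\<lambda>x. a * v x"] lp_add(1)[of "T u" q I "\<lambda>i. a * T v i"] q1
    by (auto simp: E_def lp_cmult)
qed

lemma E_lp_r: "u \<in> E \<Longrightarrow> u \<in> lp r V"
  using lp_embed(1)[of u m V r] m0 by (auto simp: E_def)

lemma E_fin: "fin u \<Longrightarrow> u \<in> E"
  using fin_lp T_lp_fin by (auto simp: E_def)

text \<open>The Sobolev inequality makes the seminorm definite on \<open>E\<close>.\<close>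

lemma E_zero: "u \<in> E \<Longrightarrow> nT u = 0 \<Longrightarrow> x \<in> V \<Longrightarrow> u x = 0"
proof -
  assume u: "u \<in> E" "nT u = 0" and x: "x \<in> V"
  then have "psum m V u \<le> 0" using sob[of u] m0 q1 by (auto simp: E_def)
  then have "psum m V u = 0" by (simp add: order.antisym)
  then show "u x = 0" using psum_eq_0D[of u m V x] u x by (auto simp: E_def)
qed

lemma Q_zero: "(\<And>x. x \<in> V \<Longrightarrow> u x = 0) \<Longrightarrow> Q u = 0"
  unfolding B_def by (rule infsum_0) (auto simp: pw_def)

lemma Cs_nonneg: "u \<in> E \<Longrightarrow> nT u = 1 \<Longrightarrow> psum m V u \<le> Cs"
  using sob[of u] by (auto simp: E_def)

lemma Q_bounded: "u \<in> E \<Longrightarrow> nT u = 1 \<Longrightarrow> Q u \<le> (2 * \<kappa> + 1) * (Cs powr (r / m)) powr (2 * p / r)"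
proof -
  assume u: "u \<in> E" "nT u = 1"
  have "psum r V u \<le> psum m V u powr (r / m)" using lp_embed(2)[of u m V r] m0 u by (auto simp: E_def)
  also have "\<dots> \<le> Cs powr (r / m)" using Cs_nonneg[OF u] m0 by (intro powr_mono2) auto
  finally have "(2 * \<kappa> + 1) * psum r V u powr (2 * p / r) \<le> (2 * \<kappa> + 1) * (Cs powr (r / m)) powr (2 * p / r)"
    using \<kappa>_nonneg exps by (intro mult_left_mono powr_mono2) auto
  then show ?thesis using Q_le[OF E_lp_r[OF u(1)]] by linarith
qed

definition K :: real where "K = Sup (Q ` {u \<in> E. nT u = 1})"

lemma Q_le_K: "u \<in> E \<Longrightarrow> nT u = 1 \<Longrightarrow> Q u \<le> K"
  unfolding K_def by (rule cSup_upper) (use Q_bounded in \<open>auto intro!: bdd_aboveI\<close>)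

lemma normalize:
  assumes "u \<in> E" "nT u > 0"
  defines "v \<equiv> \<lambda>x. nT u powr (- 1 / q) * u x"
  shows "v \<in> E" "nT v = 1" "Q u = Q v * nT u powr (2 * p / q)"
proof -
  show "v \<in> E" "nT v = 1" unfolding v_def
    using E_scale[OF assms(1)] assms(2) q1 powr_minus_divide[of "nT u" 1] by (auto simp: powr_powr)
  have "Q v = nT u powr (- (2 * p / q)) * Q u" unfolding v_def using assms(2) by (simp add: Q_scale powr_powr)
  moreover have "nT u powr (- (2 * p / q)) * nT u powr (2 * p / q) = 1" using assms(2) by (simp flip: powr_add)
  ultimately show "Q u = Q v * nT u powr (2 * p / q)" by (simp add: mult_ac)
qed

text \<open>The scale-free form is needed for remainders and variations, whose norm is not
  1.\<close>

lemma Q_le_hom: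
  assumes "u \<in> E" shows "Q u \<le> K * nT u powr (2 * p / q)"
proof (cases "nT u = 0")
  case True
  then show ?thesis using Q_zero[of u] E_zero[OF assms] by simp
next
  case False
  then have "nT u > 0" by (metis psum_nonneg order_le_less)
  from normalize[OF assms this] Q_le_K show ?thesis by (simp add: mult_right_mono)
qed

lemma K_pos: "K > 0"
proof -
  obtain x y where xy: "x \<in> V" "y \<in> V" "0 < k x y" using k_pos by blast
  define u :: "'a \<Rightarrow> real" where "u = indicator {x, y}"
  have u: "fin u" by (rule finite_subset[of _ "{x, y}"]) (auto simp: u_def indicator_def)
  have "0 < k x y * (pw u x * pw u y)" using xy by (simp add: u_def pw_def)
  also have "\<dots> = (\<Sum>e\<in>{(x, y)}. (\<lambda>(x, y). k x y * (pw u x * pw u y)) e)" by simp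
  also have "\<dots> \<le> Q u" unfolding B_def
    by (rule finite_sum_le_infsum[OF B_bound(1)[OF fin_lp[OF u] fin_lp[OF u]]]) (use xy k_nonneg in auto)
  finally have Q: "Q u > 0" .
  then have "0 < K * nT u powr (2 * p / q)" using Q_le_hom[OF E_fin[OF u]] by linarith
  then show ?thesis by (simp add: zero_less_mult_iff)
qed

lemma maximizing_translates:
  obtains u b where "\<And>n. u n \<in> E" "\<And>n. nT (u n) = 1" "(\<lambda>n. Q (u n)) \<longlonglongrightarrow> K" "b > 0" "\<And>n. b < \<bar>u n \<one>\<bar>"
proof -
  have ne: "\<exists>u. u \<in> E \<and> nT u = 1"
  proof (rule ccontr)
    assume "\<not> ?thesis"
    define u :: "'a \<Rightarrow> real" where "u = indicator {\<one>}"
    have u: "u \<in> E" unfolding u_def by (rule E_fin[OF fin_indicator])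
    have "nT u \<noteq> 0" using E_zero[OF u, of \<one>] by (auto simp: u_def)
    then have "nT u > 0" by (metis psum_nonneg order_le_less)
    from normalize[OF u this] \<open>\<not> ?thesis\<close> show False by blast
  qed
  \<comment> \<open>The errors stay below \<open>K / 2\<close>, so all energies are bounded away
    from 0.\<close>
  define e where "e n = K / (2 * real (Suc n))" for n
  have e: "e n > 0" "e n \<le> K / 2" for n
    using K_pos by (auto simp: e_def field_simps)
  have "\<exists>u. u \<in> E \<and> nT u = 1 \<and> K - e n < Q u" for n
  proof -
    have "\<exists>y\<in>Q ` {u \<in> E. nT u = 1}. K - e n < y"
      by (rule less_cSupD) (use ne e(1)[of n] in \<open>auto simp: K_def[symmetric]\<close>)
    then show ?thesis by blast
  qed
  then obtain u where u: "\<And>n. u n \<in> E" "\<And>n. nT (u n) = 1" "\<And>n. K - e n < Q (u n)" by metis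
  \<comment> \<open>An energy of at least \<open>K / 2\<close> forces a power sum of exponent
    \<open>r\<close> of at least \<open>\<delta>\<close>; the bound \<open>b\<close> is such that
    \<open>\<bar>u\<bar> \<le> b\<close> everywhere would leave at most
    \<open>\<delta> / 2\<close>.\<close>
  define \<delta> where "\<delta> = (K / (2 * (2 * \<kappa> + 1))) powr (r / (2 * p))"
  have \<delta>: "\<delta> > 0" using K_pos \<kappa>_nonneg by (simp add: \<delta>_def)
  define b where "b = (\<delta> / (2 * (\<bar>Cs\<bar> + 1))) powr (1 / (r - m))"
  have b: "b > 0" "b powr (r - m) = \<delta> / (2 * (\<bar>Cs\<bar> + 1))" using \<delta> m0 by (auto simp: b_def powr_powr)
  have "\<exists>x\<in>V. b < \<bar>u n x\<bar>" for n
  proof (rule ccontr)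
    assume "\<not> ?thesis"
    then have le: "\<And>x. x \<in> V \<Longrightarrow> \<bar>u n x\<bar> \<le> b" by force
    have um: "u n \<in> lp m V" using u by (simp add: E_def)
    have "K / 2 < (2 * \<kappa> + 1) * psum r V (u n) powr (2 * p / r)"
      using Q_le[OF E_lp_r[OF u(1)], of n] u(3)[of n] e(2)[of n] by linarith
    then have "K / (2 * (2 * \<kappa> + 1)) \<le> psum r V (u n) powr (2 * p / r)"
      using \<kappa>_nonneg by (simp add: field_simps)
    then have "\<delta> \<le> (psum r V (u n) powr (2 * p / r)) powr (r / (2 * p))"
      unfolding \<delta>_def using K_pos \<kappa>_nonneg exps by (intro powr_mono2) auto
    then have "\<delta> \<le> psum r V (u n)" using exps by (simp add: powr_powr)
    also have "\<dots> \<le> b powr (r - m) * psum m V (u n)" by (rule lp_embed_bound(2)[OF um _ le]) (use m0 in auto)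
    also have "\<dots> \<le> \<delta> / (2 * (\<bar>Cs\<bar> + 1)) * (\<bar>Cs\<bar> + 1)"
      unfolding b(2) using Cs_nonneg[OF u(1,2), of n] \<delta> by (intro mult_left_mono) auto
    also have "\<dots> = \<delta> / 2" by (simp add: field_simps)
    finally show False using \<delta> by simp
  qed
  then obtain g where g: "\<And>n. g n \<in> V" "\<And>n. b < \<bar>u n (g n)\<bar>" by metis
  define v where "v n x = u n (g n \<otimes> x)" for n x
  show thesis
  proof (rule that[of v b])
    show "v n \<in> E" for n
      using u(1)[of n] T_trans(1)[OF g(1)[of n]] lp_translate(1)[OF g(1)[of n]] by (simp add: E_def v_def[abs_def])
    show "nT (v n) = 1" for n
      using u(1,2)[of n] T_trans(2)[OF g(1)[of n]] by (simp add: E_def v_def[abs_def])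
    have Qv: "Q (v n) = Q (u n)" for n using Q_translate[OF g(1)] by (simp add: v_def[abs_def])
    have "(\<lambda>n. K / 2 * (1 / real (Suc n))) \<longlonglongrightarrow> K / 2 * 0"
      by (intro tendsto_intros LIMSEQ_Suc[OF lim_1_over_n])
    then have "(\<lambda>n. K - e n) \<longlonglongrightarrow> K - 0" by (intro tendsto_intros) (simp add: e_def)
    then have lo: "(\<lambda>n. K - e n) \<longlonglongrightarrow> K" by simp
    show "(\<lambda>n. Q (v n)) \<longlonglongrightarrow> K" unfolding Qv
      by (rule tendsto_sandwich[OF _ _ lo tendsto_const])
        (use u Q_le_K in \<open>auto intro!: always_eventually less_imp_le\<close>)
    show "b < \<bar>v n \<one>\<bar>" for n using g by (simp add: v_def)
  qed (rule b)
qed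

theorem maximizer_exists:
  obtains v where "v \<in> E" "nT v = 1" "Q v = K"
proof -
  obtain u b where u: "\<And>n. u n \<in> E" "\<And>n. nT (u n) = 1" "(\<lambda>n. Q (u n)) \<longlonglongrightarrow> K" "b > 0" "\<And>n. b < \<bar>u n \<one>\<bar>"
    using maximizing_translates by blast
  have bd: "norm (u n x) \<le> Cs powr (1 / m)" if "x \<in> V" for n x
  proof -
    have "\<bar>u n x\<bar> \<le> psum m V (u n) powr (1 / m)" by (rule lp_abs_le) (use u that m0 in \<open>auto simp: E_def\<close>)
    also have "\<dots> \<le> Cs powr (1 / m)" using Cs_nonneg[OF u(1,2)] m0 by (intro powr_mono2) auto
    finally show ?thesis by simp
  qed
  obtain j where j: "strict_mono j" "\<And>x. x \<in> V \<Longrightarrow> \<exists>l. (\<lambda>n. u (j n) x) \<longlonglongrightarrow> l"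
    using function_convergent_subsequence[of V u, OF V_countable bd] by blast
  then obtain v where v: "\<And>x. x \<in> V \<Longrightarrow> (\<lambda>n. u (j n) x) \<longlonglongrightarrow> v x" by metis
  define w where "w n = u (j n)" for n
  have w: "w n \<in> E" "nT (w n) = 1" "w n \<in> lp m V" "T (w n) \<in> lp q I" "psum m V (w n) \<le> Cs" for n
    using u(1,2) Cs_nonneg[OF u(1,2)] by (auto simp: w_def E_def)
  have wl: "\<And>x. x \<in> V \<Longrightarrow> (\<lambda>n. w n x) \<longlonglongrightarrow> v x" using v by (simp add: w_def)
  have Tl: "\<And>i. i \<in> I \<Longrightarrow> (\<lambda>n. T (w n) i) \<longlonglongrightarrow> T v i" using T_lim[OF wl] .
  have Qw: "(\<lambda>n. Q (w n)) \<longlonglongrightarrow> K"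
    using LIMSEQ_subseq_LIMSEQ[OF u(3) j(1)] by (simp add: w_def o_def)
  have vm: "v \<in> lp m V" by (rule lp_fatou(1)[OF w(3,5) wl m0(1)])
  have Tv: "T v \<in> lp q I" "nT v \<le> 1"
    using lp_fatou[of "\<lambda>n. T (w n)" q I 1 "T v", OF w(4) _ Tl] w(2) q1 by auto
  have vE: "v \<in> E" using vm Tv by (simp add: E_def)
  define a where "a = nT v"
  have "b \<le> \<bar>v \<one>\<bar>"
    by (rule LIMSEQ_le_const[OF tendsto_rabs[OF wl]]) (use u(5) in \<open>auto simp: w_def intro: less_imp_le\<close>)
  then have "v \<one> \<noteq> 0" using u(4) by auto
  then have "a \<noteq> 0" using E_zero[OF vE, of \<one>] by (auto simp: a_def)
  then have a: "0 < a" "a \<le> 1" using Tv(2) psum_nonneg[of q I "T v"] unfolding a_def by linarith+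
  define s where "s = 2 * p / q"
  have s: "s > 1" using q1 by (simp add: s_def)
  have dE: "(\<lambda>x. w n x - v x) \<in> E" for n
  proof -
    \<comment> \<open>The locale only gives \<open>0 < m\<close>, while \<open>lp_add\<close> rests
      on convexity; estimating by twice the maximum works for every positive exponent.\<close>
    have 1: "(\<lambda>x. w n x - v x) \<in> lp m V"
    proof -
      have "(\<lambda>x. 2 powr m * (\<bar>w n x\<bar> powr m + \<bar>v x\<bar> powr m)) summable_on V"
        using w(3)[of n] vm by (intro summable_on_cmult_right summable_on_add) (auto simp: lp_def)
      moreover have "\<bar>\<bar>w n x - v x\<bar> powr m\<bar> \<le> 2 powr m * (\<bar>w n x\<bar> powr m + \<bar>v x\<bar> powr m)" for x
      proof -
        have "\<bar>w n x - v x\<bar> powr m \<le> (2 * max \<bar>w n x\<bar> \<bar>v x\<bar>) powr m" using m0 by (intro powr_mono2) auto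
        also have "\<dots> = 2 powr m * max \<bar>w n x\<bar> \<bar>v x\<bar> powr m" by (simp add: powr_mult)
        also have "\<dots> \<le> 2 powr m * (\<bar>w n x\<bar> powr m + \<bar>v x\<bar> powr m)"
          by (intro mult_left_mono) (auto simp: max_def)
        finally show ?thesis by simp
      qed
      ultimately show ?thesis unfolding lp_def mem_Collect_eq by (rule summable_on_abs_le)
    qed
    have "(\<lambda>i. T (w n) i + - 1 * T v i) \<in> lp q I" using lp_add(1)[OF w(4) lp_cmult(1)[OF Tv(1)] q1(1)] .
    then have "T (\<lambda>x. w n x - v x) \<in> lp q I" using lp_cong(1)[of I "T (\<lambda>x. w n x - v x)" "\<lambda>i. T (w n) i + - 1 * T v i" q] T_diff by simp
    with 1 show ?thesis by (simp add: E_def)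
  qed
  have nd: "(\<lambda>n. nT (\<lambda>x. w n x - v x)) \<longlonglongrightarrow> 1 - a"
  proof -
    have "(\<lambda>n. psum q I (\<lambda>i. T (w n) i - T v i)) \<longlonglongrightarrow> 1 - a"
      unfolding a_def by (rule brezis_lieb[OF q1(1) w(4) _ Tl]) (use w(2) in auto)
    moreover have "psum q I (\<lambda>i. T (w n) i - T v i) = nT (\<lambda>x. w n x - v x)" for n
      by (rule lp_cong(2)) (simp add: T_diff)
    ultimately show ?thesis by simp
  qed
  have "psum r V (w n) \<le> Cs powr (r / m)" for n
  proof -
    have "psum r V (w n) \<le> psum m V (w n) powr (r / m)" by (rule lp_embed(2)[OF w(3)]) (use m0 in auto)
    also have "\<dots> \<le> Cs powr (r / m)" using w(5) m0 by (intro powr_mono2) auto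
    finally show ?thesis .
  qed
  from brezis_lieb_Q[OF E_lp_r[OF w(1)] this wl]
  have "(\<lambda>n. Q (w n) - Q (\<lambda>x. w n x - v x) - Q v) \<longlonglongrightarrow> 0" .
  from tendsto_diff[OF tendsto_diff[OF Qw this] tendsto_const[of "Q v"]]
  have 1: "(\<lambda>n. Q (\<lambda>x. w n x - v x)) \<longlonglongrightarrow> K - Q v" by simp
  have 2: "(\<lambda>n. K * nT (\<lambda>x. w n x - v x) powr s) \<longlonglongrightarrow> K * (1 - a) powr s"
    by (intro tendsto_mult_left tendsto_powr' nd tendsto_const) (use s in auto)
  have "K - Q v \<le> K * (1 - a) powr s"
    by (rule LIMSEQ_le[OF 1 2]) (use Q_le_hom[OF dE] in \<open>auto simp: s_def\<close>)
  moreover have "Q v \<le> K * a powr s" using Q_le_hom[OF vE] by (simp add: a_def s_def)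
  ultimately have "K * 1 \<le> K * (a powr s + (1 - a) powr s)" by (simp add: algebra_simps)
  then have "1 \<le> a powr s + (1 - a) powr s" using K_pos by (simp only: mult_le_cancel_left_pos)
  then have "a = 1" using powr_split_lt_1[of a s] a s by fastforce
  have "Q v = K" using \<open>K - Q v \<le> K * (1 - a) powr s\<close> \<open>Q v \<le> K * a powr s\<close> \<open>a = 1\<close> by simp
  then show thesis using that[OF vE] \<open>a = 1\<close> by (simp add: a_def)
qed

text \<open>Only point masses serve as variations. The operator \<open>T\<close> maps them to
  finitely supported functions, so the constraint varies through the finite sum
  \<open>\<Phi>\<close>, and by \<open>Q_change_point\<close> the energy is an explicit function of
  one value.\<close>

lemma euler_lagrange:
  assumes q: "q > 1" and p: "p > 1" and v: "v \<in> E" "nT v = 1" "Q v = K" and x: "x \<in> V"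
  shows "\<bar>v x\<bar> powr (p - 2) * v x * R v x =
    K * (\<Sum>\<^sub>\<infinity>i\<in>I. \<bar>T v i\<bar> powr (q - 2) * T v i * T (indicator {x}) i)"
proof -
  define \<delta> :: "'a \<Rightarrow> real" where "\<delta> = indicator {x}"
  define J where "J = {i \<in> I. T \<delta> i \<noteq> 0}"
  have J: "finite J" "J \<subseteq> I" using T_fin[OF fin_indicator[of x]] by (auto simp: J_def \<delta>_def)
  define w where "w t y = v y + t * \<delta> y" for t y
  have vr: "v \<in> lp r V" by (rule E_lp_r[OF v(1)])
  have Tv: "T v \<in> lp q I" "v \<in> lp m V" using v(1) by (auto simp: E_def)
  have wm: "w t \<in> lp m V" for t
  proof -
    have "(\<lambda>y. \<bar>v y\<bar> powr m + \<bar>(if y = x then \<bar>w t x\<bar> powr m else 0)\<bar>) summable_on V"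
      by (intro summable_on_add) (use Tv in \<open>auto simp: lp_def intro!: fin_summable[OF fin_indicator[of x]]\<close>)
    then show ?thesis unfolding lp_def mem_Collect_eq
      by (rule summable_on_abs_le) (auto simp: w_def \<delta>_def)
  qed
  define \<Phi> where "\<Phi> t = (\<Sum>i\<in>J. \<bar>T v i + t * T \<delta> i\<bar> powr q)" for t
  have Tw: "T (w t) i = T v i + t * T \<delta> i" if "i \<in> I" for t i
    unfolding w_def using T_lin[OF that] by simp
  have nw: "T (w t) \<in> lp q I" "nT (w t) = 1 - \<Phi> 0 + \<Phi> t" for t
  proof -
    have "(\<lambda>i. T v i + t * T \<delta> i) \<in> lp q I"
      using lp_add(1)[OF Tv(1) lp_cmult(1)[OF T_lp_fin[OF fin_indicator[of x]]] q1(1)] by (simp add: \<delta>_def)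
    then show 1: "T (w t) \<in> lp q I" using lp_cong(1)[of I "T (w t)"] Tw by simp
    have split: "psum q I f = (\<Sum>i\<in>J. \<bar>f i\<bar> powr q) + (\<Sum>\<^sub>\<infinity>i\<in>I - J. \<bar>f i\<bar> powr q)" if "f \<in> lp q I" for f
      using infsum_Un_disjoint[of "\<lambda>i. \<bar>f i\<bar> powr q" J "I - J"] J that
      by (simp add: Un_absorb1 psum_def lp_def summable_on_subset_banach)
    have rest: "(\<Sum>\<^sub>\<infinity>i\<in>I - J. \<bar>T (w t) i\<bar> powr q) = (\<Sum>\<^sub>\<infinity>i\<in>I - J. \<bar>T v i\<bar> powr q)"
      by (rule infsum_cong) (auto simp: Tw J_def)
    have "(\<Sum>i\<in>J. \<bar>T (w t) i\<bar> powr q) = \<Phi> t" unfolding \<Phi>_def using J(2) by (intro sum.cong) (auto simp: Tw)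
    moreover have "(\<Sum>i\<in>J. \<bar>T v i\<bar> powr q) = \<Phi> 0" by (simp add: \<Phi>_def)
    ultimately show "nT (w t) = 1 - \<Phi> 0 + \<Phi> t"
      using split[OF 1] split[OF Tv(1)] rest v(2) by simp
  qed
  have wE: "w t \<in> E" for t using wm nw by (simp add: E_def)
  have Qw: "Q (w t) = K + 2 * ((\<bar>v x + t\<bar> powr p - \<bar>v x\<bar> powr p) * R v x)" for t
    using Q_change_point[OF vr E_lp_r[OF wE[of t]] x] v(3) by (simp add: w_def \<delta>_def pw_def)
  \<comment> \<open>By \<open>Q_le_hom\<close> this deficit is at most 0, with equality at
    \<open>t = 0\<close>; hence neither renormalisation nor a Lagrange multiplier is needed.\<close>
  define F where "F t = K + 2 * ((\<bar>v x + t\<bar> powr p - \<bar>v x\<bar> powr p) * R v x) - K * (1 - \<Phi> 0 + \<Phi> t) powr (2 * p / q)" for t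
  define L where "L = (\<Sum>i\<in>J. \<bar>T v i\<bar> powr (q - 2) * T v i * T \<delta> i)"
  have d\<Phi>: "(\<Phi> has_real_derivative q * L) (at 0)"
  proof -
    have "((\<lambda>t. \<bar>T v i + t * T \<delta> i\<bar> powr q) has_real_derivative
       q * (\<bar>T v i + 0 * T \<delta> i\<bar> powr (q - 2) * (T v i + 0 * T \<delta> i)) * T \<delta> i) (at 0)" for i
      by (rule DERIV_chain2[where f="\<lambda>s. \<bar>s\<bar> powr q" and g="\<lambda>t. T v i + t * T \<delta> i", OF powr_has_derivative[OF q]])
        (auto intro!: derivative_eq_intros)
    then have "(\<Phi> has_real_derivative (\<Sum>i\<in>J. q * (\<bar>T v i + 0 * T \<delta> i\<bar> powr (q - 2) * (T v i + 0 * T \<delta> i)) * T \<delta> i)) (at 0)"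
      unfolding \<Phi>_def[abs_def] by (rule DERIV_sum)
    then show ?thesis by (simp add: L_def sum_distrib_left mult_ac)
  qed
  have dp: "((\<lambda>t. \<bar>v x + t\<bar> powr p) has_real_derivative p * (\<bar>v x\<bar> powr (p - 2) * v x)) (at 0)"
  proof -
    have "((\<lambda>t. \<bar>v x + t\<bar> powr p) has_real_derivative p * (\<bar>v x + 0\<bar> powr (p - 2) * (v x + 0)) * 1) (at 0)"
      by (rule DERIV_chain2[where f="\<lambda>s. \<bar>s\<bar> powr p" and g="\<lambda>t. v x + t", OF powr_has_derivative[OF p]])
        (auto intro!: derivative_eq_intros)
    then show ?thesis by simp
  qed
  have dn: "((\<lambda>t. (1 - \<Phi> 0 + \<Phi> t) powr (2 * p / q)) has_real_derivative (2 * p / q) * (q * L)) (at 0)"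
  proof -
    have "((\<lambda>t. 1 - \<Phi> 0 + \<Phi> t) has_real_derivative q * L) (at 0)"
      using d\<Phi> by (auto intro!: derivative_eq_intros)
    then have "((\<lambda>t. (1 - \<Phi> 0 + \<Phi> t) powr (2 * p / q)) has_real_derivative
       (2 * p / q) * (1 - \<Phi> 0 + \<Phi> 0) powr (2 * p / q - 1) * (q * L)) (at 0)"
      by (intro DERIV_chain2[OF has_real_derivative_powr]) auto
    then show ?thesis by simp
  qed
  have dF: "(F has_real_derivative 2 * (p * (\<bar>v x\<bar> powr (p - 2) * v x) * R v x) - K * ((2 * p / q) * (q * L))) (at 0)"
    using DERIV_diff[OF DERIV_add[OF DERIV_const DERIV_cmult[OF DERIV_cmult_right[OF DERIV_diff[OF dp DERIV_const]]]] DERIV_cmult[OF dn],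
        of K 2 "\<bar>v x\<bar> powr p" "R v x" K] by (simp add: F_def[abs_def])
  have "F t \<le> F 0" for t
  proof -
    have "F t \<le> 0" using Q_le_hom[OF wE[of t]] by (simp add: F_def Qw nw)
    then show ?thesis by (simp add: F_def)
  qed
  then have "2 * (p * (\<bar>v x\<bar> powr (p - 2) * v x) * R v x) - K * ((2 * p / q) * (q * L)) = 0"
    using DERIV_local_max[OF dF, of 1] by simp
  then have "2 * p * (\<bar>v x\<bar> powr (p - 2) * v x * R v x) = 2 * p * (K * L)" using q by (simp add: mult_ac)
  then have "\<bar>v x\<bar> powr (p - 2) * v x * R v x = K * L" using p by simp
  also have "L = (\<Sum>\<^sub>\<infinity>i\<in>I. \<bar>T v i\<bar> powr (q - 2) * T v i * T \<delta> i)"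
  proof -
    have "(\<Sum>\<^sub>\<infinity>i\<in>I. \<bar>T v i\<bar> powr (q - 2) * T v i * T \<delta> i) = (\<Sum>\<^sub>\<infinity>i\<in>J. \<bar>T v i\<bar> powr (q - 2) * T v i * T \<delta> i)"
      by (rule infsum_cong_neutral) (use J in \<open>auto simp: J_def\<close>)
    then show ?thesis using J by (simp add: L_def)
  qed
  finally show ?thesis by (simp add: \<delta>_def)
qed

end

subsection \<open>Superharmonic functions and the second-order Sobolev inequality\<close>

lemma infsum_finite_sum:
  fixes f :: "'i \<Rightarrow> 'j \<Rightarrow> real"
  assumes "finite I" "\<And>i. i \<in> I \<Longrightarrow> f i summable_on A"
  shows "(\<lambda>x. \<Sum>i\<in>I. f i x) summable_on A \<and> (\<Sum>\<^sub>\<infinity>x\<in>A. \<Sum>i\<in>I. f i x) = (\<Sum>i\<in>I. infsum (f i) A)"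
  using assms by (induction I rule: finite_induct) (auto simp: infsum_add summable_on_add)

text \<open>The two-point inequality of Moser's iteration. For fixed \<open>\<lambda>\<close> the difference of the two sides of
  \<open>2 * \<lambda> * (sqrt s / \<sigma>) * (a^\<sigma> - b^\<sigma>) \<le> (a^s - b^s) + \<lambda>^2 * (a - b)\<close> has a derivative in \<open>a\<close> that is a
  square; then optimise \<open>\<lambda>\<close>.\<close>

lemma moser_two_point:
  fixes a b s :: real
  assumes s: "s > 0" and ab: "0 < b" "b \<le> a"
  defines "\<sigma> \<equiv> (s + 1) / 2"
  shows "s / \<sigma>\<^sup>2 * (a powr \<sigma> - b powr \<sigma>)\<^sup>2 \<le> (a - b) * (a powr s - b powr s)"
proof (cases "a = b")
  case False
  then have lt: "b < a" using ab by simp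
  have \<sigma>: "\<sigma> > 0" "2 * (\<sigma> - 1) = s - 1" using s by (auto simp: \<sigma>_def)
  define x where "x = a powr s - b powr s"
  define y where "y = a powr \<sigma> - b powr \<sigma>"
  have x: "x > 0" using lt ab s by (simp add: x_def powr_less_mono2)
  have y: "y > 0" using lt ab \<sigma> by (simp add: y_def powr_less_mono2)
  have key: "2 * l * (sqrt s / \<sigma>) * y \<le> x + l\<^sup>2 * (a - b)" if "l > 0" for l
  proof -
    define F where "F t = (t powr s - b powr s) + l\<^sup>2 * (t - b) - 2 * l * (sqrt s / \<sigma>) * (t powr \<sigma> - b powr \<sigma>)" for t
    have "F b \<le> F a"
    proof (rule DERIV_nonneg_imp_nondecreasing[OF ab(2)])
      fix t assume t: "b \<le> t" "t \<le> a"
      then have t0: "t > 0" using ab by simp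
      have "(F has_real_derivative (s * t powr (s - 1) - 0) + l\<^sup>2 * (1 - 0) - 2 * l * (sqrt s / \<sigma>) * (\<sigma> * t powr (\<sigma> - 1) - 0)) (at t)"
        unfolding F_def[abs_def]
        by (intro DERIV_diff DERIV_add DERIV_cmult has_real_derivative_powr DERIV_ident DERIV_const t0)
      moreover have "(s * t powr (s - 1) - 0) + l\<^sup>2 * (1 - 0) - 2 * l * (sqrt s / \<sigma>) * (\<sigma> * t powr (\<sigma> - 1) - 0) = (l - sqrt s * t powr (\<sigma> - 1))\<^sup>2"
      proof -
        have "t powr (s - 1) = (t powr (\<sigma> - 1))\<^sup>2" using \<sigma>(2) t0 by (simp add: power2_eq_square flip: powr_add)
        then show ?thesis using \<sigma>(1) s by (simp add: power2_diff power_mult_distrib)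
      qed
      ultimately show "\<exists>d. (F has_real_derivative d) (at t) \<and> 0 \<le> d" by (metis zero_le_power2)
    qed
    then show ?thesis by (simp add: F_def x_def y_def)
  qed
  define l where "l = sqrt (x / (a - b))"
  have l: "l > 0" "l\<^sup>2 = x / (a - b)" using x lt by (auto simp: l_def)
  then have lx: "l\<^sup>2 * (a - b) = x" using lt by simp
  have "2 * l * (sqrt s / \<sigma>) * y \<le> 2 * (l\<^sup>2 * (a - b))" using key[OF l(1)] lx by simp
  then have "2 * (l * ((sqrt s / \<sigma>) * y)) \<le> 2 * (l * (l * (a - b)))" by (simp only: power2_eq_square mult_ac)
  then have "l * ((sqrt s / \<sigma>) * y) \<le> l * (l * (a - b))" by (simp only: mult_le_cancel_left_pos zero_less_numeral)
  then have "(sqrt s / \<sigma>) * y \<le> l * (a - b)" using l(1) by (simp only: mult_le_cancel_left_pos)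
  then have "((sqrt s / \<sigma>) * y)\<^sup>2 \<le> (l * (a - b))\<^sup>2" using s \<sigma> y by (intro power_mono) auto
  also have "\<dots> = (a - b) * (l\<^sup>2 * (a - b))" by (simp add: power2_eq_square mult_ac)
  finally show ?thesis using s by (simp add: lx x_def y_def power_mult_distrib power_divide)
qed simp

context cayley
begin

section \<open>The Sobolev inequality for the Laplacian\<close>

lemma laplacian_uminus: "laplacian G S (\<lambda>x. - u x) x = - laplacian G S u x"
  using laplacian_linear[of "- 1" u 0 u x] by simp

text \<open>The test function is the power \<open>s\<close> of the positive part, truncated below at
  \<open>d\<close> to have finite support. The Moser inequality turns the pairing into the gradient
  energy of the power \<open>\<sigma>\<close>, to which the gradient Sobolev inequality with
  exponent 2 applies; \<open>d\<close> tends to 0 by Fatou's lemma.\<close>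

lemma sobolev_laplacian_pos:
  fixes q :: real
  assumes q: "1 < q" "2 * q < N"
  defines "m \<equiv> N * q / (N - 2 * q)"
  obtains C where "C \<ge> 0" "\<And>u. u \<in> lp m V \<Longrightarrow> laplacian G S u \<in> lp q V \<Longrightarrow>
    psum m V (\<lambda>x. max (u x) 0) \<le> C * psum q V (laplacian G S u) powr (m / q)"
proof -
  have N2: "real N > 2" using N3 by simp
  define M where "M = N * 2 / (real N - 2)"
  have M: "M > 0" "M / 2 = N / (real N - 2)" using N2 by (auto simp: M_def field_simps)
  obtain C1 where C1: "C1 \<ge> 0" "\<And>u. u \<in> lp M V \<Longrightarrow> grad u \<in> lp 2 (V \<times> S) \<Longrightarrow>
    psum M V u \<le> C1 * psum 2 (V \<times> S) (grad u) powr (M / 2)"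
    using sobolev_p[of 2] N2 unfolding M_def by auto
  have Nq: "real N - 2 * q > 0" using q by simp
  have m: "m > 0" using q by (simp add: m_def)
  \<comment> \<open>Fixed by \<open>s * q' = m\<close>, so that Hoelder's inequality returns the
    same power sum \<open>X\<close>; then \<open>\<sigma> * M = m\<close> holds as well.\<close>
  define s where "s = m * (1 - 1 / q)"
  have s: "s > 0" using q m by (simp add: s_def)
  define q' where "q' = q / (q - 1)"
  have q': "q' > 1" "1 / q + 1 / q' = 1" "s * q' = m" using q by (auto simp: q'_def s_def field_simps)
  define \<sigma> where "\<sigma> = (s + 1) / 2"
  have \<sigma>: "\<sigma> > 0" using s by (simp add: \<sigma>_def)
  have \<sigma>M: "\<sigma> * M = m"
  proof -
    have s1: "s + 1 = q * (real N - 2) / (N - 2 * q)" using q Nq by (simp add: s_def m_def field_simps)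
    have "\<sigma> * M = (s + 1) * (M / 2)" by (simp add: \<sigma>_def)
    also have "\<dots> = q * (real N - 2) / (N - 2 * q) * (N / (real N - 2))" by (simp only: s1 M(2))
    also have "\<dots> = m" using N2 by (simp add: m_def)
    finally show ?thesis .
  qed
  define c where "c = s / \<sigma>\<^sup>2"
  have c: "c > 0" using s \<sigma> by (simp add: c_def)
  define C2 where "C2 = C1 * (2 / c) powr (M / 2)"
  \<comment> \<open>The exponent of \<open>X\<close> that remains after its power on the right is
    divided out; it is positive because \<open>2 * q < N\<close>.\<close>
  define e where "e = 1 - (1 - 1 / q) * (M / 2)"
  have e: "e > 0" "M / 2 / q / e = m / q"
  proof -
    have "e = (q * (real N - 2) - (q - 1) * N) / (q * (real N - 2))"
      unfolding e_def M(2) using q N2 by (simp add: field_simps)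
    also have "q * (real N - 2) - (q - 1) * N = N - 2 * q" by (simp add: algebra_simps)
    finally have e: "e = (N - 2 * q) / (q * (real N - 2))" .
    show "e > 0" unfolding e using q N2 by simp
    show "M / 2 / q / e = m / q" unfolding e M(2) m_def using q N2 by simp
  qed
  have "psum m V (\<lambda>x. max (u x) 0) \<le> C2 powr (1 / e) * psum q V (laplacian G S u) powr (m / q)"
    if u: "u \<in> lp m V" "laplacian G S u \<in> lp q V" for u
  proof -
    define X where "X = psum m V (\<lambda>x. max (u x) 0)"
    define Y where "Y = psum q V (laplacian G S u)"
    have up: "(\<lambda>x. max (u x) 0) \<in> lp m V" by (rule lp_mono(1)[OF u(1)]) (use m in auto)
    define \<phi> where "\<phi> x = (max (u x) 0) powr s" for x
    have \<phi>: "\<phi> \<in> lp q' V" "psum q' V \<phi> = X"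
      using up q'(3) by (auto simp: lp_def psum_def X_def \<phi>_def powr_powr)
    note hol = lp_hoelder[OF u(2) \<phi>(1) q(1) q'(1,2)]
    define h where "h n x = max (u x) (1 / real (Suc n)) powr \<sigma> - (1 / real (Suc n)) powr \<sigma>" for n x
    have hb: "psum M V (h n) \<le> C2 * (Y powr (1 / q) * X powr (1 - 1 / q)) powr (M / 2)" "fin (h n)" for n
    proof -
      define d where "d = 1 / real (Suc n)"
      have d: "d > 0" by (simp add: d_def)
      define w where "w x = max (u x) d powr s - d powr s" for x
      have fs: "finite {x \<in> V. d < u x}"
        by (rule finite_subset[OF _ lp_finite_superlevel[OF u(1) d m]]) auto
      have fw: "fin w" by (rule finite_subset[OF _ fs]) (auto simp: w_def max_def split: if_splits)
      have hd: "h n x = max (u x) d powr \<sigma> - d powr \<sigma>" for x by (simp only: h_def d_def)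
      show fh: "fin (h n)" by (rule finite_subset[OF _ fs]) (auto simp: hd max_def split: if_splits)
      have tp: "c * (h n y - h n x)\<^sup>2 \<le> (u y - u x) * (w y - w x)" for x y
      proof -
        have *: "c * (h n y - h n x)\<^sup>2 \<le> (u y - u x) * (w y - w x)" if "u x \<le> u y" for x y
        proof -
          have "c * (h n y - h n x)\<^sup>2 \<le> (max (u y) d - max (u x) d) * (max (u y) d powr s - max (u x) d powr s)"
            using moser_two_point[OF s, of "max (u x) d" "max (u y) d"] d that
            by (simp add: hd c_def \<sigma>_def)
          also have "\<dots> \<le> (u y - u x) * (max (u y) d powr s - max (u x) d powr s)"
            using that d s by (intro mult_right_mono) (auto intro!: powr_mono2)
          finally show ?thesis by (simp add: w_def)
        qed
        show ?thesis
        proof (cases "u x \<le> u y")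
          case False
          then have "c * (h n x - h n y)\<^sup>2 \<le> (u x - u y) * (w x - w y)" by (intro *) simp
          then show ?thesis by (simp add: power2_commute algebra_simps)
        qed (rule *)
      qed
      have "c * psum 2 (V \<times> S) (grad (h n)) = (\<Sum>\<^sub>\<infinity>e\<in>V \<times> S. c * (grad (h n) e)\<^sup>2)"
        by (simp add: psum_def infsum_cmult_right')
      also have "\<dots> \<le> (\<Sum>\<^sub>\<infinity>e\<in>V \<times> S. grad u e * grad w e)"
      proof (rule infsum_mono)
        show "(\<lambda>e. c * (grad (h n) e)\<^sup>2) summable_on V \<times> S"
          using grad_lp_finite[OF fh, of 2] by (intro summable_on_cmult_right) (simp add: lp_def)
        show "(\<lambda>e. grad u e * grad w e) summable_on V \<times> S"
          by (rule div_formula(1)[OF grad_anti fw])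
      qed (use tp in auto)
      also have "\<dots> = 2 * (\<Sum>\<^sub>\<infinity>x\<in>V. - (laplacian G S u x * w x))"
        using green_formula[OF fw, of u] by (simp add: infsum_uminus)
      also have "(\<Sum>\<^sub>\<infinity>x\<in>V. - (laplacian G S u x * w x)) \<le> (\<Sum>\<^sub>\<infinity>x\<in>V. \<bar>laplacian G S u x * \<phi> x\<bar>)"
      proof (rule infsum_mono[OF _ hol(1)])
        show "(\<lambda>x. - (laplacian G S u x * w x)) summable_on V" by (rule fin_summable[OF fw]) simp
        have "\<bar>w x\<bar> \<le> \<bar>\<phi> x\<bar>" for x
          using d s powr_mono2[of s d "u x"] by (auto simp: w_def \<phi>_def max_def)
        then show "- (laplacian G S u x * w x) \<le> \<bar>laplacian G S u x * \<phi> x\<bar>" for x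
          using mult_left_mono[of "\<bar>w x\<bar>" "\<bar>\<phi> x\<bar>" "\<bar>laplacian G S u x\<bar>"] by (simp add: abs_mult[symmetric])
      qed
      also have "(\<Sum>\<^sub>\<infinity>x\<in>V. \<bar>laplacian G S u x * \<phi> x\<bar>) \<le> Y powr (1 / q) * X powr (1 - 1 / q)"
        using hol(2) q'(2) by (simp add: \<phi>(2) Y_def eq_diff_eq[symmetric] add.commute)
      finally have "psum 2 (V \<times> S) (grad (h n)) \<le> (2 / c) * (Y powr (1 / q) * X powr (1 - 1 / q))"
        using c by (simp add: field_simps)
      then have "psum 2 (V \<times> S) (grad (h n)) powr (M / 2) \<le> ((2 / c) * (Y powr (1 / q) * X powr (1 - 1 / q))) powr (M / 2)"
        using M(1) by (intro powr_mono2) auto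
      then have "C1 * psum 2 (V \<times> S) (grad (h n)) powr (M / 2) \<le> C2 * (Y powr (1 / q) * X powr (1 - 1 / q)) powr (M / 2)"
        using mult_left_mono[OF _ C1(1)] by (simp only: C2_def powr_mult mult.assoc)
      then show "psum M V (h n) \<le> C2 * (Y powr (1 / q) * X powr (1 - 1 / q)) powr (M / 2)"
        using C1(2)[OF fin_lp[OF fh] grad_lp_finite[OF fh]] by linarith
    qed
    have "psum M V (\<lambda>x. max (u x) 0 powr \<sigma>) \<le> C2 * (Y powr (1 / q) * X powr (1 - 1 / q)) powr (M / 2)"
    proof (rule lp_fatou(2)[OF fin_lp[OF hb(2)] hb(1) _ M(1)])
      fix x
      have l: "(\<lambda>n. 1 / real (Suc n)) \<longlonglongrightarrow> 0" by (rule LIMSEQ_Suc[OF lim_1_over_n])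
      have "(\<lambda>n. max (u x) (1 / real (Suc n)) powr \<sigma> - (1 / real (Suc n)) powr \<sigma>) \<longlonglongrightarrow> max (u x) 0 powr \<sigma> - 0 powr \<sigma>"
        by (intro tendsto_diff tendsto_powr' tendsto_max l tendsto_const) (use \<sigma> in \<open>auto simp: le_max_iff_disj intro!: always_eventually\<close>)
      then show "(\<lambda>n. h n x) \<longlonglongrightarrow> max (u x) 0 powr \<sigma>" by (simp add: h_def)
    qed
    moreover have "psum M V (\<lambda>x. max (u x) 0 powr \<sigma>) = X" using \<sigma>M by (simp add: psum_def X_def powr_powr)
    ultimately have XY: "X \<le> C2 * Y powr (M / 2 / q) * X powr ((1 - 1 / q) * (M / 2))"
      by (simp add: powr_mult powr_powr mult_ac)
    have C20: "C2 \<ge> 0" using C1 by (simp add: C2_def)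
    have "X \<le> C2 powr (1 / e) * Y powr (m / q)"
    proof (cases "X = 0")
      case False
      then have X: "X > 0" by (metis X_def psum_nonneg order_le_less)
      have "X powr e * X powr ((1 - 1 / q) * (M / 2)) \<le> C2 * Y powr (M / 2 / q) * X powr ((1 - 1 / q) * (M / 2))"
        using XY X by (simp add: e_def flip: powr_add)
      then have "X powr e \<le> C2 * Y powr (M / 2 / q)" using X by simp
      then have "(X powr e) powr (1 / e) \<le> (C2 * Y powr (M / 2 / q)) powr (1 / e)" using e by (intro powr_mono2) auto
      also have "\<dots> = C2 powr (1 / e) * Y powr (M / 2 / q * (1 / e))" by (simp only: powr_mult powr_powr)
      also have "M / 2 / q * (1 / e) = m / q" using e(2) by simp
      finally show ?thesis using X e by (simp add: powr_powr)
    qed simp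
    then show ?thesis by (simp add: X_def Y_def)
  qed
  then show thesis using that[of "C2 powr (1 / e)"] by simp
qed

lemma sobolev_laplacian:
  fixes q :: real
  assumes q: "1 < q" "2 * q < N"
  defines "m \<equiv> N * q / (N - 2 * q)"
  obtains C where "C \<ge> 0" "\<And>u. u \<in> lp m V \<Longrightarrow> laplacian G S u \<in> lp q V \<Longrightarrow>
    psum m V u \<le> C * psum q V (laplacian G S u) powr (m / q)"
proof -
  obtain C where C: "C \<ge> 0" "\<And>u. u \<in> lp m V \<Longrightarrow> laplacian G S u \<in> lp q V \<Longrightarrow>
    psum m V (\<lambda>x. max (u x) 0) \<le> C * psum q V (laplacian G S u) powr (m / q)"
    using sobolev_laplacian_pos[OF q] unfolding m_def by blast
  show thesis
  proof (rule that[of "2 * C"])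
    fix u assume u: "u \<in> lp m V" "laplacian G S u \<in> lp q V"
    have m: "m > 0" using q by (simp add: m_def)
    have mu: "(\<lambda>x. - u x) \<in> lp m V" "laplacian G S (\<lambda>x. - u x) \<in> lp q V"
      "psum q V (laplacian G S (\<lambda>x. - u x)) = psum q V (laplacian G S u)"
      using u by (auto simp: lp_def psum_def laplacian_uminus)
    have l: "(\<lambda>x. max (u x) 0) \<in> lp m V" "(\<lambda>x. max (- u x) 0) \<in> lp m V"
      by (rule lp_mono(1)[OF u(1)], use m in auto)+
    have "psum m V u = (\<Sum>\<^sub>\<infinity>x\<in>V. \<bar>max (u x) 0\<bar> powr m + \<bar>max (- u x) 0\<bar> powr m)"
      unfolding psum_def by (rule infsum_cong) (auto simp: max_def)
    also have "\<dots> = psum m V (\<lambda>x. max (u x) 0) + psum m V (\<lambda>x. max (- u x) 0)"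
      unfolding psum_def by (rule infsum_add) (use l in \<open>auto simp: lp_def\<close>)
    also have "\<dots> \<le> C * psum q V (laplacian G S u) powr (m / q) + C * psum q V (laplacian G S u) powr (m / q)"
      using C(2)[OF u] C(2)[OF mu(1,2)] mu(3) by (intro add_mono) auto
    finally show "psum m V u \<le> 2 * C * psum q V (laplacian G S u) powr (m / q)" by simp
  qed (use C in simp)
qed

section \<open>Minimum principles and potentials\<close>

lemma propagate:
  assumes "\<And>x s. x \<in> V \<Longrightarrow> s \<in> S \<Longrightarrow> P x \<Longrightarrow> P (x \<otimes> s)" "x \<in> V" "P x" "y \<in> V"
  shows "P y"
proof -
  have "P (x \<otimes> (inv x \<otimes> y))"
    by (rule adj_closed[of "\<lambda>z. P (x \<otimes> z)"]) (use assms in \<open>auto simp: m_assoc[symmetric]\<close>)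
  then show ?thesis using assms by (simp add: m_assoc[symmetric])
qed

text \<open>At a minimum all differences to neighbours are nonnegative while their sum is at most 0,
  so the minimum spreads along edges.\<close>

lemma superharmonic_min_const:
  assumes ge: "\<And>x. x \<in> V \<Longrightarrow> \<mu> \<le> z x" and sup: "\<And>x. x \<in> V \<Longrightarrow> laplacian G S z x \<le> 0"
    and x: "x \<in> V" "z x = \<mu>" and y: "y \<in> V"
  shows "z y = \<mu>"
proof (rule propagate[of "\<lambda>x. z x = \<mu>", OF _ x y])
  fix x s assume xs: "x \<in> V" "s \<in> S" "z x = \<mu>"
  have nn: "0 \<le> grad z (x, s)" if "s \<in> S" for s using ge[of "x \<otimes> s"] xs that by simp
  have "(\<Sum>s\<in>S. grad z (x, s)) = 0"
    using sup[OF xs(1)] sum_nonneg[of S "\<lambda>s. grad z (x, s)"] nn xs by (simp add: laplacian_eq del: grad_apply)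
  then have "grad z (x, s) = 0" using nn xs finS by (simp add: sum_nonneg_eq_0_iff del: grad_apply)
  then show "z (x \<otimes> s) = \<mu>" using xs by simp
qed

text \<open>Decay at infinity makes the set of values below a negative one finite, so the minimum is
  attained. The function is then a negative constant, which contradicts decay on an infinite
  group.\<close>

lemma superharmonic_nonneg:
  assumes fin: "\<And>e. e > 0 \<Longrightarrow> finite {x \<in> V. e < \<bar>z x\<bar>}"
    and sup: "\<And>x. x \<in> V \<Longrightarrow> laplacian G S z x \<le> 0" and x: "x \<in> V"
  shows "0 \<le> z x"
proof (rule ccontr)
  assume neg: "\<not> 0 \<le> z x"
  define A where "A = {y \<in> V. z y \<le> z x}"
  have A: "finite A" "A \<noteq> {}" "A \<subseteq> V"
  proof -
    have "A \<subseteq> {y \<in> V. - z x / 2 < \<bar>z y\<bar>}" using neg by (auto simp: A_def)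
    then show "finite A" by (rule finite_subset) (rule fin, use neg in simp)
  qed (use x in \<open>auto simp: A_def\<close>)
  define \<mu> where "\<mu> = Min (z ` A)"
  have "\<mu> \<in> z ` A" using A by (simp add: \<mu>_def)
  then obtain a where a: "a \<in> A" "z a = \<mu>" by auto
  have ge: "\<mu> \<le> z y" if "y \<in> V" for y
  proof (cases "y \<in> A")
    case True then show ?thesis using A by (simp add: \<mu>_def)
  next
    case False
    then have "z x < z y" using that by (simp add: A_def)
    then show ?thesis using a by (simp add: A_def)
  qed
  have const: "z y = \<mu>" if "y \<in> V" for y
    by (rule superharmonic_min_const[OF ge sup _ a(2) that]) (use a A in auto)
  have "\<mu> < 0" using a neg by (auto simp: A_def)
  then have "{y \<in> V. - \<mu> / 2 < \<bar>z y\<bar>} = V" using const by auto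
  then show False using fin[of "- \<mu> / 2"] \<open>\<mu> < 0\<close> V_infinite by simp
qed

lemma superharmonic_pos:
  assumes "\<And>x. x \<in> V \<Longrightarrow> 0 \<le> v x" "\<And>x. x \<in> V \<Longrightarrow> laplacian G S v x \<le> 0" "y \<in> V" "v y \<noteq> 0" "x \<in> V"
  shows "0 < v x"
  using superharmonic_min_const[of 0 v x y] assms by (metis order_le_less)

text \<open>The potentials of finite truncations of \<open>f\<close> have Laplacian bounded by
  \<open>f\<close>, so the Sobolev inequality itself bounds them uniformly; this replaces a
  convolution estimate for the Green function.\<close>

lemma pot_1_potential:
  fixes q :: real
  assumes q: "1 < q" "2 * q < N" and f: "f \<in> lp q V" "\<And>x. x \<in> V \<Longrightarrow> 0 \<le> f x"
  defines "m \<equiv> N * q / (N - 2 * q)"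
  obtains v where "v \<in> lp m V" "\<And>x. x \<in> V \<Longrightarrow> 0 \<le> v x" "\<And>x. x \<in> V \<Longrightarrow> laplacian G S v x = - f x"
proof -
  have N1: "(0::real) < 1" "1 < real N / 2" using N3 by auto
  have m: "m > 0" using q by (simp add: m_def)
  \<comment> \<open>The hypothesis of \<open>pot_lp\<close> for exponent \<open>m\<close>, a
    consequence of \<open>q > 1\<close>: each column of the Green function lies in the space where
    the Sobolev inequality is valid.\<close>
  have mN: "N < m * (real N - 2 * 1)"
  proof -
    have "1 * real N < q * N" using q N3 by (intro mult_strict_right_mono) auto
    then have "real N * (N - 2 * q) < N * q * (real N - 2 * 1)" using N3 by (simp add: algebra_simps)
    then show ?thesis using q by (simp add: m_def field_simps)
  qed
  have pl: "(\<lambda>x. pot 1 x y) \<in> lp m V" if "y \<in> V" for y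
    using pot_lp[OF N1 _ that, of m] mN lp_cong(1)[of V "\<lambda>x. pot 1 x y" "pot 1 y" m] pot_symmetric[of _ y 1] that by simp
  define vF where "vF F x = (\<Sum>y\<in>F. pot 1 x y * f y)" for F x
  obtain C where C: "C \<ge> 0" "\<And>u. u \<in> lp m V \<Longrightarrow> laplacian G S u \<in> lp q V \<Longrightarrow>
    psum m V u \<le> C * psum q V (laplacian G S u) powr (m / q)"
    using sobolev_laplacian[OF q] unfolding m_def by blast
  define M where "M = C * psum q V f powr (m / q)"
  have vF: "vF F \<in> lp m V" "psum m V (vF F) \<le> M" if F: "finite F" "F \<subseteq> V" for F
  proof -
    have m1: "m \<ge> 1"
    proof -
      have "real N - 2 * q \<le> real N * 1" using q by simp
      also have "\<dots> \<le> real N * q" using q by (intro mult_left_mono) auto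
      finally show ?thesis using q by (simp add: m_def)
    qed
    show l: "vF F \<in> lp m V" using F
    proof (induction F rule: finite_induct)
      case empty then show ?case by (simp add: vF_def[abs_def] lp_def)
    next
      case (insert y F)
      have "(\<lambda>x. f y * pot 1 x y + vF F x) \<in> lp m V"
        by (rule lp_add(1)[OF lp_cmult(1)[OF pl]]) (use insert m1 in auto)
      moreover have "(\<lambda>x. f y * pot 1 x y + vF F x) = vF (insert y F)"
        using insert by (auto simp: vF_def mult.commute)
      ultimately show ?case by simp
    qed
    have L: "laplacian G S (vF F) x = - (if x \<in> F then f x else 0)" if "x \<in> V" for x
    proof -
      have "laplacian G S (vF F) x = (\<Sum>y\<in>F. f y * laplacian G S (\<lambda>x. pot 1 x y) x)"
        unfolding laplacian_sum[symmetric] by (simp add: vF_def[abs_def] mult.commute)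
      also have "\<dots> = (\<Sum>y\<in>F. if y = x then - f y else 0)"
        using F that by (intro sum.cong) (auto simp: laplacian_pot_1 indicator_def)
      finally show ?thesis using F by simp
    qed
    have Lq: "laplacian G S (vF F) \<in> lp q V" "psum q V (laplacian G S (vF F)) \<le> psum q V f"
      by (rule lp_mono[OF f(1)]; use q in \<open>simp add: L\<close>)+
    have "psum m V (vF F) \<le> C * psum q V (laplacian G S (vF F)) powr (m / q)" by (rule C(2)[OF l Lq(1)])
    also have "\<dots> \<le> M" unfolding M_def using Lq(2) C(1) m q by (intro mult_left_mono powr_mono2) auto
    finally show "psum m V (vF F) \<le> M" .
  qed
  have pf: "0 \<le> pot 1 x y * f y" if "x \<in> V" "y \<in> V" for x y using pot_nonneg[OF N1 that] f(2)[OF that(2)] by simp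
  have sm: "(\<lambda>y. pot 1 x y * f y) summable_on V" if x: "x \<in> V" for x
  proof (rule nonneg_summable_on_bounded(1)[where M="M powr (1 / m)"])
    fix F assume F: "finite F" "F \<subseteq> V"
    have "\<bar>vF F x\<bar> \<le> psum m V (vF F) powr (1 / m)" by (rule lp_abs_le[OF vF(1)[OF F] x m])
    also have "\<dots> \<le> M powr (1 / m)" using vF(2)[OF F] m by (intro powr_mono2) auto
    finally show "(\<Sum>y\<in>F. pot 1 x y * f y) \<le> M powr (1 / m)" by (simp add: vF_def)
  qed (use pf x in auto)
  define v where "v x = (\<Sum>\<^sub>\<infinity>y\<in>V. pot 1 x y * f y)" for x
  have lim: "((\<lambda>F. vF F x) \<longlongrightarrow> v x) (finite_subsets_at_top V)" if "x \<in> V" for x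
    unfolding vF_def v_def by (rule infsum_tendsto[OF sm[OF that]])
  show thesis
  proof (rule that[of v])
    show "0 \<le> v x" if "x \<in> V" for x unfolding v_def by (rule infsum_nonneg) (use pf that in auto)
    show "v \<in> lp m V"
    proof (rule lp_boundedI(1))
      fix H assume H: "finite H" "H \<subseteq> V"
      have "((\<lambda>F. \<Sum>x\<in>H. \<bar>vF F x\<bar> powr m) \<longlongrightarrow> (\<Sum>x\<in>H. \<bar>v x\<bar> powr m)) (finite_subsets_at_top V)"
        by (intro tendsto_sum tendsto_powr' tendsto_rabs lim) (use H m in auto)
      moreover have "\<forall>\<^sub>F F in finite_subsets_at_top V. (\<Sum>x\<in>H. \<bar>vF F x\<bar> powr m) \<le> M"
        by (rule eventually_finite_subsets_at_top_weakI)
          (use lp_sum_le[OF vF(1) H] vF(2) in \<open>blast intro: order_trans\<close>)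
      ultimately show "(\<Sum>x\<in>H. \<bar>v x\<bar> powr m) \<le> M"
        by (rule tendsto_upperbound) simp
    qed
    show "laplacian G S v x = - f x" if x: "x \<in> V" for x
    proof -
      have "laplacian G S v x = (\<Sum>s\<in>S. \<Sum>\<^sub>\<infinity>y\<in>V. pot 1 (x \<otimes> s) y * f y - pot 1 x y * f y)"
        using x by (simp add: laplacian_eq v_def infsum_diff_real(2)[OF sm sm])
      also have "\<dots> = (\<Sum>\<^sub>\<infinity>y\<in>V. \<Sum>s\<in>S. pot 1 (x \<otimes> s) y * f y - pot 1 x y * f y)"
        by (rule infsum_finite_sum[THEN conjunct2, symmetric]) (use x finS in \<open>auto intro!: infsum_diff_real(1) sm\<close>)
      also have "\<dots> = (\<Sum>\<^sub>\<infinity>y\<in>V. - f x * indicator {x} y)"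
      proof (rule infsum_cong)
        fix y assume y: "y \<in> V"
        have "(\<Sum>s\<in>S. pot 1 (x \<otimes> s) y * f y - pot 1 x y * f y) = laplacian G S (\<lambda>x. pot 1 x y) x * f y"
          using x by (simp add: laplacian_eq sum_distrib_right left_diff_distrib)
        then show "(\<Sum>s\<in>S. pot 1 (x \<otimes> s) y * f y - pot 1 x y * f y) = - f x * indicator {x} y"
          using laplacian_pot_1[OF x y] by (auto simp: indicator_def)
      qed
      also have "\<dots> = - f x" using ip_indicator[OF x, of "\<lambda>_. - f x"] by (simp add: ip_def)
      finally show ?thesis .
    qed
  qed
qed

text \<open>Solving \<open>- \<Delta> v = \<bar>\<Delta> u\<bar>\<close> keeps the norm and increases the energy, which replaces a maximizer by a
  superharmonic one.\<close>

lemma superharmonic_majorant: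
  fixes q :: real
  assumes q: "1 < q" "2 * q < N"
  defines "m \<equiv> N * q / (N - 2 * q)"
  assumes u: "u \<in> lp m V" "laplacian G S u \<in> lp q V"
  obtains v where "v \<in> lp m V" "\<And>x. x \<in> V \<Longrightarrow> \<bar>u x\<bar> \<le> v x" "\<And>x. x \<in> V \<Longrightarrow> laplacian G S v x = - \<bar>laplacian G S u x\<bar>"
proof -
  have m: "m > 0" using q by (simp add: m_def)
  have f: "(\<lambda>x. \<bar>laplacian G S u x\<bar>) \<in> lp q V" using u(2) by (simp add: lp_def)
  obtain v where v: "v \<in> lp m V" "\<And>x. x \<in> V \<Longrightarrow> 0 \<le> v x" "\<And>x. x \<in> V \<Longrightarrow> laplacian G S v x = - \<bar>laplacian G S u x\<bar>"
    using pot_1_potential[OF q f abs_ge_zero, folded m_def] by blast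
  note v = v(1,3)
  have *: "0 \<le> v x + a * u x" if "x \<in> V" "\<bar>a\<bar> = 1" for x a
  proof (rule superharmonic_nonneg[OF _ _ that(1)])
    fix e :: real assume "e > 0"
    have "{x \<in> V. e < \<bar>v x + a * u x\<bar>} \<subseteq> {x \<in> V. e/2 < \<bar>v x\<bar>} \<union> {x \<in> V. e/2 < \<bar>u x\<bar>}"
    proof
      fix x assume x: "x \<in> {x \<in> V. e < \<bar>v x + a * u x\<bar>}"
      have "\<bar>v x + a * u x\<bar> \<le> \<bar>v x\<bar> + \<bar>u x\<bar>" using abs_triangle_ineq[of "v x" "a * u x"] that(2) by (simp add: abs_mult)
      then show "x \<in> {x \<in> V. e/2 < \<bar>v x\<bar>} \<union> {x \<in> V. e/2 < \<bar>u x\<bar>}" using x by auto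
    qed
    then show "finite {x \<in> V. e < \<bar>v x + a * u x\<bar>}"
      by (rule finite_subset) (use lp_finite_superlevel[OF v(1) _ m, of "e/2"] lp_finite_superlevel[OF u(1) _ m, of "e/2"] \<open>e > 0\<close> in auto)
  next
    fix x assume "x \<in> V"
    have "a * laplacian G S u x \<le> \<bar>a * laplacian G S u x\<bar>" by (rule abs_ge_self)
    also have "\<dots> = \<bar>laplacian G S u x\<bar>" using that(2) by (simp add: abs_mult)
    finally have "a * laplacian G S u x \<le> \<bar>laplacian G S u x\<bar>" .
    then show "laplacian G S (\<lambda>x. v x + a * u x) x \<le> 0"
      using laplacian_linear[of 1 v a u x] v(2)[OF \<open>x \<in> V\<close>] by simp
  qed
  have "\<bar>u x\<bar> \<le> v x" if "x \<in> V" for x using *[OF that, of 1] *[OF that, of "- 1"] by (simp add: abs_le_iff)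
  from that[OF v(1) this v(2)] show thesis by simp
qed

end

subsection \<open>The equations for p > 1\<close>

context cayley
begin

definition offdiag_pot :: "real \<Rightarrow> 'a \<Rightarrow> 'a \<Rightarrow> real" where
  "offdiag_pot \<alpha> x y = (if x = y then 0 else pot (\<alpha> / 2) x y)"

text \<open>The upper bound on \<open>r\<close> is equivalent to
  \<open>N < c * (N - \<alpha>)\<close> for the exponent \<open>c\<close> of Young's inequality,
  which is what \<open>pot_lp\<close> asks for.\<close>

lemma choquard_kernel_offdiag_pot:
  fixes \<alpha> p r :: real
  assumes \<alpha>: "0 < \<alpha>" "\<alpha> < N" and p: "1 \<le> p" "p < r" "r < 2 * N * p / (N + \<alpha>)"
  shows "choquard_kernel G S N (offdiag_pot \<alpha>) p r"
proof
  have \<beta>: "0 < \<alpha> / 2" "\<alpha> / 2 < N / 2" using \<alpha> by auto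
  have r2: "r * (N + \<alpha>) < 2 * N * p" using p \<alpha> by (simp add: pos_less_divide_eq)
  show "1 \<le> p" "p < r" by fact+
  \<comment> \<open>Positivity of \<open>\<alpha>\<close> places \<open>r\<close> below
    \<open>2 * p\<close>.\<close>
  have "r * N \<le> r * (N + \<alpha>)" using p \<alpha> by (intro mult_left_mono) auto
  then have "r * N \<le> (2 * p) * N" using r2 by (simp add: mult_ac)
  then show "r \<le> 2 * p" using N3 by simp
  show "0 \<le> offdiag_pot \<alpha> x y" if "x \<in> V" "y \<in> V" for x y using pot_nonneg[OF \<beta> that] by (simp add: offdiag_pot_def)
  show "offdiag_pot \<alpha> x y = offdiag_pot \<alpha> y x" if "x \<in> V" "y \<in> V" for x y using pot_symmetric that by (simp add: offdiag_pot_def)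
  show "offdiag_pot \<alpha> (g \<otimes> x) (g \<otimes> y) = offdiag_pot \<alpha> x y" if "g \<in> V" "x \<in> V" "y \<in> V" for g x y
    using pot_translate[OF that] that by (simp add: offdiag_pot_def)
  show "offdiag_pot \<alpha> x x = 0" for x by (simp add: offdiag_pot_def)
  obtain s where s: "s \<in> S" "s \<noteq> \<one>" using S_nonunit by blast
  then show "\<exists>x\<in>V. \<exists>y\<in>V. 0 < offdiag_pot \<alpha> x y" using pot_edge_pos[OF \<beta> s] by (intro bexI[of _ \<one>] bexI[of _ s]) (auto simp: offdiag_pot_def)
  define c where "c = 1 / (2 * (1 - p / r))"
  have pr: "1 - p / r > 0" using p by simp
  have "N < c * (N - 2 * (\<alpha> / 2))"
  proof -
    have "(1 - p / r) * (2 * real N * r) = 2 * N * r - 2 * N * p" using p by (simp add: field_simps)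
    also have "\<dots> < 2 * N * r - r * (N + \<alpha>)" using r2 by simp
    also have "\<dots> = (N - \<alpha>) * r" by (simp add: algebra_simps)
    finally have "(1 - p / r) * (2 * real N) * r < (N - \<alpha>) * r" by (simp add: mult_ac)
    then have "(1 - p / r) * (2 * real N) < N - \<alpha>" using p by simp
    then have "real N * (2 * (1 - p / r)) < N - \<alpha>" by (simp only: mult_ac)
    moreover have "0 < 2 * (1 - p / r)" using pr by (intro mult_pos_pos) auto
    ultimately have "N < (N - \<alpha>) / (2 * (1 - p / r))" by (simp only: pos_less_divide_eq)
    then show ?thesis by (simp add: c_def)
  qed
  from pot_lp[OF \<beta> this one_closed] have "pot (\<alpha> / 2) \<one> \<in> lp c V" .
  then have "offdiag_pot \<alpha> \<one> \<in> lp c V" by (rule lp_mono(1)) (use pr in \<open>auto simp: offdiag_pot_def c_def\<close>)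
  then show "offdiag_pot \<alpha> \<one> \<in> lp (1 / (2 * (1 - p / r))) V" by (simp add: c_def)
qed

lemma offdiag_pot_green: "0 < (\<alpha>::real) \<Longrightarrow> \<alpha> < N \<Longrightarrow> x \<in> V \<Longrightarrow> y \<in> V \<Longrightarrow> x \<noteq> y \<Longrightarrow> offdiag_pot \<alpha> x y = green G S \<alpha> x y"
  by (simp add: offdiag_pot_def green_eq_pot)

section \<open>Matching the norms of the statement with the variational setting\<close>

lemma lp_space_eq: "lp_space G q = lp q V"
  by (simp add: lp_space_def lp_def)

lemma edge_sum:
  "(\<lambda>x. \<Sum>y\<in>nbrs G S x. \<bar>u y - u x\<bar> powr q) summable_on V \<longleftrightarrow> grad u \<in> lp q (V \<times> S)"
  "grad u \<in> lp q (V \<times> S) \<Longrightarrow> (\<Sum>\<^sub>\<infinity>x\<in>V. \<Sum>y\<in>nbrs G S x. \<bar>u y - u x\<bar> powr q) = psum q (V \<times> S) (grad u)"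
proof -
  have nb: "(\<Sum>y\<in>nbrs G S x. \<bar>u y - u x\<bar> powr q) = (\<Sum>s\<in>S. \<bar>grad u (x, s)\<bar> powr q)" if "x \<in> V" for x
    using that by (simp add: sum_nbrs)
  show "(\<lambda>x. \<Sum>y\<in>nbrs G S x. \<bar>u y - u x\<bar> powr q) summable_on V \<longleftrightarrow> grad u \<in> lp q (V \<times> S)"
  proof
    assume a: "(\<lambda>x. \<Sum>y\<in>nbrs G S x. \<bar>u y - u x\<bar> powr q) summable_on V"
    show "grad u \<in> lp q (V \<times> S)" unfolding lp_def mem_Collect_eq
      by (rule summable_on_SigmaI[OF _ a]) (use finS nb in \<open>auto intro!: has_sum_finiteI\<close>)
  next
    assume "grad u \<in> lp q (V \<times> S)"
    then have s: "(\<lambda>e. \<bar>grad u e\<bar> powr q) summable_on V \<times> S" by (simp add: lp_def)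
    have "(\<lambda>x. \<Sum>s\<in>S. \<bar>grad u (x, s)\<bar> powr q) summable_on V" using summable_on_SigmaD[OF s] finS by simp
    then show "(\<lambda>x. \<Sum>y\<in>nbrs G S x. \<bar>u y - u x\<bar> powr q) summable_on V" using nb by (simp cong: summable_on_cong)
  qed
  assume "grad u \<in> lp q (V \<times> S)"
  then have s: "(\<lambda>e. \<bar>grad u e\<bar> powr q) summable_on V \<times> S" by (simp add: lp_def)
  show "(\<Sum>\<^sub>\<infinity>x\<in>V. \<Sum>y\<in>nbrs G S x. \<bar>u y - u x\<bar> powr q) = psum q (V \<times> S) (grad u)"
    using infsum_Sigma_banach[OF s] finS nb by (simp add: psum_def cong: infsum_cong)
qed

lemma grad_translate_lp:
  assumes "g \<in> V" "grad u \<in> lp q (V \<times> S)"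
  shows "grad (\<lambda>x. u (g \<otimes> x)) \<in> lp q (V \<times> S)" "psum q (V \<times> S) (grad (\<lambda>x. u (g \<otimes> x))) = psum q (V \<times> S) (grad u)"
proof -
  have b: "bij_betw (\<lambda>(x, s). (g \<otimes> x, s)) (V \<times> S) (V \<times> S)"
    by (rule bij_betwI[where g="\<lambda>(x, s). (inv g \<otimes> x, s)"]) (use assms in \<open>auto simp: m_assoc[symmetric]\<close>)
  have e: "grad (\<lambda>x. u (g \<otimes> x)) e = grad u ((\<lambda>(x, s). (g \<otimes> x, s)) e)" if "e \<in> V \<times> S" for e
    using that assms by (auto simp: m_assoc)
  have s: "(\<lambda>e. \<bar>grad u e\<bar> powr q) summable_on V \<times> S" using assms by (simp add: lp_def)
  show "grad (\<lambda>x. u (g \<otimes> x)) \<in> lp q (V \<times> S)" 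
    using summable_on_reindex_bij_betw[OF b, of "\<lambda>e. \<bar>grad u e\<bar> powr q"] s e
    by (simp add: lp_def cong: summable_on_cong)
  show "psum q (V \<times> S) (grad (\<lambda>x. u (g \<otimes> x))) = psum q (V \<times> S) (grad u)"
    using infsum_reindex_bij_betw[OF b, of "\<lambda>e. \<bar>grad u e\<bar> powr q"] e
    by (simp add: psum_def cong: infsum_cong)
qed

lemma variational_D1:
  fixes p r :: real
  assumes ck: "choquard_kernel G S N k p r" and p: "1 \<le> p" "p < N" "N * p / (N - p) < r"
  obtains C where "variational G S N k p r grad (V \<times> S) p (N * p / (N - p)) C"
proof -
  interpret choquard_kernel G S N k p r by (rule ck)
  obtain C where C: "C \<ge> 0" "\<And>u. u \<in> lp (N * p / (N - p)) V \<Longrightarrow> grad u \<in> lp p (V \<times> S) \<Longrightarrow>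
    psum (N * p / (N - p)) V u \<le> C * psum p (V \<times> S) (grad u) powr ((N * p / (N - p)) / p)"
    using sobolev_p[OF p(1,2)] by blast
  have "variational G S N k p r grad (V \<times> S) p (N * p / (N - p)) C"
  proof
    show "1 \<le> p" "p < 2 * p" "N * p / (N - p) < r" "0 < N * p / (N - p)" using p N3 by auto
    show "grad (\<lambda>x. u x + a * v x) e = grad u e + a * grad v e" for u v a e
      by (cases e) (simp add: algebra_simps)
    show "(\<lambda>n. grad (u n) e) \<longlonglongrightarrow> grad w e" if "\<And>x. x \<in> V \<Longrightarrow> (\<lambda>n. u n x) \<longlonglongrightarrow> w x" "e \<in> V \<times> S" for u w e
      using that by (auto intro!: tendsto_intros)
    show "finite {e \<in> V \<times> S. grad u e \<noteq> 0}" if u: "fin u" for u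
    proof -
      obtain E where "finite E" "\<forall>e \<in> V \<times> S - E. grad u e = 0" using grad_finite_support[OF u] by blast
      then show ?thesis by (auto intro: finite_subset[of _ E] simp del: grad_apply)
    qed
  qed (use grad_translate_lp C in auto)
  then show thesis by (rule that)
qed

lemma variational_D2:
  fixes q r :: real
  assumes ck: "choquard_kernel G S N k p r" and q: "1 < q" "2 * q < N" "q < 2 * p" "N * q / (N - 2 * q) < r"
  obtains C where "variational G S N k p r (laplacian G S) V q (N * q / (N - 2 * q)) C"
proof -
  interpret choquard_kernel G S N k p r by (rule ck)
  obtain C where C: "C \<ge> 0" "\<And>u. u \<in> lp (N * q / (N - 2 * q)) V \<Longrightarrow> laplacian G S u \<in> lp q V \<Longrightarrow>
    psum (N * q / (N - 2 * q)) V u \<le> C * psum q V (laplacian G S u) powr ((N * q / (N - 2 * q)) / q)"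
    using sobolev_laplacian[OF q(1,2)] by blast
  have tr: "laplacian G S (\<lambda>x. u (g \<otimes> x)) \<in> lp q V \<longleftrightarrow> laplacian G S u \<in> lp q V"
    "psum q V (laplacian G S (\<lambda>x. u (g \<otimes> x))) = psum q V (laplacian G S u)" if "g \<in> V" for u g
    using lp_translate[where u="laplacian G S u" and q=q, OF that] lp_cong[where A=V and q=q and f="laplacian G S (\<lambda>x. u (g \<otimes> x))" and g="\<lambda>x. laplacian G S u (g \<otimes> x)"]
      laplacian_translate[OF that] by auto
  have "variational G S N k p r (laplacian G S) V q (N * q / (N - 2 * q)) C"
  proof
    show "1 \<le> q" "q < 2 * p" "N * q / (N - 2 * q) < r" "0 < N * q / (N - 2 * q)" using q N3 by auto
    show "laplacian G S (\<lambda>x. u x + a * v x) e = laplacian G S u e + a * laplacian G S v e" for u v a e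
      using laplacian_linear[of 1 u a v] by simp
    show "(\<lambda>n. laplacian G S (u n) e) \<longlonglongrightarrow> laplacian G S w e" if "\<And>x. x \<in> V \<Longrightarrow> (\<lambda>n. u n x) \<longlonglongrightarrow> w x" "e \<in> V" for u w e
      unfolding laplacian_eq[OF that(2)] grad_apply by (intro tendsto_intros that(1)) (use that(2) in auto)
  qed (use tr fin_laplacian C in auto)
  then show thesis by (rule that)
qed

text \<open>The window for \<open>r\<close> lies above \<open>p\<close> too, because
  \<open>\<alpha> < N\<close>.\<close>

lemma ex_exponent:
  fixes m p \<alpha> :: real
  assumes "0 < \<alpha>" "\<alpha> < N" "0 < p" "m < 2 * N * p / (N + \<alpha>)"
  obtains r where "m < r" "p < r" "r < 2 * N * p / (N + \<alpha>)"
proof -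
  have "p * (N + \<alpha>) < 2 * N * p" using assms by (simp add: algebra_simps)
  then have "p < 2 * N * p / (N + \<alpha>)" using assms by (simp add: pos_less_divide_eq)
  then have "max m p < 2 * N * p / (N + \<alpha>)" using assms by simp
  from dense[OF this] show thesis using that by auto
qed

end

locale green_variational = variational +
  fixes \<alpha> :: real
  assumes k_green: "\<And>x y. x \<in> V \<Longrightarrow> y \<in> V \<Longrightarrow> x \<noteq> y \<Longrightarrow> k x y = green G S \<alpha> x y"
begin

text \<open>The factor \<open>a\<close> accommodates the rescaled solution, whose power is a
  multiple of that of the maximizer.\<close>

lemma green_conv_eq:
  assumes f: "\<And>y. y \<in> V \<Longrightarrow> f y = a * pw u y" and u: "u \<in> lp r V"
  shows "green_conv_defined G S \<alpha> f" "x \<in> V \<Longrightarrow> green_conv G S \<alpha> f x = a * R u x"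
proof -
  have s: "(\<lambda>y. green G S \<alpha> x y * f y) summable_on V - {x}"
    "(\<Sum>\<^sub>\<infinity>y\<in>V - {x}. green G S \<alpha> x y * f y) = a * R u x" if x: "x \<in> V" for x
  proof -
    have "(\<lambda>y. a * (k x y * pw u y)) summable_on V" by (intro summable_on_cmult_right R_summable u x)
    moreover have "(\<lambda>y. a * (k x y * pw u y)) summable_on V \<longleftrightarrow> (\<lambda>y. green G S \<alpha> x y * f y) summable_on V - {x}"
      by (rule summable_on_cong_neutral) (use f k_diag k_green x in auto)
    ultimately show "(\<lambda>y. green G S \<alpha> x y * f y) summable_on V - {x}" by simp
    have "(\<Sum>\<^sub>\<infinity>y\<in>V. a * (k x y * pw u y)) = (\<Sum>\<^sub>\<infinity>y\<in>V - {x}. green G S \<alpha> x y * f y)"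
      by (rule infsum_cong_neutral) (use f k_diag k_green x in auto)
    then show "(\<Sum>\<^sub>\<infinity>y\<in>V - {x}. green G S \<alpha> x y * f y) = a * R u x" by (simp add: R_def infsum_cmult_right')
  qed
  show "green_conv_defined G S \<alpha> f" using s by (simp add: green_conv_defined_def)
  show "x \<in> V \<Longrightarrow> green_conv G S \<alpha> f x = a * R u x" using s by (simp add: green_conv_def)
qed

lemma choquard_Q:
  assumes "u \<in> lp r V"
  shows "choquard_finite G S \<alpha> p u" "choquard G S \<alpha> p u = Q u"
proof -
  note g = green_conv_eq[of "\<lambda>y. \<bar>u y\<bar> powr p" 1 u, OF _ assms]
  have e: "green_conv G S \<alpha> (\<lambda>y. \<bar>u y\<bar> powr p) x * \<bar>u x\<bar> powr p = R u x * pw u x" if "x \<in> V" for x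
    using g(2)[OF _ that] by (simp add: pw_def)
  show "choquard_finite G S \<alpha> p u" unfolding choquard_finite_def
  proof
    have "(\<lambda>x. green_conv G S \<alpha> (\<lambda>y. \<bar>u y\<bar> powr p) x * \<bar>u x\<bar> powr p) summable_on V \<longleftrightarrow> (\<lambda>x. R u x * pw u x) summable_on V"
      by (rule summable_on_cong) (rule e)
    then show "(\<lambda>x. green_conv G S \<alpha> (\<lambda>y. \<bar>u y\<bar> powr p) x * \<bar>u x\<bar> powr p) summable_on V"
      using Q_iterated(1)[OF assms] by simp
  qed (use g(1) in \<open>simp add: pw_def\<close>)
  show "choquard G S \<alpha> p u = Q u" unfolding choquard_def
    using Q_iterated(2)[OF assms] infsum_cong[OF e] by simp
qed

lemma choquard_maximizerI:
  assumes E': "E' = E" "\<And>u. u \<in> E \<Longrightarrow> nrm u = nT u powr (1 / q)" and v: "v \<in> E" "nT v = 1" "Q v = K"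
  shows "choquard_maximizer G S \<alpha> p E' nrm v"
  unfolding choquard_maximizer_def
proof (intro conjI ballI impI)
  show "v \<in> E'" "nrm v = 1" using assms by auto
  fix w assume w: "w \<in> E'" "nrm w = 1"
  then have "nT w powr (1 / q) = 1" using E' by auto
  then have "(nT w powr (1 / q)) powr q = 1" by simp
  then have "nT w = 1" using q1 by (simp add: powr_powr)
  then have "Q w \<le> Q v" using Q_le_K[of w] w E' v(3) by simp
  then show "choquard G S \<alpha> p w \<le> choquard G S \<alpha> p v" "choquard_finite G S \<alpha> p w"
    using choquard_Q E_lp_r w E' v by auto
qed

text \<open>A competitor with no larger norm and no smaller energy gives equality in
  \<open>Q_le_hom\<close>. It is applied to \<open>\<bar>v\<bar>\<close> and to the superharmonic
  majorant.\<close>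

lemma maximizer_improve:
  assumes "w \<in> E" "nT w \<le> 1" "K \<le> Q w"
  shows "nT w = 1" "Q w = K"
proof -
  have "K * 1 \<le> K * nT w powr (2 * p / q)" using Q_le_hom[OF assms(1)] assms(3) by simp
  then have "1 \<le> nT w powr (2 * p / q)" using K_pos by (simp only: mult_le_cancel_left_pos)
  moreover have "nT w powr (2 * p / q) < 1" if "nT w < 1"
    using powr_less_mono2[of "2 * p / q" "nT w" 1] that q1 exps by simp
  ultimately show n: "nT w = 1" using assms(2) by fastforce
  show "Q w = K" using Q_le_K[OF assms(1) n] assms(3) by simp
qed

end

context cayley
begin

theorem p_laplace_ground_state:
  fixes \<alpha> p :: real
  assumes \<alpha>: "0 < \<alpha>" "\<alpha> < real N - 2" and p: "1 < p" "p < (real N - \<alpha>) / 2"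
  shows "\<exists>u. (\<forall>x\<in>V. u x > 0) \<and> ground_state G S \<alpha> p (D1_space G S N p) (D1_norm G S p) u \<and> solves_p_laplace G S \<alpha> p u"
proof -
  have \<alpha>N: "\<alpha> < N" and pN: "p < N" using \<alpha> p by auto
  define m where "m = N * p / (N - p)"
  have "m < 2 * N * p / (N + \<alpha>)"
  proof -
    have "m < N * p / ((N + \<alpha>) / 2)" unfolding m_def
      by (rule divide_strict_left_mono) (use p \<alpha> pN N3 in \<open>auto intro!: mult_pos_pos\<close>)
    then show ?thesis by (simp add: mult_ac)
  qed
  then obtain r where r: "m < r" "p < r" "r < 2 * N * p / (N + \<alpha>)"
    using ex_exponent[OF \<alpha>(1) \<alpha>N, of p m] p by auto
  have ck: "choquard_kernel G S N (offdiag_pot \<alpha>) p r" by (rule choquard_kernel_offdiag_pot) (use \<alpha> \<alpha>N p r in auto)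
  obtain C where var: "variational G S N (offdiag_pot \<alpha>) p r grad (V \<times> S) p m C"
    using variational_D1[OF ck] p pN r unfolding m_def by auto
  interpret variational G S N "offdiag_pot \<alpha>" p r grad "V \<times> S" p m C by (rule var)
  interpret green_variational G S N "offdiag_pot \<alpha>" p r grad "V \<times> S" p m C \<alpha>
    by unfold_locales (rule offdiag_pot_green[OF \<alpha>(1) \<alpha>N])
  obtain v where v: "v \<in> E" "nT v = 1" "Q v = K" by (rule maximizer_exists)
  define w where "w x = \<bar>v x\<bar>" for x
  have gw: "grad w \<in> lp p (V \<times> S)" "nT w \<le> nT v"
    by (rule lp_mono[of "grad v"]; use v p in \<open>auto simp: E_def w_def\<close>)+
  have wm: "w \<in> lp m V" using v(1) by (simp add: E_def w_def lp_def)
  have w: "w \<in> E" using gw wm by (simp add: E_def)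
  have "Q w = Q v" by (simp add: B_def pw_def[abs_def] w_def)
  then have wK: "nT w = 1" "Q w = K" using maximizer_improve[OF w] gw(2) v by auto
  have w0: "w x \<ge> 0" for x by (simp add: w_def)
  define g where "g e = \<bar>grad w e\<bar> powr (p - 2) * grad w e" for e
  \<comment> \<open>The factor 2 arises because the edge sum contains both orientations.\<close>
  have el: "w x powr (p - 1) * R w x = - 2 * K * p_laplacian G S p w x" if x: "x \<in> V" for x
  proof -
    have anti: "g (x \<otimes> s, inv s) = - g (x, s)" if "x \<in> V" "s \<in> S" for x s
      using that by (simp add: g_def m_assoc abs_minus_commute algebra_simps)
    have "(\<Sum>\<^sub>\<infinity>e\<in>V \<times> S. g e * grad (indicator {x}) e) = - 2 * (\<Sum>\<^sub>\<infinity>y\<in>V. (\<Sum>s\<in>S. g (y, s)) * indicator {x} y)"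
      by (rule div_formula(2)[OF anti fin_indicator])
    also have "(\<Sum>\<^sub>\<infinity>y\<in>V. (\<Sum>s\<in>S. g (y, s)) * indicator {x} y) = (\<Sum>s\<in>S. g (x, s))"
      using ip_indicator[OF x, of "\<lambda>y. \<Sum>s\<in>S. g (y, s)"] by (simp add: ip_def)
    also have "(\<Sum>s\<in>S. g (x, s)) = p_laplacian G S p w x" using x by (simp add: p_laplacian_def sum_nbrs g_def)
    finally have "\<bar>w x\<bar> powr (p - 2) * w x * R w x = K * (- 2 * p_laplacian G S p w x)"
      using euler_lagrange[OF p(1) p(1) w wK x] by (simp add: g_def mult.assoc)
    moreover have "\<bar>w x\<bar> powr (p - 2) * w x = w x powr (p - 1)"
      using powr_mult_base[of "w x" "p - 2"] w0[of x] by (simp add: mult.commute)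
    ultimately show ?thesis by simp
  qed
  have pos: "w x > 0" if x: "x \<in> V" for x
  proof (rule ccontr)
    assume "\<not> w x > 0"
    then have wx: "w x = 0" using w0[of x] by simp
    have "w y = 0" if "y \<in> V" for y
    proof (rule propagate[of "\<lambda>x. w x = 0", OF _ x wx that])
      fix z s assume z: "z \<in> V" "s \<in> S" "w z = 0"
      have "p_laplacian G S p w z = 0" using el[OF z(1)] z(3) K_pos by simp
      \<comment> \<open>At a zero of \<open>w\<close> the p-Laplacian is a sum of nonnegative powers
        of the neighbouring values, so zeros spread to the whole group.\<close>
      then have "(\<Sum>s\<in>S. w (z \<otimes> s) powr (p - 2) * w (z \<otimes> s)) = 0"
        using z w0 by (simp add: p_laplacian_def sum_nbrs)
      then have "w (z \<otimes> s) powr (p - 2) * w (z \<otimes> s) = 0"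
        using z w0 finS by (subst (asm) sum_nonneg_eq_0_iff) auto
      then show "w (z \<otimes> s) = 0" by auto
    qed
    then show False using Q_zero[of w] wK K_pos by simp
  qed
  \<comment> \<open>Under \<open>u = c * w\<close> the p-Laplacian scales by
    \<open>c powr (p - 1)\<close> and the nonlocal term by \<open>c powr (2 * p - 1)\<close>;
    equating both fixes \<open>c powr p\<close>.\<close>
  define c where "c = (1 / (2 * K)) powr (1 / p)"
  have c: "c > 0" "c powr p = 1 / (2 * K)" using K_pos p by (auto simp: c_def powr_powr)
  define u where "u x = c * w x" for x
  have mx: "choquard_maximizer G S \<alpha> p (D1_space G S N p) (D1_norm G S p) w"
  proof (rule choquard_maximizerI[OF _ _ w wK])
    show "D1_space G S N p = E" by (auto simp: D1_space_def E_def lp_space_eq edge_sum m_def[symmetric])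
    show "D1_norm G S p u = nT u powr (1 / p)" if "u \<in> E" for u
      using that by (simp add: D1_norm_def E_def edge_sum)
  qed
  have up: "u y powr p = c powr p * pw w y" for y using w0[of y] by (simp add: u_def pw_def powr_mult)
  have wr: "w \<in> lp r V" by (rule E_lp_r[OF w])
  have "solves_p_laplace G S \<alpha> p u" unfolding solves_p_laplace_def
  proof (intro conjI ballI)
    show "green_conv_defined G S \<alpha> (\<lambda>y. u y powr p)" by (rule green_conv_eq(1)[OF up wr])
    fix x assume x: "x \<in> V"
    have "p_laplacian G S p u x = c powr (p - 2) * c * p_laplacian G S p w x"
    proof -
      have "u y - u x = c * (w y - w x)" for y by (simp add: u_def algebra_simps)
      then show ?thesis using c by (simp add: p_laplacian_def abs_mult powr_mult sum_distrib_left mult_ac)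
    qed
    also have "c powr (p - 2) * c = c powr (p - 1)" using powr_mult_base[of c "p - 2"] c by (simp add: mult.commute)
    finally have pl: "p_laplacian G S p u x = c powr (p - 1) * p_laplacian G S p w x" .
    have ux: "u x powr (p - 1) = c powr (p - 1) * w x powr (p - 1)" by (simp add: u_def powr_mult)
    have "p_laplacian G S p u x + green_conv G S \<alpha> (\<lambda>y. u y powr p) x * u x powr (p - 1)
       = c powr (p - 1) * (p_laplacian G S p w x + 1 / (2 * K) * (w x powr (p - 1) * R w x))"
      unfolding pl ux green_conv_eq(2)[OF up wr x] c(2) by (simp only: distrib_left mult_ac)
    also have "\<dots> = 0" using el[OF x] K_pos by simp
    finally show "p_laplacian G S p u x + green_conv G S \<alpha> (\<lambda>y. u y powr p) x * u x powr (p - 1) = 0" .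
  qed
  moreover have "ground_state G S \<alpha> p (D1_space G S N p) (D1_norm G S p) u"
    unfolding ground_state_def using mx c(1) by (intro exI[of _ c] conjI exI[of _ w]) (auto simp: u_def)
  ultimately show ?thesis using pos c by (intro exI[of _ u]) (auto simp: u_def)
qed

text \<open>The exponent \<open>q\<close> of the operator is kept apart from the exponent
  \<open>p\<close> of the nonlinearity: \<open>q = 2\<close> is the second equation,
  \<open>q = p\<close> the third.\<close>

theorem p_biharmonic_ground_state:
  fixes \<alpha> p q :: real
  assumes \<alpha>: "0 < \<alpha>" "\<alpha> < N" and p: "1 < p" and q: "1 < q" "2 * q < N" "q < 2 * p"
    and crit: "N * q / (N - 2 * q) < 2 * N * p / (N + \<alpha>)"
  shows "\<exists>u. (\<forall>x\<in>V. u x > 0) \<and> ground_state G S \<alpha> p (D2_space G S N q) (D2_norm G S q) u \<and>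
    green_conv_defined G S \<alpha> (\<lambda>y. u y powr p) \<and>
    (\<forall>x\<in>V. laplacian G S (\<lambda>z. \<bar>laplacian G S u z\<bar> powr (q - 2) * laplacian G S u z) x
          - green_conv G S \<alpha> (\<lambda>y. u y powr p) x * u x powr (p - 1) = 0)"
proof -
  define m where "m = N * q / (N - 2 * q)"
  obtain r where r: "m < r" "p < r" "r < 2 * N * p / (N + \<alpha>)"
    using ex_exponent[OF \<alpha>, of p m] p crit unfolding m_def by auto
  have ck: "choquard_kernel G S N (offdiag_pot \<alpha>) p r" by (rule choquard_kernel_offdiag_pot) (use \<alpha> p r in auto)
  obtain C where var: "variational G S N (offdiag_pot \<alpha>) p r (laplacian G S) V q m C"
    using variational_D2[OF ck q] r unfolding m_def by auto
  interpret variational G S N "offdiag_pot \<alpha>" p r "laplacian G S" V q m C by (rule var)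
  interpret green_variational G S N "offdiag_pot \<alpha>" p r "laplacian G S" V q m C \<alpha>
    by unfold_locales (rule offdiag_pot_green[OF \<alpha>])
  obtain v where v: "v \<in> E" "nT v = 1" "Q v = K" by (rule maximizer_exists)
  have vm: "v \<in> lp m V" "laplacian G S v \<in> lp q V" using v(1) by (auto simp: E_def)
  obtain w where w: "w \<in> lp m V" "\<And>x. x \<in> V \<Longrightarrow> \<bar>v x\<bar> \<le> w x"
    "\<And>x. x \<in> V \<Longrightarrow> laplacian G S w x = - \<bar>laplacian G S v x\<bar>"
    using superharmonic_majorant[OF q(1,2), folded m_def, OF vm] by blast
  have w0: "w x \<ge> 0" if "x \<in> V" for x using w(2)[OF that] by linarith
  have Lw: "laplacian G S w \<in> lp q V" "nT w \<le> nT v"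
    by (rule lp_mono[OF vm(2)]; use w(3) q in simp)+
  have wE: "w \<in> E" using w(1) Lw by (simp add: E_def)
  have wr: "w \<in> lp r V" by (rule E_lp_r[OF wE])
  have "Q v \<le> Q w" by (rule Q_mono[OF wr]) (use w(2) in force)
  then have wK: "nT w = 1" "Q w = K" using maximizer_improve[OF wE] Lw(2) v by auto
  define F where "F u = (\<lambda>z. \<bar>laplacian G S u z\<bar> powr (q - 2) * laplacian G S u z)" for u
  have el: "w x powr (p - 1) * R w x = K * laplacian G S (F w) x" if x: "x \<in> V" for x
  proof -
    have "(\<Sum>\<^sub>\<infinity>y\<in>V. F w y * laplacian G S (indicator {x}) y) = (\<Sum>\<^sub>\<infinity>y\<in>V. laplacian G S (F w) y * indicator {x} y)"
      by (rule laplacian_symmetric[OF fin_indicator])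
    also have "\<dots> = laplacian G S (F w) x" using ip_indicator[OF x] by (simp add: ip_def)
    finally have "\<bar>w x\<bar> powr (p - 2) * w x * R w x = K * laplacian G S (F w) x"
      using euler_lagrange[OF q(1) p wE wK x] by (simp add: F_def mult.assoc)
    moreover have "\<bar>w x\<bar> powr (p - 2) * w x = w x powr (p - 1)"
      using powr_mult_base[of "w x" "p - 2"] w0[OF x] by (simp add: mult.commute)
    ultimately show ?thesis by simp
  qed
  have pos: "w x > 0" if x: "x \<in> V" for x
  proof -
    obtain y where "y \<in> V" "w y \<noteq> 0" using Q_zero[of w] wK K_pos by (metis less_irrefl)
    then show ?thesis using superharmonic_pos[of w y x] w0 w(3) x by simp
  qed
  \<comment> \<open>The operator scales by \<open>c powr (q - 1)\<close>, the nonlocal term by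
    \<open>c powr (2 * p - 1)\<close>.\<close>
  define c where "c = (1 / K) powr (1 / (2 * p - q))"
  have c: "c > 0" "c powr (2 * p - q) = 1 / K" using K_pos q by (auto simp: c_def powr_powr)
  define u where "u x = c * w x" for x
  have mx: "choquard_maximizer G S \<alpha> p (D2_space G S N q) (D2_norm G S q) w"
  proof (rule choquard_maximizerI[OF _ _ wE wK])
    show "D2_space G S N q = E" by (auto simp: D2_space_def E_def lp_space_eq m_def[symmetric])
    show "D2_norm G S q u = nT u powr (1 / q)" for u
      by (simp add: D2_norm_def lp_norm_def psum_def)
  qed
  have up: "u y powr p = c powr p * pw w y" if "y \<in> V" for y
    using w0[OF that] by (simp add: u_def pw_def powr_mult)
  have "laplacian G S (F u) x - green_conv G S \<alpha> (\<lambda>y. u y powr p) x * u x powr (p - 1) = 0" if x: "x \<in> V" for x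
  proof -
    have Lu: "laplacian G S u z = c * laplacian G S w z" for z
      using laplacian_linear[of c w 0 w z] by (simp add: u_def[abs_def])
    have "F u z = c powr (q - 1) * F w z" for z
    proof -
      have "F u z = (c powr (q - 2) * c) * F w z" using c(1) by (simp add: F_def Lu abs_mult powr_mult)
      also have "c powr (q - 2) * c = c powr (q - 1)" using powr_mult_base[of c "q - 2"] c by (simp add: mult.commute)
      finally show ?thesis .
    qed
    then have "F u = (\<lambda>z. c powr (q - 1) * F w z)" by (rule ext)
    then have "laplacian G S (F u) x = c powr (q - 1) * laplacian G S (F w) x"
      using laplacian_linear[of "c powr (q - 1)" "F w" 0 "F w" x] by simp
    also have "laplacian G S (F w) x = c powr (2 * p - q) * (w x powr (p - 1) * R w x)"
      using el[OF x] K_pos c(2) by (simp add: field_simps)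
    also have "c powr (q - 1) * (c powr (2 * p - q) * (w x powr (p - 1) * R w x)) =
       (c powr p * R w x) * (c powr (p - 1) * w x powr (p - 1))"
    proof -
      have "c powr (q - 1) * c powr (2 * p - q) = c powr p * c powr (p - 1)" by (simp flip: powr_add)
      then show ?thesis by (simp add: mult_ac)
    qed
    finally have "laplacian G S (F u) x = (c powr p * R w x) * (c powr (p - 1) * w x powr (p - 1))" .
    moreover have "u x powr (p - 1) = c powr (p - 1) * w x powr (p - 1)" by (simp add: u_def powr_mult)
    ultimately show ?thesis using green_conv_eq(2)[OF up wr x] by (simp only: diff_self)
  qed
  moreover have "green_conv_defined G S \<alpha> (\<lambda>y. u y powr p)" by (rule green_conv_eq(1)[OF up wr])
  moreover have "ground_state G S \<alpha> p (D2_space G S N q) (D2_norm G S q) u"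
    unfolding ground_state_def using mx c(1) by (intro exI[of _ c] conjI exI[of _ w]) (auto simp: u_def)
  ultimately show ?thesis using pos c by (intro exI[of _ u]) (auto simp: u_def F_def)
qed

end

subsection \<open>The case p = 1\<close>

lemma closed_Sgn: "closed (Sgn t)"
  by (simp add: Sgn_def)

text \<open>Compares first-order coefficients after an inequality between expansions has been
  divided by \<open>t\<close>.\<close>

lemma affine_small_le:
  fixes A B C D t0 :: real
  assumes "t0 > 0" "\<And>t. 0 < t \<Longrightarrow> t \<le> t0 \<Longrightarrow> A + t * B \<le> C + t * D"
  shows "A \<le> C"
proof (rule tendsto_le)
  show "((\<lambda>t. A + t * B) \<longlongrightarrow> A) (at_right 0)" "((\<lambda>t. C + t * D) \<longlongrightarrow> C) (at_right 0)"
    by (auto intro!: tendsto_eq_intros)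
  show "\<forall>\<^sub>F t in at_right 0. A + t * B \<le> C + t * D"
    using eventually_at_right_real[OF assms(1)] by eventually_elim (use assms(2) in auto)
qed simp

context cayley
begin

text \<open>The antisymmetric selections of \<open>laplacian_1\<close>, carried by oriented edges:
  subgradients of the total variation at \<open>w\<close>.\<close>

definition subgrad :: "('a \<Rightarrow> real) \<Rightarrow> ('a \<times> 'a \<Rightarrow> real) \<Rightarrow> bool" where
  "subgrad w g \<longleftrightarrow> (\<forall>x\<in>V. \<forall>s\<in>S. g (x \<otimes> s, inv s) = - g (x, s) \<and> g (x, s) \<in> Sgn (grad w (x, s)))"

definition diverg :: "('a \<times> 'a \<Rightarrow> real) \<Rightarrow> 'a \<Rightarrow> real" where
  "diverg g x = (\<Sum>s\<in>S. g (x, s))"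

text \<open>\<open>dderiv a b\<close> is the right derivative of \<open>\<bar>a + t * b\<bar>\<close> at \<open>t = 0\<close>.\<close>

definition dderiv :: "real \<Rightarrow> real \<Rightarrow> real" where
  "dderiv a b = (if a = 0 then \<bar>b\<bar> else sgn a * b)"

text \<open>The values lie in \<open>{-1..1}\<close> on a countable edge set, and antisymmetry and
  the sign condition survive pointwise limits.\<close>

lemma subgrad_compact:
  assumes "\<And>n. subgrad w (g n)"
  obtains j h where "strict_mono (j :: nat \<Rightarrow> nat)" "subgrad w h" "\<And>x s. x \<in> V \<Longrightarrow> s \<in> S \<Longrightarrow> (\<lambda>n. g (j n) (x, s)) \<longlonglongrightarrow> h (x, s)"
proof -
  have bd: "norm (g n e) \<le> 1" if "e \<in> V \<times> S" for n e
    using assms[of n] that by (force simp: subgrad_def Sgn_def split: if_splits)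
  have ct: "countable (V \<times> S)" using V_countable finS by (simp add: countable_finite)
  obtain j where j: "strict_mono j" "\<And>e. e \<in> V \<times> S \<Longrightarrow> \<exists>l. (\<lambda>n. g (j n) e) \<longlonglongrightarrow> l"
    using function_convergent_subsequence[of "V \<times> S" g, OF ct bd] by blast
  then obtain h where h: "\<And>e. e \<in> V \<times> S \<Longrightarrow> (\<lambda>n. g (j n) e) \<longlonglongrightarrow> h e" by metis
  have "subgrad w h" unfolding subgrad_def
  proof (intro ballI conjI)
    fix x s assume xs: "x \<in> V" "s \<in> S"
    have l: "(\<lambda>n. g (j n) (x, s)) \<longlonglongrightarrow> h (x, s)" using h xs by simp
    have "(\<lambda>n. g (j n) (x \<otimes> s, inv s)) \<longlonglongrightarrow> h (x \<otimes> s, inv s)" using h xs by simp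
    moreover have "g (j n) (x \<otimes> s, inv s) = - g (j n) (x, s)" for n using assms xs by (simp add: subgrad_def)
    ultimately have "(\<lambda>n. - g (j n) (x, s)) \<longlonglongrightarrow> h (x \<otimes> s, inv s)" by simp
    then show "h (x \<otimes> s, inv s) = - h (x, s)" using tendsto_minus[OF l] by (rule LIMSEQ_unique)
    show "h (x, s) \<in> Sgn (grad w (x, s))"
      by (rule closed_sequentially[OF closed_Sgn _ l]) (use assms xs in \<open>simp add: subgrad_def\<close>)
  qed
  then show thesis using that[OF j(1)] h by simp
qed

text \<open>Least squares over the compact convex set of subgradients: at the minimiser the residual itself,
  used as a test function, shows that the residual vanishes.\<close>

lemma subgrad_solve_finite:
  assumes ineq: "\<And>\<phi>. fin \<phi> \<Longrightarrow> 2 * (\<Sum>\<^sub>\<infinity>x\<in>V. b x * \<phi> x) \<le> (\<Sum>\<^sub>\<infinity>e\<in>V \<times> S. dderiv (grad w e) (grad \<phi> e))"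
    and F: "finite F" "F \<subseteq> V"
  shows "\<exists>g. subgrad w g \<and> (\<forall>x\<in>F. diverg g x = - b x)"
proof -
  define ob where "ob g = (\<Sum>x\<in>F. (diverg g x + b x)\<^sup>2)" for g
  \<comment> \<open>The extreme selection for direction \<open>\<phi>\<close>: on edges where
    \<open>w\<close> is constant it takes the sign of \<open>grad \<phi>\<close>, so that its
    pairing with \<open>grad \<phi>\<close> attains \<open>dderiv\<close>.\<close>
  define sg where "sg \<phi> e = (if grad w e = 0 then sgn (grad \<phi> e) else sgn (grad w e))" for \<phi> e
  have sg: "subgrad w (sg \<phi>)" for \<phi>
    unfolding subgrad_def
  proof (intro ballI conjI)
    fix x s assume xs: "x \<in> V" "s \<in> S"
    have "grad u (x \<otimes> s, inv s) = - grad u (x, s)" for u by (rule grad_anti[OF xs])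
    then show "sg \<phi> (x \<otimes> s, inv s) = - sg \<phi> (x, s)" by (simp add: sg_def sgn_minus del: grad_apply)
    show "sg \<phi> (x, s) \<in> Sgn (grad w (x, s))" by (auto simp: sg_def Sgn_def sgn_if simp del: grad_apply)
  qed
  define A where "A = ob ` {g. subgrad w g}"
  have A: "A \<noteq> {}" "bdd_below A" using sg by (auto simp: A_def ob_def intro!: bdd_belowI[of _ 0] sum_nonneg)
  have "\<exists>g. subgrad w g \<and> ob g < Inf A + 1 / real (Suc n)" for n
  proof -
    have "\<exists>y\<in>A. y < Inf A + 1 / real (Suc n)" using cInf_lessD[OF A(1), of "Inf A + 1 / real (Suc n)"] by auto
    then show ?thesis by (auto simp: A_def)
  qed
  then obtain g where g: "\<And>n. subgrad w (g n)" "\<And>n. ob (g n) < Inf A + 1 / real (Suc n)" by metis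
  obtain j h where h: "strict_mono (j :: nat \<Rightarrow> nat)" "subgrad w h" "\<And>x s. x \<in> V \<Longrightarrow> s \<in> S \<Longrightarrow> (\<lambda>n. g (j n) (x, s)) \<longlonglongrightarrow> h (x, s)"
    using subgrad_compact[of w g, OF g(1)] by blast
  have "(\<lambda>n. ob (g (j n))) \<longlonglongrightarrow> ob h" unfolding ob_def diverg_def
    by (intro tendsto_intros h(3)) (use F in auto)
  moreover have "(\<lambda>n. Inf A + 1 / real (Suc (j n))) \<longlonglongrightarrow> Inf A + 0"
    using LIMSEQ_subseq_LIMSEQ[OF LIMSEQ_Suc[OF lim_1_over_n] h(1)] by (intro tendsto_intros) (simp add: o_def)
  ultimately have "ob h \<le> Inf A + 0"
    by (rule LIMSEQ_le) (use g(2) in \<open>auto intro: less_imp_le\<close>)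
  then have min: "ob h \<le> ob g'" if "subgrad w g'" for g'
    using cInf_lower[OF _ A(2), of "ob g'"] that by (auto simp: A_def)
  define e where "e x = diverg h x + b x" for x
  define \<phi> where "\<phi> x = (if x \<in> F then e x else 0)" for x
  have f\<phi>: "fin \<phi>" by (rule finite_subset[OF _ F(1)]) (auto simp: \<phi>_def split: if_splits)
  define g' where "g' = sg \<phi>"
  define d where "d x = diverg g' x - diverg h x" for x
  \<comment> \<open>First-order optimality of \<open>h\<close> along the segment from
    \<open>h\<close> to \<open>g'\<close>, which consists of subgradients by convexity.\<close>
  have first: "0 \<le> (\<Sum>x\<in>F. 2 * (e x * d x))"
  proof (rule affine_small_le[of 1])
    fix t :: real assume t: "0 < t" "t \<le> 1"
    define gt where "gt = (\<lambda>e. (1 - t) * h e + t * g' e)"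
    have "subgrad w gt" unfolding subgrad_def
    proof (intro ballI conjI)
      fix x s assume xs: "x \<in> V" "s \<in> S"
      then show "gt (x \<otimes> s, inv s) = - gt (x, s)" using h(2) sg[of \<phi>] by (simp add: gt_def g'_def subgrad_def)
      have "h (x, s) \<in> Sgn (grad w (x, s))" "g' (x, s) \<in> Sgn (grad w (x, s))"
        using h(2) sg[of \<phi>] xs by (auto simp: subgrad_def g'_def simp del: grad_apply)
      moreover have "convex (Sgn a)" for a by (simp add: Sgn_def)
      ultimately have "(1 - t) *\<^sub>R h (x, s) + t *\<^sub>R g' (x, s) \<in> Sgn (grad w (x, s))"
        using t by (intro convexD) auto
      then show "gt (x, s) \<in> Sgn (grad w (x, s))" by (simp add: gt_def)
    qed
    then have "ob h \<le> ob gt" by (rule min)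
    also have "ob gt = (\<Sum>x\<in>F. (e x)\<^sup>2 + t * (2 * (e x * d x) + t * (d x)\<^sup>2))"
      unfolding ob_def
    proof (rule sum.cong[OF refl])
      fix x
      have "diverg gt x = diverg h x + t * d x"
      proof -
        have "gt e = h e + t * (g' e - h e)" for e by (simp add: gt_def algebra_simps)
        then show ?thesis by (simp add: diverg_def d_def sum.distrib sum_distrib_left[symmetric] sum_subtractf)
      qed
      then show "(diverg gt x + b x)\<^sup>2 = (e x)\<^sup>2 + t * (2 * (e x * d x) + t * (d x)\<^sup>2)"
        by (simp add: e_def power2_eq_square algebra_simps)
    qed
    also have "\<dots> = ob h + t * ((\<Sum>x\<in>F. 2 * (e x * d x)) + t * (\<Sum>x\<in>F. (d x)\<^sup>2))"
      by (simp add: sum.distrib ob_def e_def sum_distrib_left algebra_simps)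
    finally have "0 \<le> t * ((\<Sum>x\<in>F. 2 * (e x * d x)) + t * (\<Sum>x\<in>F. (d x)\<^sup>2))" by simp
    then show "0 + t * 0 \<le> (\<Sum>x\<in>F. 2 * (e x * d x)) + t * (\<Sum>x\<in>F. (d x)\<^sup>2)" using t by (simp add: zero_le_mult_iff)
  qed simp
  have anti: "g' (x \<otimes> s, inv s) = - g' (x, s)" if "x \<in> V" "s \<in> S" for x s
    using sg[of \<phi>] that by (simp add: subgrad_def g'_def)
  have fs: "(\<Sum>\<^sub>\<infinity>x\<in>V. a x * \<phi> x) = (\<Sum>x\<in>F. a x * e x)" for a
  proof -
    have "(\<Sum>\<^sub>\<infinity>x\<in>V. a x * \<phi> x) = (\<Sum>\<^sub>\<infinity>x\<in>F. a x * e x)"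
      by (rule infsum_cong_neutral) (use F in \<open>auto simp: \<phi>_def\<close>)
    then show ?thesis using F by simp
  qed
  have "(\<Sum>\<^sub>\<infinity>e\<in>V \<times> S. dderiv (grad w e) (grad \<phi> e)) = (\<Sum>\<^sub>\<infinity>e\<in>V \<times> S. g' e * grad \<phi> e)"
    by (rule infsum_cong) (simp add: g'_def sg_def dderiv_def abs_sgn mult.commute del: grad_apply)
  also have "\<dots> = - 2 * (\<Sum>x\<in>F. diverg g' x * e x)"
    using div_formula(2)[of g', OF anti f\<phi>] fs[of "diverg g'"] by (simp add: diverg_def)
  finally have "(\<Sum>x\<in>F. b x * e x) \<le> - (\<Sum>x\<in>F. diverg g' x * e x)" using ineq[OF f\<phi>] fs[of b] by simp
  \<comment> \<open>The residual is \<open>e = diverg h + b\<close>, and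
    \<open>diverg h = diverg g' - d\<close>. The first two sums together are at most 0 by the
    hypothesis tested with \<open>\<phi>\<close>, the last is nonnegative by optimality.\<close>
  moreover have "(\<Sum>x\<in>F. (e x)\<^sup>2) = (\<Sum>x\<in>F. b x * e x) + (\<Sum>x\<in>F. diverg g' x * e x) - (\<Sum>x\<in>F. e x * d x)"
    by (simp add: sum.distrib[symmetric] sum_subtractf[symmetric] d_def e_def power2_eq_square algebra_simps)
  ultimately have "(\<Sum>x\<in>F. (e x)\<^sup>2) \<le> 0" using first by (simp add: sum_distrib_left[symmetric])
  then have "(\<Sum>x\<in>F. (e x)\<^sup>2) = 0" by (simp add: order.antisym sum_nonneg)
  then have "e x = 0" if "x \<in> F" for x using F(1) that by (simp add: sum_nonneg_eq_0_iff)
  then show ?thesis using h(2) by (intro exI[of _ h]) (auto simp: e_def add_eq_0_iff)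
qed

text \<open>Exhaustion of the group by finite sets; at each vertex the equation holds from some
  index on and passes to the limit.\<close>

lemma subgrad_solve:
  assumes ineq: "\<And>\<phi>. fin \<phi> \<Longrightarrow> 2 * (\<Sum>\<^sub>\<infinity>x\<in>V. b x * \<phi> x) \<le> (\<Sum>\<^sub>\<infinity>e\<in>V \<times> S. dderiv (grad w e) (grad \<phi> e))"
  shows "\<exists>g. subgrad w g \<and> (\<forall>x\<in>V. diverg g x = - b x)"
proof -
  define F where "F n = from_nat_into V ` {..<n}" for n
  have F: "finite (F n)" "F n \<subseteq> V" for n
    using from_nat_into[of V] V_infinite by (auto simp: F_def)
  have "\<exists>g. subgrad w g \<and> (\<forall>x\<in>F n. diverg g x = - b x)" for n
    by (rule subgrad_solve_finite[OF ineq F])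
  then obtain g where g: "\<And>n. subgrad w (g n)" "\<And>n x. x \<in> F n \<Longrightarrow> diverg (g n) x = - b x" by metis
  obtain j h where h: "strict_mono (j :: nat \<Rightarrow> nat)" "subgrad w h" "\<And>x s. x \<in> V \<Longrightarrow> s \<in> S \<Longrightarrow> (\<lambda>n. g (j n) (x, s)) \<longlonglongrightarrow> h (x, s)"
    using subgrad_compact[of w g, OF g(1)] by blast
  have "diverg h x = - b x" if x: "x \<in> V" for x
  proof (rule LIMSEQ_unique)
    show "(\<lambda>n. diverg (g (j n)) x) \<longlonglongrightarrow> diverg h x" unfolding diverg_def by (intro tendsto_sum h(3) x)
    obtain k where k: "from_nat_into V k = x" using from_nat_into_surj[OF V_countable x] by blast
    have "x \<in> F (j n)" if "n > k" for n
      using seq_suble[OF h(1), of n] that k by (auto simp: F_def intro!: image_eqI[of _ _ k])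
    then have "\<forall>\<^sub>F n in sequentially. - b x = diverg (g (j n)) x"
      using g(2) by (intro eventually_sequentiallyI[of "Suc k"]) auto
    then show "(\<lambda>n. diverg (g (j n)) x) \<longlonglongrightarrow> - b x"
      by (rule Lim_transform_eventually[OF tendsto_const])
  qed
  then show ?thesis using h(2) by blast
qed

end

context choquard_kernel
begin

text \<open>For \<open>p = 1\<close> the energy is not differentiable where \<open>w\<close>
  vanishes. Dropping absolute values via \<open>\<bar>z\<bar> \<ge> z\<close> still gives a lower
  bound with the expected linear term and a quadratic error, which is enough against a
  maximum.\<close>

lemma Q_lower_expansion:
  assumes p: "p = 1" and w: "w \<in> lp r V" "\<And>x. x \<in> V \<Longrightarrow> 0 \<le> w x" and \<phi>: "fin \<phi>" and t: "t > 0"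
  shows "Q w + 2 * t * (\<Sum>\<^sub>\<infinity>x\<in>V. R w x * \<phi> x) - t\<^sup>2 * Q \<phi> \<le> Q (\<lambda>x. w x + t * \<phi> x)"
proof -
  have pw: "pw u x = \<bar>u x\<bar>" for u x unfolding pw_def using p by simp
  have \<phi>r: "\<phi> \<in> lp r V" by (rule fin_lp[OF \<phi>])
  have r1: "r \<ge> 1" using pr p by simp
  have wt: "(\<lambda>x. w x + t * \<phi> x) \<in> lp r V" by (rule lp_add(1)[OF w(1) lp_cmult(1)[OF \<phi>r] r1])
  define W where "W = (\<lambda>(x, y). k x y * (pw w x * pw w y))"
  define X where "X = (\<lambda>(x, y). \<phi> x * (k x y * pw w y))"
  define X' where "X' = (\<lambda>(x, y). \<phi> y * (k y x * pw w x))"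
  define P where "P = (\<lambda>(x, y). k x y * (pw \<phi> x * pw \<phi> y))"
  have W: "W summable_on V \<times> V" "infsum W (V \<times> V) = Q w" using B_bound(1)[OF w(1) w(1)] by (auto simp: W_def B_def)
  have P: "P summable_on V \<times> V" "infsum P (V \<times> V) = Q \<phi>" using B_bound(1)[OF \<phi>r \<phi>r] by (auto simp: P_def B_def)
  have X: "X summable_on V \<times> V"
    by (rule summable_on_abs_le[OF B_bound(1)[OF \<phi>r w(1)]]) (auto simp: X_def pw abs_mult k_nonneg)
  have X': "X' summable_on V \<times> V" "infsum X' (V \<times> V) = infsum X (V \<times> V)"
    using pair_swap[of "\<lambda>x y. \<phi> x * (k x y * pw w y)" V] X by (auto simp: X_def X'_def)
  have "infsum X (V \<times> V) = (\<Sum>\<^sub>\<infinity>x\<in>V. \<Sum>\<^sub>\<infinity>y\<in>V. X (x, y))" using infsum_Sigma_banach[OF X] by simp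
  also have "\<dots> = (\<Sum>\<^sub>\<infinity>x\<in>V. R w x * \<phi> x)"
    by (rule infsum_cong) (simp add: X_def R_def infsum_cmult_right' mult.commute)
  finally have Xi: "infsum X (V \<times> V) = (\<Sum>\<^sub>\<infinity>x\<in>V. R w x * \<phi> x)" .
  have "Q w + t * infsum X (V \<times> V) + t * infsum X (V \<times> V) - t\<^sup>2 * Q \<phi> =
      infsum (\<lambda>e. (W e + t * X e + t * X' e) - t\<^sup>2 * P e) (V \<times> V)"
  proof -
    note tX = summable_on_cmult_right[OF X, of t] and tX' = summable_on_cmult_right[OF X'(1), of t]
    show ?thesis
      unfolding infsum_diff_real(2)[OF summable_on_add[OF summable_on_add[OF W(1) tX] tX'] summable_on_cmult_right[OF P(1)]]
        infsum_add[OF summable_on_add[OF W(1) tX] tX'] infsum_add[OF W(1) tX] infsum_cmult_right' W P X' ..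
  qed
  also have "\<dots> \<le> Q (\<lambda>x. w x + t * \<phi> x)" unfolding B_def
  proof (rule infsum_mono[OF _ B_bound(1)[OF wt wt]])
    show "(\<lambda>e. (W e + t * X e + t * X' e) - t\<^sup>2 * P e) summable_on V \<times> V"
      using W P X X' by (intro infsum_diff_real(1) summable_on_add summable_on_cmult_right)
    fix e assume "e \<in> V \<times> V"
    then obtain x y where e: "e = (x, y)" "x \<in> V" "y \<in> V" by auto
    have k: "0 \<le> k x y" "k y x = k x y" using k_nonneg[OF e(2,3)] k_sym[OF e(3,2)] by auto
    have "w x * w y + t * (\<phi> x * w y) + t * (\<phi> y * w x) - t\<^sup>2 * (\<bar>\<phi> x\<bar> * \<bar>\<phi> y\<bar>) \<le> (w x + t * \<phi> x) * (w y + t * \<phi> y)"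
    proof -
      have "- (\<bar>\<phi> x\<bar> * \<bar>\<phi> y\<bar>) \<le> \<phi> x * \<phi> y" using abs_ge_minus_self[of "\<phi> x * \<phi> y"] by (simp add: abs_mult)
      then have "t\<^sup>2 * (- (\<bar>\<phi> x\<bar> * \<bar>\<phi> y\<bar>)) \<le> t\<^sup>2 * (\<phi> x * \<phi> y)" by (rule mult_left_mono) simp
      then show ?thesis by (simp add: power2_eq_square algebra_simps)
    qed
    also have "\<dots> \<le> \<bar>w x + t * \<phi> x\<bar> * \<bar>w y + t * \<phi> y\<bar>" by (simp add: abs_mult[symmetric])
    finally have "k x y * (w x * w y + t * (\<phi> x * w y) + t * (\<phi> y * w x) - t\<^sup>2 * (\<bar>\<phi> x\<bar> * \<bar>\<phi> y\<bar>)) \<le> k x y * (\<bar>w x + t * \<phi> x\<bar> * \<bar>w y + t * \<phi> y\<bar>)"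
      using k(1) by (rule mult_left_mono)
    then show "(W e + t * X e + t * X' e) - t\<^sup>2 * P e \<le> (case e of (x, y) \<Rightarrow> k x y * (pw (\<lambda>x. w x + t * \<phi> x) x * pw (\<lambda>x. w x + t * \<phi> x) y))"
      using w(2)[OF e(2)] w(2)[OF e(3)] k(2) by (simp add: e(1) W_def X_def X'_def P_def pw algebra_simps)
  qed
  finally show ?thesis by (simp add: Xi algebra_simps)
qed

end

lemma abs_add_small:
  fixes a b t :: real
  assumes "0 \<le> t" "a \<noteq> 0 \<Longrightarrow> t * \<bar>b\<bar> \<le> \<bar>a\<bar>"
  shows "\<bar>a + t * b\<bar> = \<bar>a\<bar> + t * (if a = 0 then \<bar>b\<bar> else sgn a * b)"
proof (cases "a = 0")
  case False
  have "\<bar>t * b\<bar> \<le> \<bar>a\<bar>" using assms False by (simp add: abs_mult)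
  then have "0 < a \<Longrightarrow> 0 \<le> a + t * b" "a < 0 \<Longrightarrow> a + t * b \<le> 0" by linarith+
  then show ?thesis using False by (cases "0 < a") auto
qed (use assms in \<open>simp add: abs_mult\<close>)

text \<open>A finitely supported variation changes finitely many edges, so for all small steps no
  nonzero difference changes sign and the total variation is exactly affine in the step.\<close>

lemma ex_small_step:
  fixes a b :: "'i \<Rightarrow> real"
  assumes "finite J"
  obtains t0 where "t0 > 0" "\<And>t i. 0 < t \<Longrightarrow> t \<le> t0 \<Longrightarrow> i \<in> J \<Longrightarrow> a i \<noteq> 0 \<Longrightarrow> t * \<bar>b i\<bar> \<le> \<bar>a i\<bar>"
proof -
  have "\<exists>t0>0. \<forall>t i. 0 < t \<longrightarrow> t \<le> t0 \<longrightarrow> i \<in> J \<longrightarrow> a i \<noteq> 0 \<longrightarrow> t * \<bar>b i\<bar> \<le> \<bar>a i\<bar>"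
    using assms
  proof (induction J rule: finite_induct)
    case (insert j J)
    then obtain t0 where t0: "t0 > 0" "\<And>t i. 0 < t \<Longrightarrow> t \<le> t0 \<Longrightarrow> i \<in> J \<Longrightarrow> a i \<noteq> 0 \<Longrightarrow> t * \<bar>b i\<bar> \<le> \<bar>a i\<bar>" by blast
    define t1 where "t1 = (if a j = 0 then t0 else min t0 (\<bar>a j\<bar> / (\<bar>b j\<bar> + 1)))"
    have t1: "t1 > 0" "t1 \<le> t0" using t0(1) by (auto simp: t1_def)
    have "t * \<bar>b j\<bar> \<le> \<bar>a j\<bar>" if "0 < t" "t \<le> t1" "a j \<noteq> 0" for t
    proof -
      have "t * \<bar>b j\<bar> \<le> t1 * (\<bar>b j\<bar> + 1)" using that t1 by (intro mult_mono) auto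
      also have "\<dots> \<le> \<bar>a j\<bar> / (\<bar>b j\<bar> + 1) * (\<bar>b j\<bar> + 1)" using that by (intro mult_right_mono) (auto simp: t1_def)
      also have "\<dots> = \<bar>a j\<bar>" by (simp add: add_nonneg_eq_0_iff)
      finally show ?thesis .
    qed
    then show ?case using t1 t0(2) by (intro exI[of _ t1]) auto
  qed (auto intro: exI[of _ 1])
  then show thesis using that by blast
qed

context cayley
begin

theorem one_laplace_solution:
  fixes \<alpha> :: real
  assumes \<alpha>: "0 < \<alpha>" "\<alpha> < real N - 2"
  shows "\<exists>u. (\<forall>x\<in>V. u x \<ge> 0) \<and> (\<exists>x\<in>V. u x \<noteq> 0) \<and> solves_1_laplace G S \<alpha> u"
proof -
  have \<alpha>N: "\<alpha> < N" using \<alpha> by auto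
  define m where "m = N * 1 / (real N - 1)"
  have "m < 2 * N * 1 / (N + \<alpha>)"
  proof -
    have "m < N * 1 / ((N + \<alpha>) / 2)" unfolding m_def
      by (rule divide_strict_left_mono) (use \<alpha> N3 in \<open>auto intro!: mult_pos_pos\<close>)
    then show ?thesis by (simp add: mult_ac)
  qed
  then obtain r where r: "m < r" "1 < r" "r < 2 * N * 1 / (N + \<alpha>)"
    using ex_exponent[OF \<alpha>(1) \<alpha>N, of 1 m] by auto
  have ck: "choquard_kernel G S N (offdiag_pot \<alpha>) 1 r" by (rule choquard_kernel_offdiag_pot) (use \<alpha> \<alpha>N r in auto)
  obtain C where var: "variational G S N (offdiag_pot \<alpha>) 1 r grad (V \<times> S) 1 m C"
    using variational_D1[OF ck] N3 r unfolding m_def by auto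
  interpret variational G S N "offdiag_pot \<alpha>" 1 r grad "V \<times> S" 1 m C by (rule var)
  interpret green_variational G S N "offdiag_pot \<alpha>" 1 r grad "V \<times> S" 1 m C \<alpha>
    by unfold_locales (rule offdiag_pot_green[OF \<alpha>(1) \<alpha>N])
  obtain v where v: "v \<in> E" "nT v = 1" "Q v = K" by (rule maximizer_exists)
  define w where "w x = \<bar>v x\<bar>" for x
  have gw: "grad w \<in> lp 1 (V \<times> S)" "nT w \<le> nT v"
    by (rule lp_mono[of "grad v"]; use v in \<open>auto simp: E_def w_def\<close>)+
  have w: "w \<in> E" using gw v(1) by (simp add: E_def w_def lp_def)
  have "Q w = Q v" by (simp add: B_def pw_def[abs_def] w_def)
  then have wK: "nT w = 1" "Q w = K" using maximizer_improve[OF w] gw(2) v by auto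
  have w0: "w x \<ge> 0" for x by (simp add: w_def)
  have wr: "w \<in> lp r V" by (rule E_lp_r[OF w])
  have m1: "m \<ge> 1" using N3 by (simp add: m_def)
  \<comment> \<open>Comparing \<open>Q_lower_expansion\<close> with \<open>Q_le_hom\<close>, where
    \<open>2 * p / q = 2\<close>, gives to first order \<open>2 * L \<le> 2 * K * J\<close>;
    dividing by \<open>2 * K\<close> leads to this right-hand side.\<close>
  define b where "b x = R w x / (2 * K)" for x
  have ineq: "2 * (\<Sum>\<^sub>\<infinity>x\<in>V. b x * \<phi> x) \<le> (\<Sum>\<^sub>\<infinity>e\<in>V \<times> S. dderiv (grad w e) (grad \<phi> e))" (is "_ \<le> ?J") if \<phi>: "fin \<phi>" for \<phi>
  proof -
    define J where "J = {e \<in> V \<times> S. grad \<phi> e \<noteq> 0}"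
    have J: "finite J" "J \<subseteq> V \<times> S" using T_fin[OF \<phi>] by (auto simp: J_def)
    obtain t0 where t0: "t0 > 0" "\<And>t e. 0 < t \<Longrightarrow> t \<le> t0 \<Longrightarrow> e \<in> J \<Longrightarrow> grad w e \<noteq> 0 \<Longrightarrow> t * \<bar>grad \<phi> e\<bar> \<le> \<bar>grad w e\<bar>"
      using ex_small_step[OF J(1), of "grad w" "grad \<phi>"] by blast
    define L where "L = (\<Sum>\<^sub>\<infinity>x\<in>V. R w x * \<phi> x)"
    have dz: "dderiv a 0 = 0" for a by (simp add: dderiv_def)
    have ds: "(\<lambda>e. dderiv (grad w e) (grad \<phi> e)) summable_on V \<times> S"
      by (rule finite_nonzero_values_imp_summable_on, rule finite_subset[OF _ J(1)]) (auto simp: J_def dz simp del: grad_apply)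
    have "2 * L \<le> 2 * K * ?J"
    proof (rule affine_small_le[OF t0(1)])
      fix t assume t: "0 < t" "t \<le> t0"
      have gt: "\<bar>grad (\<lambda>x. w x + t * \<phi> x) e\<bar> = \<bar>grad w e\<bar> + t * dderiv (grad w e) (grad \<phi> e)" if "e \<in> V \<times> S" for e
      proof -
        have "\<bar>grad w e + t * grad \<phi> e\<bar> = \<bar>grad w e\<bar> + t * dderiv (grad w e) (grad \<phi> e)"
          unfolding dderiv_def
        proof (rule abs_add_small)
          show "t * \<bar>grad \<phi> e\<bar> \<le> \<bar>grad w e\<bar>" if "grad w e \<noteq> 0"
            using t0(2)[OF t _ that] \<open>e \<in> V \<times> S\<close> by (cases "grad \<phi> e = 0") (auto simp: J_def)
        qed (use t in simp)
        then show ?thesis using T_lin[OF that, of w t \<phi>] by simp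
      qed
      have "nT (\<lambda>x. w x + t * \<phi> x) = (\<Sum>\<^sub>\<infinity>e\<in>V \<times> S. \<bar>grad w e\<bar> + t * dderiv (grad w e) (grad \<phi> e))"
        unfolding psum_def
      proof (rule infsum_cong)
        have p1: "\<bar>z\<bar> powr 1 = \<bar>z\<bar>" for z :: real by simp
        show "\<bar>grad (\<lambda>x. w x + t * \<phi> x) e\<bar> powr 1 = \<bar>grad w e\<bar> + t * dderiv (grad w e) (grad \<phi> e)" if "e \<in> V \<times> S" for e
          by (rule trans[OF p1 gt[OF that]])
      qed
      also have "\<dots> = nT w + t * ?J"
        using gw(1) ds by (subst infsum_add) (auto simp: lp_def psum_def infsum_cmult_right' simp del: grad_apply intro!: summable_on_cmult_right)
      finally have n: "nT (\<lambda>x. w x + t * \<phi> x) = 1 + t * ?J" using wK by simp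
      have wt: "(\<lambda>x. w x + t * \<phi> x) \<in> E" by (rule E_add[OF w E_fin[OF \<phi>] m1])
      have nn: "0 \<le> 1 + t * ?J" using psum_nonneg[of 1 "V \<times> S" "grad (\<lambda>x. w x + t * \<phi> x)"] n by simp
      have "K + 2 * t * L - t\<^sup>2 * Q \<phi> \<le> K * (1 + t * ?J)\<^sup>2"
        using order_trans[OF Q_lower_expansion[OF refl wr w0 \<phi> t(1)] Q_le_hom[OF wt]] wK(2) n nn by (simp add: L_def)
      then have "t * (2 * L + t * - Q \<phi>) \<le> t * (2 * K * ?J + t * (K * ?J\<^sup>2))"
        by (simp add: power2_eq_square algebra_simps)
      then show "2 * L + t * - Q \<phi> \<le> 2 * K * ?J + t * (K * ?J\<^sup>2)" using t(1) by (simp only: mult_le_cancel_left_pos)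
    qed
    moreover have "(\<Sum>\<^sub>\<infinity>x\<in>V. b x * \<phi> x) = L / (2 * K)"
    proof -
      have "(\<Sum>\<^sub>\<infinity>x\<in>V. b x * \<phi> x) = (\<Sum>\<^sub>\<infinity>x\<in>V. 1 / (2 * K) * (R w x * \<phi> x))"
        by (rule infsum_cong) (simp add: b_def)
      then show ?thesis by (simp only: infsum_cmult_right' L_def) simp
    qed
    ultimately have "2 * K * (2 * (\<Sum>\<^sub>\<infinity>x\<in>V. b x * \<phi> x)) \<le> 2 * K * ?J" using K_pos by simp
    then show ?thesis using K_pos by (subst (asm) mult_le_cancel_left_pos) auto
  qed
  obtain g where g: "subgrad w g" "\<And>x. x \<in> V \<Longrightarrow> diverg g x = - b x" using subgrad_solve[OF ineq] by blast
  \<comment> \<open>The 1-Laplacian is unchanged by positive factors while the nonlocal term is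
    linear, so the constant is absorbed by scaling.\<close>
  define c where "c = 1 / (2 * K)"
  have c: "c > 0" using K_pos by (simp add: c_def)
  define u where "u x = c * w x" for x
  have up: "u y = c * pw w y" for y by (simp add: u_def pw_def w_def)
  \<comment> \<open>The generator of the edge from \<open>x\<close> to \<open>y\<close> is recovered
    as \<open>inv x \<otimes> y\<close>.\<close>
  define f where "f x y = g (x, inv x \<otimes> y)" for x y
  have f: "f x y = - f y x \<and> f x y \<in> Sgn (u y - u x)" if adj: "cayley_adj G S y x" for x y
  proof -
    obtain s where s: "s \<in> S" "y = x \<otimes> s" "x \<in> V" "y \<in> V" using adj by (auto simp: cayley_adj_def)
    have fx: "f x y = g (x, s)" using s by (simp add: f_def m_assoc[symmetric])
    have fy: "f y x = g (x \<otimes> s, inv s)" using s by (simp add: f_def inv_mult_group m_assoc)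
    have "Sgn (u y - u x) = Sgn (w y - w x)"
      using c by (simp add: Sgn_def u_def right_diff_distrib[symmetric] zero_less_mult_iff)
    then show ?thesis using g(1) s unfolding fx fy subgrad_def by simp
  qed
  have "(\<lambda>x. \<Sum>y\<in>nbrs G S x. f x y) \<in> laplacian_1 G S u"
    unfolding laplacian_1_def mem_Collect_eq by (intro exI[of _ f] conjI refl allI impI f)
  moreover have "(\<Sum>y\<in>nbrs G S x. f x y) + green_conv G S \<alpha> u x * u x ^ 0 = 0" if x: "x \<in> V" for x
  proof -
    have "(\<Sum>y\<in>nbrs G S x. f x y) = diverg g x"
      using x by (simp add: sum_nbrs diverg_def f_def m_assoc[symmetric])
    then show ?thesis using g(2)[OF x] green_conv_eq(2)[OF up wr x] by (simp add: b_def c_def)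
  qed
  moreover have "green_conv_defined G S \<alpha> u" by (rule green_conv_eq(1)[OF up wr])
  ultimately have "solves_1_laplace G S \<alpha> u" unfolding solves_1_laplace_def
    by (intro conjI bexI[of _ "\<lambda>x. \<Sum>y\<in>nbrs G S x. f x y"] ballI)
  moreover have "\<exists>x\<in>V. u x \<noteq> 0"
  proof (rule ccontr)
    assume "\<not> ?thesis"
    then have "w x = 0" if "x \<in> V" for x using that c by (auto simp: u_def)
    then show False using Q_zero[of w] wK K_pos by simp
  qed
  ultimately show ?thesis using w0 c by (intro exI[of _ u]) (auto simp: u_def)
qed

end

theorem theorem1p6:
  fixes G :: "('a, 'b) monoid_scheme" and S :: "'a set" and N :: nat
  assumes "group G"
    and "finite S" and "S \<subseteq> carrier G" and "set_inv\<^bsub>G\<^esub> S = S" and "generate G S = carrier G"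
    and "polynomial_growth G S N"
  shows
    "(N \<ge> 3 \<longrightarrow> (\<forall>\<alpha> p :: real. 0 < \<alpha> \<and> \<alpha> < real N - 2 \<and> 1 \<le> p \<and> p < (real N - \<alpha>) / 2 \<longrightarrow>
        (p > 1 \<longrightarrow> (\<exists>u. (\<forall>x\<in>carrier G. u x > 0) \<and>
            ground_state G S \<alpha> p (D1_space G S N p) (D1_norm G S p) u \<and>
            solves_p_laplace G S \<alpha> p u)) \<and>
        (p = 1 \<longrightarrow> (\<exists>u. (\<forall>x\<in>carrier G. u x \<ge> 0) \<and> (\<exists>x\<in>carrier G. u x \<noteq> 0) \<and>
            solves_1_laplace G S \<alpha> u))))
     \<and>
     (N \<ge> 5 \<longrightarrow> (\<forall>\<alpha> p :: real. 0 < \<alpha> \<and> \<alpha> < real N \<and> p > (real N + \<alpha>) / (real N - 4) \<longrightarrow>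
        (\<exists>u. (\<forall>x\<in>carrier G. u x > 0) \<and>
            ground_state G S \<alpha> p (D2_space G S N 2) (D2_norm G S 2) u \<and>
            solves_biharmonic G S \<alpha> p u)))
     \<and>
     (N \<ge> 5 \<longrightarrow> (\<forall>\<alpha> p :: real. 0 < \<alpha> \<and> \<alpha> < real N - 4 \<and> 1 < p \<and> p < (real N - \<alpha>) / 4 \<longrightarrow>
        (\<exists>u. (\<forall>x\<in>carrier G. u x > 0) \<and>
            ground_state G S \<alpha> p (D2_space G S N p) (D2_norm G S p) u \<and>
            solves_p_biharmonic G S \<alpha> p u)))"
proof (intro conjI impI allI)
  fix \<alpha> p :: real
  assume N: "3 \<le> N" and a: "0 < \<alpha> \<and> \<alpha> < real N - 2 \<and> 1 \<le> p \<and> p < (real N - \<alpha>) / 2"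
  interpret cayley G S N using assms N by (intro cayley.intro cayley_axioms.intro)
  show "\<exists>u. (\<forall>x\<in>carrier G. u x > 0) \<and> ground_state G S \<alpha> p (D1_space G S N p) (D1_norm G S p) u \<and> solves_p_laplace G S \<alpha> p u"
    if "1 < p" by (rule p_laplace_ground_state) (use a that in auto)
  show "\<exists>u. (\<forall>x\<in>carrier G. u x \<ge> 0) \<and> (\<exists>x\<in>carrier G. u x \<noteq> 0) \<and> solves_1_laplace G S \<alpha> u"
    by (rule one_laplace_solution) (use a in auto)
next
  fix \<alpha> p :: real
  assume N: "5 \<le> N" and a: "0 < \<alpha> \<and> \<alpha> < real N \<and> p > (real N + \<alpha>) / (real N - 4)"
  have N4: "real N - 4 > 0" using N by simp
  have "1 < (real N + \<alpha>) / (real N - 4)" using a N4 by simp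
  then have p: "1 < p" using a by linarith
  have "N + \<alpha> < p * (real N - 4)" using a N4 by (simp add: pos_divide_less_eq)
  \<comment> \<open>The lower bound on \<open>p\<close> is the comparison of exponents for
    \<open>q = 2\<close>.\<close>
  then have crit: "N * 2 / (real N - 2 * 2) < 2 * N * p / (N + \<alpha>)"
  proof -
    have "N * 2 / (real N - 4) = 2 * N * p / (p * (real N - 4))" using p by (simp add: mult_ac)
    also have "\<dots> < 2 * N * p / (N + \<alpha>)"
      by (rule divide_strict_left_mono) (use \<open>N + \<alpha> < p * (real N - 4)\<close> N p a N4 in \<open>auto intro!: mult_pos_pos\<close>)
    finally show ?thesis by simp
  qed
  interpret cayley G S N using assms N by (intro cayley.intro cayley_axioms.intro) auto
  \<comment> \<open>At \<open>t = 0\<close> the factor \<open>0 powr 0\<close> is 0, which the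
    factor \<open>t\<close> makes harmless; so the general operator with \<open>q = 2\<close> is the
    bilaplacian.\<close>
  have bi: "\<bar>t\<bar> powr (2 - 2) * t = t" for t :: real by simp
  show "\<exists>u. (\<forall>x\<in>carrier G. u x > 0) \<and> ground_state G S \<alpha> p (D2_space G S N 2) (D2_norm G S 2) u \<and> solves_biharmonic G S \<alpha> p u"
    using p_biharmonic_ground_state[of \<alpha> p 2] a p N crit unfolding bi solves_biharmonic_def by simp
next
  fix \<alpha> p :: real
  assume N: "5 \<le> N" and a: "0 < \<alpha> \<and> \<alpha> < real N - 4 \<and> 1 < p \<and> p < (real N - \<alpha>) / 4"
  \<comment> \<open>Cancelling \<open>N * p\<close> shows that this is the upper bound on
    \<open>p\<close>.\<close>
  have crit: "N * p / (N - 2 * p) < 2 * N * p / (N + \<alpha>)"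
  proof -
    have "N * p / (N - 2 * p) < N * p / ((N + \<alpha>) / 2)"
      by (rule divide_strict_left_mono) (use a N in \<open>auto intro!: mult_pos_pos\<close>)
    then show ?thesis by (simp add: mult_ac)
  qed
  interpret cayley G S N using assms N by (intro cayley.intro cayley_axioms.intro) auto
  show "\<exists>u. (\<forall>x\<in>carrier G. u x > 0) \<and> ground_state G S \<alpha> p (D2_space G S N p) (D2_norm G S p) u \<and> solves_p_biharmonic G S \<alpha> p u"
    unfolding solves_p_biharmonic_def by (rule p_biharmonic_ground_state) (use a crit in auto)
qed

end
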